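(* Suppose that $(X,d)$ is a complete and quasiconvex metric space and that $\Phi:X\to\mathbb{R}^N$ is a Lipschitz map with the property that for some constant $C_\Phi>0$ and all rectifiable curves $\gamma$ in $X$ we have $$\ell(\gamma)\le C_\Phi\,\ell(\Phi\circ\gamma).$$ Then for any $k\ge 1$ and any Lipschitz map $f:E\to X$ defined on a measurable set $E\subset\mathbb{R}^k$ the following conditions are equivalent: (1) $\mathcal{H}^k(f(E))=0$ in $X$; (2) $\mathcal{H}^k(\Phi(f(E)))=0$ in $\mathbb{R}^N$; (3) $\operatorname{rank}(\operatorname{ap}D(\Phi\circ f)(x))<k$ for $\mathcal{H}^k$-a.e. $x\in E$.
   Context: $\ell(\gamma)$ denotes the length of a curve $\gamma$ (in the respective metric space), and a curve is rectifiable if its length is finite. A metric space $(X,d)$ is quasiconvex if there is a constant $M\ge 1$ such that any two points $x,y\in X$ can be connected by a curve $\gamma$ of length $\ell(\gamma)\le M d(x,y)$. $\mathcal{H}^k$ is the $k$-dimensional Hausdorff measure (Lebesgue measure on $\mathbb{R}^k$). A measurable function $h:E\to\mathbb{R}$ on a measurable set $E\subset\mathbb{R}^k$ is approximately differentiable at $x\in E$ if there are a measurable set $E_x\subset E$ and a linear function $L:\mathbb{R}^k\to\mathbb{R}$ such that $x$ is a density point of $E_x$ and $\lim_{E_x\ni y\to x}\frac{h(y)-h(x)-L(y-x)}{|y-x|}=0$; the unique such $L$ is denoted $\operatorname{ap}Dh(x)$. For maps into $\mathbb{R}^N$ this is understood componentwise. Lipschitz maps $E\to\mathbb{R}^N$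 are approximately differentiable a.e. in $E$. *)

theory Defs
  imports "HOL-Analysis.Analysis"
begin

subsection \<open>Length of curves and quasiconvexity\<close>

text \<open>Curves are parametrised on \<open>[0,1]\<close>, as in the library's \<^const>\<open>path\<close>.\<close>

definition curve_length :: "(real \<Rightarrow> 'a::metric_space) \<Rightarrow> ennreal" where
  "curve_length \<gamma> =
     (SUP (n, t) \<in> {(n::nat, t::nat \<Rightarrow> real). t 0 = 0 \<and> t n = 1 \<and> (\<forall>i<n. t i < t (Suc i))}.
        \<Sum>i<n. ennreal (dist (\<gamma> (t i)) (\<gamma> (t (Suc i)))))"

definition rectifiable_curve :: "(real \<Rightarrow> 'a::metric_space) \<Rightarrow> bool" where
  "rectifiable_curve \<gamma> \<longleftrightarrow> path \<gamma> \<and> curve_length \<gamma> < \<infinity>"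

definition quasiconvex_space :: "'a::metric_space itself \<Rightarrow> bool" where
  "quasiconvex_space _ \<longleftrightarrow>
     (\<exists>M::real. M \<ge> 1 \<and>
        (\<forall>x y::'a. \<exists>\<gamma>. path \<gamma> \<and> pathstart \<gamma> = x \<and> pathfinish \<gamma> = y \<and>
           curve_length \<gamma> \<le> ennreal (M * dist x y)))"

subsection \<open>Hausdorff measure\<close>

text \<open>
  The Hausdorff (outer) measure of integer dimension, defined on all subsets and normalised so that
  it agrees with Lebesgue (outer) measure on \<open>\<real>\<^sup>k\<close>. Boundedness of the covering sets is
  required explicitly because the real-valued \<^const>\<open>diameter\<close> is meaningless on unbounded sets;
  empty sets are given weight 0 separately only because of \<open>0 ^ 0 = 1\<close>.
\<close>

definition hausdorff_weight :: "nat \<Rightarrow> 'a::metric_space set \<Rightarrow> ennreal" where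
  "hausdorff_weight k S =
     (if S = {} then 0 else ennreal (unit_ball_vol (real k) * (diameter S / 2) ^ k))"

definition hausdorff_premeasure :: "nat \<Rightarrow> real \<Rightarrow> 'a::metric_space set \<Rightarrow> ennreal" where
  "hausdorff_premeasure k \<delta> A =
     (INF C \<in> {C::nat \<Rightarrow> 'a set. A \<subseteq> (\<Union>i. C i) \<and> (\<forall>i. bounded (C i) \<and> diameter (C i) \<le> \<delta>)}.
        \<Sum>i. hausdorff_weight k (C i))"

definition hausdorff_measure :: "nat \<Rightarrow> 'a::metric_space set \<Rightarrow> ennreal" where
  "hausdorff_measure k A = (SUP \<delta> \<in> {0<..}. hausdorff_premeasure k \<delta> A)"

subsection \<open>Approximate differentiability\<close>

definition density_point :: "'a::euclidean_space set \<Rightarrow> 'a \<Rightarrow> bool" where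
  "density_point S x \<longleftrightarrow>
     ((\<lambda>r. measure lebesgue (S \<inter> ball x r) / measure lebesgue (ball x r)) \<longlongrightarrow> 1) (at_right 0)"

definition has_approx_derivative ::
    "'a::euclidean_space set \<Rightarrow> ('a \<Rightarrow> real) \<Rightarrow> ('a \<Rightarrow> real) \<Rightarrow> 'a \<Rightarrow> bool" where
  "has_approx_derivative E h L x \<longleftrightarrow>
     x \<in> E \<and> linear L \<and>
     (\<exists>E\<^sub>x. E\<^sub>x \<in> sets lebesgue \<and> E\<^sub>x \<subseteq> E \<and> density_point E\<^sub>x x \<and>
        ((\<lambda>y. (h y - h x - L (y - x)) / norm (y - x)) \<longlongrightarrow> 0) (at x within E\<^sub>x))"

definition approx_derivative :: "'a::euclidean_space set \<Rightarrow> ('a \<Rightarrow> real) \<Rightarrow> 'a \<Rightarrow> ('a \<Rightarrow> real)" where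
  "approx_derivative E h x = (THE L. has_approx_derivative E h L x)"

definition approx_differentiable_vec ::
    "'a::euclidean_space set \<Rightarrow> ('a \<Rightarrow> real^'n) \<Rightarrow> 'a \<Rightarrow> bool" where
  "approx_differentiable_vec E h x \<longleftrightarrow> (\<forall>j. \<exists>L. has_approx_derivative E (\<lambda>y. h y $ j) L x)"

definition approx_derivative_vec ::
    "'a::euclidean_space set \<Rightarrow> ('a \<Rightarrow> real^'n) \<Rightarrow> 'a \<Rightarrow> ('a \<Rightarrow> real^'n)" where
  "approx_derivative_vec E h x = (\<lambda>v. \<chi> j. approx_derivative E (\<lambda>y. h y $ j) x v)"

end

theory Submission
  imports Defs
begin

text \<open>
  The map \<open>\<Phi> \<circ> f\<close> extends to a Lipschitz map \<open>G\<close> on \<open>\<real>\<^sup>k\<close>, which is differentiable almost everywhere by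
  Rademacher's theorem, and at density points of \<open>E\<close> the approximate derivative is the derivative
  of \<open>G\<close>.

  Where the derivative is injective, \<open>G\<close> is locally expanding, so these points form countably many
  pieces on which \<open>G\<close> has a Lipschitz inverse; if the image is null, so are the pieces. This gives
  \<open>(2) \<Longrightarrow> (3)\<close>.

  For \<open>(3) \<Longrightarrow> (1)\<close>, almost all of \<open>E\<close> is, for every \<open>m\<close>, a countable union of sets on which \<open>G\<close> has speed at
  most \<open>1/m\<close> in some fixed direction \<open>v\<close>. Fix such a set \<open>A\<close>. On a line parallel to \<open>v\<close> that lies mostly
  in \<open>A\<close>, fill the gaps of \<open>f\<close> by quasigeodesics; the resulting curve has a short image under \<open>\<Phi>\<close>,
  hence is short itself, so \<open>f\<close> is nearly constant on the line. A cube of side \<open>r\<close> filled almost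
  entirely by \<open>A\<close> is a union of \<open>m\<^sup>k\<^sup>-\<^sup>1\<close> tubes in direction \<open>v\<close>, each containing such a line, so its image is
  covered by \<open>m\<^sup>k\<^sup>-\<^sup>1\<close> sets of diameter \<open>O(r/m)\<close>, of total weight \<open>O(r\<^sup>k/m)\<close>. Summing over cubes, the
  content of \<open>f(A)\<close> is \<open>O(|A|/m)\<close>, and \<open>m\<close> tends to infinity.
\<close>

subsection \<open>Hausdorff content\<close>

text \<open>The argument runs with the content instead of the measure: it has the same null sets, is
  countably subadditive and asks for no bound on diameters. (1) implies (2) because Lipschitz maps
  preserve nullity.

  The obstacle in (3) implies (1) is that X has no linear structure: \<open>f\<close> has in general
  no Lipschitz extension with values in X, and the hypothesis on \<Phi> speaks only of whole curves.
  So only the composition is extended, while \<open>f\<close> is completed one line at a time.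
  Filling a gap costs a multiple of its length, which makes only those lines usable that lie almost
  entirely in the set; Tonelli's theorem supplies one in each tube of a good cube.

  Cubes in which the set misses more than the fraction 1/m^k of the volume get only the plain
  Lipschitz estimate. Their total volume is at most m^k times the excess of the covering by cubes,
  and this excess can be made small after m has been fixed.\<close>

lemma diameter_le_metric:
  fixes S :: "'a::metric_space set"
  assumes "\<And>x y. x \<in> S \<Longrightarrow> y \<in> S \<Longrightarrow> dist x y \<le> d" "0 \<le> d"
  shows "diameter S \<le> d"
  using assms unfolding diameter_def by (auto intro!: cSUP_least)

lemma bounded_metric:
  fixes S :: "'a::metric_space set"
  assumes "\<And>x y. x \<in> S \<Longrightarrow> y \<in> S \<Longrightarrow> dist x y \<le> d"
  shows "bounded S"
  using assms unfolding bounded_def by (cases "S = {}") (auto, meson)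

lemma hausdorff_weight_le:
  assumes "diameter S \<le> d" "bounded S"
  shows "hausdorff_weight k S \<le> ennreal (unit_ball_vol (real k) * (d / 2) ^ k)"
  using assms diameter_ge_0[of S] unfolding hausdorff_weight_def
  by (auto intro!: ennreal_leI mult_left_mono power_mono)

text \<open>The content usually written H^k_\<infinity>, the case of the premeasure in which
  covering sets may be arbitrarily large.\<close>

definition hausdorff_content :: "nat \<Rightarrow> 'a::metric_space set \<Rightarrow> ennreal" where
  "hausdorff_content k A =
     (INF C \<in> {C::nat \<Rightarrow> 'a set. A \<subseteq> (\<Union>i. C i) \<and> (\<forall>i. bounded (C i))}.
        \<Sum>i. hausdorff_weight k (C i))"

lemma hausdorff_content_le_cover:
  assumes "A \<subseteq> (\<Union>i. C i)" "\<And>i. bounded (C i)"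
  shows "hausdorff_content k A \<le> (\<Sum>i. hausdorff_weight k (C i))"
  unfolding hausdorff_content_def by (rule INF_lower) (use assms in auto)

lemma hausdorff_content_lessE:
  assumes "hausdorff_content k A < e"
  obtains C where "A \<subseteq> (\<Union>i. C i)" "\<And>i. bounded (C i)" "(\<Sum>i. hausdorff_weight k (C i)) < e"
  using assms unfolding hausdorff_content_def INF_less_iff by auto

lemma hausdorff_content_le_premeasure: "hausdorff_content k A \<le> hausdorff_premeasure k \<delta> A"
  unfolding hausdorff_content_def hausdorff_premeasure_def by (rule INF_superset_mono) auto

text \<open>A covering of small total weight consists of sets of small diameter, so the
  restriction to small diameters does not matter for null sets.\<close>

lemma hausdorff_measure_eq_0_iff:
  assumes "k > 0"
  shows "hausdorff_measure k A = 0 \<longleftrightarrow> hausdorff_content k A = 0"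
proof
  assume "hausdorff_measure k A = 0"
  then have "hausdorff_premeasure k 1 A \<le> 0"
    unfolding hausdorff_measure_def by (metis SUP_upper greaterThan_iff zero_less_one)
  with hausdorff_content_le_premeasure[of k A 1] show "hausdorff_content k A = 0"
    by auto
next
  assume 0: "hausdorff_content k A = 0"
  have "hausdorff_premeasure k \<delta> A \<le> 0" if \<delta>: "\<delta> > 0" for \<delta>
  proof (rule ennreal_le_epsilon)
    fix e :: real assume e: "e > 0"
    \<comment> \<open>The second entry of the minimum is the weight of a set of diameter \<delta>,
      so a covering of smaller total weight contains no set of larger diameter.\<close>
    define e' where "e' = min e (unit_ball_vol (real k) * (\<delta> / 2) ^ k)"
    have e': "e' > 0" unfolding e'_def using e \<delta> by simp
    then obtain C where C: "A \<subseteq> (\<Union>i. C i)" "\<And>i. bounded (C i)"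
        "(\<Sum>i. hausdorff_weight k (C i)) < ennreal e'"
      using hausdorff_content_lessE[of k A "ennreal e'"] 0 by auto
    have "diameter (C i) \<le> \<delta>" for i
    proof (cases "C i = {}")
      case True then show ?thesis using \<delta> by simp
    next
      case False
      have "hausdorff_weight k (C i) \<le> (\<Sum>i. hausdorff_weight k (C i))"
        using sum_le_suminf[OF summableI, of "{i}" "\<lambda>i. hausdorff_weight k (C i)"] by simp
      also have "\<dots> < ennreal e'" by (rule C)
      finally have "unit_ball_vol (real k) * (diameter (C i) / 2) ^ k < e'"
        using False diameter_ge_0[OF C(2)[of i]] unfolding hausdorff_weight_def
        by (simp add: ennreal_less_iff)
      also have "\<dots> \<le> unit_ball_vol (real k) * (\<delta> / 2) ^ k" by (simp add: e'_def)
      finally have "(diameter (C i) / 2) ^ k < (\<delta> / 2) ^ k"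
        by simp
      then have "diameter (C i) / 2 < \<delta> / 2"
        by (rule power_less_imp_less_base) (use \<delta> in simp)
      then show ?thesis by simp
    qed
    then have "hausdorff_premeasure k \<delta> A \<le> (\<Sum>i. hausdorff_weight k (C i))"
      unfolding hausdorff_premeasure_def by (intro INF_lower) (use C in auto)
    also have "\<dots> \<le> ennreal e'" using C(3) by simp
    also have "\<dots> \<le> 0 + ennreal e" using e'_def by (simp add: ennreal_leI)
    finally show "hausdorff_premeasure k \<delta> A \<le> 0 + ennreal e" .
  qed
  then show "hausdorff_measure k A = 0"
    unfolding hausdorff_measure_def
    by (metis (no_types, lifting) SUP_least greaterThan_iff le_zero_eq)
qed

lemma hausdorff_content_mono: "A \<subseteq> B \<Longrightarrow> hausdorff_content k A \<le> hausdorff_content k B"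
  unfolding hausdorff_content_def by (rule INF_superset_mono) auto

text \<open>Nearly optimal coverings of the single sets, with error e / 2^(i+1) for
  \<open>A i\<close>, are merged into one sequence by \<open>prod_decode\<close>. Such coverings
  exist because each content may be assumed finite.\<close>

lemma hausdorff_content_UN:
  "hausdorff_content k (\<Union>i::nat. A i) \<le> (\<Sum>i. hausdorff_content k (A i))"
proof (rule ennreal_le_epsilon)
  fix e :: real assume e: "e > 0" and fin: "(\<Sum>i. hausdorff_content k (A i)) < top"
  define E where "E i = e * (1/2) ^ Suc i" for i
  have E: "E i > 0" for i unfolding E_def using e by simp
  have "\<exists>C. A i \<subseteq> (\<Union>j. C j) \<and> (\<forall>j. bounded (C j)) \<and>
      (\<Sum>j. hausdorff_weight k (C j)) < hausdorff_content k (A i) + ennreal (E i)" for i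
  proof -
    have "hausdorff_content k (A i) \<le> (\<Sum>i. hausdorff_content k (A i))"
      using sum_le_suminf[OF summableI, of "{i}" "\<lambda>i. hausdorff_content k (A i)"] by simp
    with fin have "hausdorff_content k (A i) < top" by (rule order.strict_trans1[rotated])
    then have "hausdorff_content k (A i) < hausdorff_content k (A i) + ennreal (E i)"
      using E[of i] by (simp add: ennreal_add_left_cancel_less)
    then show ?thesis by (rule hausdorff_content_lessE) blast
  qed
  then obtain C where C: "\<And>i. A i \<subseteq> (\<Union>j. C i j)" "\<And>i j. bounded (C i j)"
      "\<And>i. (\<Sum>j. hausdorff_weight k (C i j)) < hausdorff_content k (A i) + ennreal (E i)"
    by metis
  define D where "D n = case_prod C (prod_decode n)" for n
  have "hausdorff_content k (\<Union>i. A i) \<le> (\<Sum>n. hausdorff_weight k (D n))"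
  proof (rule hausdorff_content_le_cover)
    show "(\<Union>i. A i) \<subseteq> (\<Union>n. D n)"
    proof
      fix x assume "x \<in> (\<Union>i. A i)"
      then obtain i j where "x \<in> C i j" using C(1) by blast
      then have "x \<in> D (prod_encode (i, j))" by (simp add: D_def)
      then show "x \<in> (\<Union>n. D n)" by blast
    qed
    show "bounded (D n)" for n unfolding D_def using C(2) by (simp split: prod.split)
  qed
  also have "\<dots> = (\<Sum>i. \<Sum>j. hausdorff_weight k (C i j))"
    using suminf_ennreal_2dimen[of "\<lambda>i. \<Sum>j. hausdorff_weight k (C i j)" "\<lambda>(i, j). hausdorff_weight k (C i j)"]
    unfolding D_def by (simp add: o_def case_prod_unfold)
  also have "\<dots> \<le> (\<Sum>i. hausdorff_content k (A i) + ennreal (E i))"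
    using C(3) by (intro suminf_le summableI) (simp add: less_imp_le)
  also have "\<dots> = (\<Sum>i. hausdorff_content k (A i)) + (\<Sum>i. ennreal (E i))"
    by (rule suminf_add[symmetric]) (auto intro: summableI)
  also have "(\<Sum>i. ennreal (E i)) = ennreal e"
  proof (rule suminf_ennreal_eq)
    show "0 \<le> E i" for i using E[of i] by simp
    have "(\<lambda>i. e * (1/2) ^ Suc i) sums (e * 1)"
      by (rule sums_mult) (rule power_half_series)
    then show "E sums e" unfolding E_def by simp
  qed
  finally show "hausdorff_content k (\<Union>i. A i) \<le> (\<Sum>i. hausdorff_content k (A i)) + ennreal e" .
qed

lemma hausdorff_content_empty [simp]: "hausdorff_content k {} = 0"
  using hausdorff_content_le_cover[of "{}" "\<lambda>_. {}" k] by (simp add: hausdorff_weight_def)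

lemma hausdorff_content_Un: "hausdorff_content k (A \<union> B) \<le> hausdorff_content k A + hausdorff_content k B"
proof -
  define C where "C i = (if i = 0 then A else if i = Suc 0 then B else {})" for i
  have "A \<union> B = (\<Union>i. C i)" unfolding C_def by (auto split: if_splits)
  then have "hausdorff_content k (A \<union> B) \<le> (\<Sum>i. hausdorff_content k (C i))"
    using hausdorff_content_UN by metis
  also have "\<dots> = (\<Sum>i\<in>{0, Suc 0}. hausdorff_content k (C i))"
    by (rule suminf_finite) (auto simp: C_def)
  also have "\<dots> = hausdorff_content k A + hausdorff_content k B"
    by (simp add: C_def)
  finally show ?thesis .
qed

lemma hausdorff_content_UN_finite:
  "finite I \<Longrightarrow> hausdorff_content k (\<Union>i\<in>I. A i) \<le> (\<Sum>i\<in>I. hausdorff_content k (A i))"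
proof (induction I rule: finite_induct)
  case (insert x F)
  have "hausdorff_content k (\<Union>i\<in>insert x F. A i) \<le>
      hausdorff_content k (A x) + hausdorff_content k (\<Union>i\<in>F. A i)"
    using hausdorff_content_Un by (metis UN_insert)
  also have "\<dots> \<le> hausdorff_content k (A x) + (\<Sum>i\<in>F. hausdorff_content k (A i))"
    by (intro add_left_mono insert.IH)
  finally show ?case using insert.hyps by simp
qed simp

lemma hausdorff_content_le:
  assumes "\<And>x y. x \<in> S \<Longrightarrow> y \<in> S \<Longrightarrow> dist x y \<le> d" "0 \<le> d"
  shows "hausdorff_content k S \<le> ennreal (unit_ball_vol (real k) * (d / 2) ^ k)"
proof -
  define C where "C i = (if i = 0 then S else {})" for i :: nat
  have b: "bounded S" by (rule bounded_metric) (use assms in auto)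
  have "hausdorff_content k S \<le> (\<Sum>i. hausdorff_weight k (C i))"
    using b by (intro hausdorff_content_le_cover) (auto simp: C_def)
  also have "\<dots> = (\<Sum>i\<in>{0}. hausdorff_weight k (C i))"
    by (rule suminf_finite) (auto simp: C_def hausdorff_weight_def)
  also have "\<dots> \<le> ennreal (unit_ball_vol (real k) * (d / 2) ^ k)"
    using hausdorff_weight_le[OF diameter_le_metric[OF assms] b] by (simp add: C_def)
  finally show ?thesis .
qed

lemma hausdorff_content_lipschitz_null:
  assumes f: "L-lipschitz_on A f" and 0: "hausdorff_content k A = 0"
  shows "hausdorff_content k (f ` A) = 0"
proof -
  have L: "L \<ge> 0" using f by (rule lipschitz_on_nonneg)
  have "hausdorff_content k (f ` A) \<le> 0"
  proof (rule ennreal_le_epsilon)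
    fix e :: real assume e: "e > 0"
    \<comment> \<open>The summand 1 keeps the denominator positive when L vanishes.\<close>
    define e' where "e' = e / (L ^ k + 1)"
    have Lk: "L ^ k \<ge> 0" using L by simp
    have e': "e' > 0" unfolding e'_def using e Lk by (simp add: add_nonneg_pos)
    then obtain C where C: "A \<subseteq> (\<Union>i. C i)" "\<And>i. bounded (C i)"
        "(\<Sum>i. hausdorff_weight k (C i)) < ennreal e'"
      using hausdorff_content_lessE[of k A "ennreal e'"] 0 by auto
    \<comment> \<open>\<open>f\<close> is Lipschitz only on \<open>A\<close>, so a covering set is
      cut with \<open>A\<close> before it is mapped.\<close>
    define D where "D i = f ` (C i \<inter> A)" for i
    have le: "dist x y \<le> L * diameter (C i)" if xy: "x \<in> D i" "y \<in> D i" for x y i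
    proof -
      from xy obtain u v where uv: "u \<in> C i \<inter> A" "v \<in> C i \<inter> A" "x = f u" "y = f v"
        unfolding D_def by blast
      have "dist x y \<le> L * dist u v" using f uv by (auto intro: lipschitz_onD)
      also have "\<dots> \<le> L * diameter (C i)"
        using uv C(2) L by (intro mult_left_mono diameter_bounded_bound) auto
      finally show ?thesis .
    qed
    have bD: "bounded (D i)" for i using le by (rule bounded_metric)
    have w: "hausdorff_weight k (D i) \<le> ennreal (L ^ k) * hausdorff_weight k (C i)" for i
    proof (cases "D i = {}")
      case False
      then have ne: "C i \<noteq> {}" unfolding D_def by auto
      have d: "diameter (C i) \<ge> 0" by (rule diameter_ge_0[OF C(2)])
      have "hausdorff_weight k (D i) \<le> ennreal (unit_ball_vol (real k) * (L * diameter (C i) / 2) ^ k)"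
        using le L d bD by (intro hausdorff_weight_le diameter_le_metric) auto
      also have "\<dots> = ennreal (L ^ k * (unit_ball_vol (real k) * (diameter (C i) / 2) ^ k))"
        by (simp add: power_mult_distrib power_divide mult_ac)
      also have "\<dots> = ennreal (L ^ k) * hausdorff_weight k (C i)"
        using ne L d by (simp add: hausdorff_weight_def ennreal_mult)
      finally show ?thesis .
    qed (simp add: hausdorff_weight_def)
    have "hausdorff_content k (f ` A) \<le> (\<Sum>i. hausdorff_weight k (D i))"
    proof (rule hausdorff_content_le_cover)
      show "f ` A \<subseteq> (\<Union>i. D i)" using C(1) unfolding D_def by blast
    qed (rule bD)
    also have "\<dots> \<le> (\<Sum>i. ennreal (L ^ k) * hausdorff_weight k (C i))"
      using w by (intro suminf_le summableI) auto
    also have "\<dots> = ennreal (L ^ k) * (\<Sum>i. hausdorff_weight k (C i))"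
      by (rule ennreal_suminf_cmult)
    also have "\<dots> \<le> ennreal (L ^ k) * ennreal e'"
      using C(3) by (intro mult_left_mono) auto
    also have "\<dots> = ennreal (L ^ k * e')" using Lk e' by (simp add: ennreal_mult)
    also have "\<dots> \<le> ennreal e"
    proof (rule ennreal_leI)
      show "L ^ k * e' \<le> e" unfolding e'_def using Lk e by (simp add: field_simps)
    qed
    finally show "hausdorff_content k (f ` A) \<le> 0 + ennreal e" by simp
  qed
  then show ?thesis by simp
qed

text \<open>Each covering set lies in the closed ball around one of its points whose radius is its
  full diameter. The weight uses half the diameter as radius, hence the factor 2^DIM.\<close>

lemma hausdorff_content_measurable_hull:
  fixes S :: "'a::euclidean_space set"
  assumes e: "hausdorff_content DIM('a) S < e"
  obtains T where "S \<subseteq> T" "T \<in> sets lebesgue" "emeasure lebesgue T \<le> ennreal (2 ^ DIM('a)) * e"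
proof -
  let ?k = "DIM('a)"
  obtain C where C: "S \<subseteq> (\<Union>i. C i)" "\<And>i. bounded (C i)"
      "(\<Sum>i. hausdorff_weight ?k (C i)) < e"
    using hausdorff_content_lessE[OF e] by auto
  define B where "B i = (if C i = {} then {} else cball (SOME x. x \<in> C i) (diameter (C i)))" for i
  have CB: "C i \<subseteq> B i" for i
  proof
    fix y assume y: "y \<in> C i"
    then have "(SOME x. x \<in> C i) \<in> C i" by (rule someI)
    then show "y \<in> B i"
      using y C(2)[of i] by (auto simp: B_def intro: diameter_bounded_bound)
  qed
  have mB: "B i \<in> sets lebesgue" for i by (simp add: B_def)
  have eB: "emeasure lebesgue (B i) = ennreal (2 ^ ?k) * hausdorff_weight ?k (C i)" for i
    using diameter_ge_0[OF C(2)[of i]]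
    by (simp add: B_def hausdorff_weight_def emeasure_cball flip: ennreal_mult)
       (simp add: power_divide)
  have "emeasure lebesgue (\<Union>i. B i) \<le> (\<Sum>i. emeasure lebesgue (B i))"
    by (rule emeasure_subadditive_countably) (use mB in auto)
  also have "\<dots> = ennreal (2 ^ ?k) * (\<Sum>i. hausdorff_weight ?k (C i))"
    unfolding eB by (rule ennreal_suminf_cmult)
  also have "\<dots> \<le> ennreal (2 ^ ?k) * e"
    using C(3) by (intro mult_left_mono) auto
  finally have "emeasure lebesgue (\<Union>i. B i) \<le> ennreal (2 ^ ?k) * e" .
  moreover have "S \<subseteq> (\<Union>i. B i)" using C(1) CB by blast
  moreover have "(\<Union>i. B i) \<in> sets lebesgue" using mB by blast
  ultimately show thesis using that by blast
qed

lemma negligible_if_hausdorff_content_0: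
  fixes S :: "'a::euclidean_space set"
  assumes 0: "hausdorff_content DIM('a) S = 0"
  shows "negligible S"
  unfolding negligible_outer_le
proof (intro allI impI)
  fix e :: real assume e: "e > 0"
  define e' where "e' = e / 2 ^ DIM('a)"
  have e': "e' > 0" using e by (simp add: e'_def)
  then have "hausdorff_content DIM('a) S < ennreal e'" using 0 by simp
  then obtain T where T: "S \<subseteq> T" "T \<in> sets lebesgue"
    "emeasure lebesgue T \<le> ennreal (2 ^ DIM('a)) * ennreal e'"
    by (rule hausdorff_content_measurable_hull)
  have "ennreal (2 ^ DIM('a)) * ennreal e' = ennreal e"
    using e by (subst ennreal_mult[symmetric]) (auto simp: e'_def)
  with T(3) have le: "emeasure lebesgue T \<le> ennreal e" by simp
  then have "emeasure lebesgue T < \<infinity>" by (simp add: order_le_less_trans)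
  with T(2) have "T \<in> lmeasurable" by (auto simp: fmeasurable_def)
  moreover have "measure lebesgue T \<le> e"
    using le e unfolding measure_def by (simp add: enn2real_leI)
  ultimately show "\<exists>T. S \<subseteq> T \<and> T \<in> lmeasurable \<and> measure lebesgue T \<le> e" using T(1) by blast
qed

text \<open>Serves to bound the measure of a rotated set: the content of a Lipschitz image is
  controlled by the measure of the original, and this lemma returns from content to measure.\<close>

lemma emeasure_le_hausdorff_content:
  fixes S :: "'a::euclidean_space set"
  assumes S: "S \<in> sets lebesgue" and c: "hausdorff_content DIM('a) S \<le> ennreal c" "c \<ge> 0"
  shows "emeasure lebesgue S \<le> ennreal (2 ^ DIM('a) * c)"
proof (rule ennreal_le_epsilon)
  fix e :: real assume e: "e > 0"
  define e' where "e' = e / 2 ^ DIM('a)"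
  have e': "e' > 0" using e by (simp add: e'_def)
  have "ennreal c < ennreal (c + e')" using c(2) e' by (simp add: ennreal_less_iff)
  with c(1) have "hausdorff_content DIM('a) S < ennreal (c + e')" by (rule order.strict_trans1)
  then obtain T where T: "S \<subseteq> T" "T \<in> sets lebesgue"
    "emeasure lebesgue T \<le> ennreal (2 ^ DIM('a)) * ennreal (c + e')"
    by (rule hausdorff_content_measurable_hull)
  have "emeasure lebesgue S \<le> emeasure lebesgue T" using T by (intro emeasure_mono) auto
  also note T(3)
  also have "ennreal (2 ^ DIM('a)) * ennreal (c + e') = ennreal (2 ^ DIM('a) * c + e)"
    using c(2) e e' by (subst ennreal_mult[symmetric]) (auto simp: e'_def distrib_left)
  also have "\<dots> = ennreal (2 ^ DIM('a) * c) + ennreal e" using c(2) e by (intro ennreal_plus) auto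
  finally show "emeasure lebesgue S \<le> ennreal (2 ^ DIM('a) * c) + ennreal e" .
qed

text \<open>A dyadic covering inside a large box. The box is chosen to be a cube, so all dyadic
  parts are cubes and have a single side length. The last bound controls the total volume that the
  cubes waste outside \<open>S\<close>.\<close>

lemma cube_cover:
  fixes S :: "'a::euclidean_space set"
  assumes S: "S \<in> lmeasurable" and b: "bounded S" and e: "e > 0"
  shows "\<exists>(a :: nat \<Rightarrow> 'a) (r :: nat \<Rightarrow> real). (\<forall>i. r i \<ge> 0) \<and> S \<subseteq> (\<Union>i. cbox (a i) (a i + r i *\<^sub>R One)) \<and>
    (\<Sum>i. ennreal (r i ^ DIM('a))) \<le> ennreal (measure lebesgue S + e) \<and>
    (\<Sum>i. emeasure lebesgue (cbox (a i) (a i + r i *\<^sub>R One) - S)) \<le> ennreal e"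
proof -
  obtain R where R: "R > 0" "S \<subseteq> cbox (-R *\<^sub>R One) (R *\<^sub>R One)"
  proof -
    obtain B where B: "B > 0" "\<And>x. x \<in> S \<Longrightarrow> norm x \<le> B" using b bounded_pos by blast
    have "x \<in> cbox (-B *\<^sub>R One) (B *\<^sub>R One)" if "x \<in> S" for x
    proof -
      have "\<bar>x \<bullet> i\<bar> \<le> B" if "i \<in> Basis" for i
        using Basis_le_norm[OF that, of x] B(2)[OF \<open>x \<in> S\<close>] by simp
      then show ?thesis by (force simp: mem_box abs_le_iff)
    qed
    with B(1) show ?thesis by (intro that) auto
  qed
  obtain \<D> where D: "countable \<D>"
      "\<And>K. K \<in> \<D> \<Longrightarrow> K \<subseteq> cbox (-R *\<^sub>R One) (R *\<^sub>R One) \<and> K \<noteq> {} \<and> (\<exists>c d::'a. K = cbox c d)"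
      "pairwise (\<lambda>A B. interior A \<inter> interior B = {}) \<D>"
      "\<And>u v. cbox u v \<in> \<D> \<Longrightarrow> \<exists>n. \<forall>i \<in> Basis. v \<bullet> i - u \<bullet> i = ((R *\<^sub>R One) \<bullet> i - (-R *\<^sub>R One) \<bullet> i)/2^n"
      "S \<subseteq> \<Union>\<D>" "\<Union>\<D> \<in> lmeasurable" "measure lebesgue (\<Union>\<D>) \<le> measure lebesgue S + e"
    using measurable_outer_intervals_bounded[OF S R(2) e] by metis
  have "\<exists>a r. r \<ge> 0 \<and> K = cbox a (a + r *\<^sub>R One)" if K: "K \<in> \<D>" for K
  proof -
    obtain c d where cd: "K = cbox c d" using D(2)[OF K] by blast
    then obtain n where n: "\<forall>i \<in> Basis. d \<bullet> i - c \<bullet> i = ((R *\<^sub>R One) \<bullet> i - (-R *\<^sub>R One) \<bullet> i)/2^n"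
      using D(4) K by blast
    have "d = c + (2 * R / 2 ^ n) *\<^sub>R One"
    proof (rule euclidean_eqI)
      fix i :: 'a assume i: "i \<in> Basis"
      then have "d \<bullet> i - c \<bullet> i = 2 * R / 2 ^ n" using n by simp
      then show "d \<bullet> i = (c + (2 * R / 2 ^ n) *\<^sub>R One) \<bullet> i"
        using i by (simp add: inner_add_left)
    qed
    moreover have "2 * R / 2 ^ n \<ge> 0" using R(1) by simp
    ultimately show ?thesis using cd by metis
  qed
  then obtain A \<rho> where A: "\<And>K. K \<in> \<D> \<Longrightarrow> \<rho> K \<ge> 0 \<and> K = cbox (A K) (A K + \<rho> K *\<^sub>R One)"
    by metis
  define g where "g = to_nat_on \<D>"
  have g: "inj_on g \<D>" unfolding g_def using D(1) by (rule inj_on_to_nat_on)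
  define I where "I = g ` \<D>"
  define h where "h = the_inv_into \<D> g"
  have h: "h i \<in> \<D>" "g (h i) = i" if "i \<in> I" for i
    using that g unfolding I_def h_def by (auto simp: the_inv_into_f_f)
  have hg: "h (g K) = K" if "K \<in> \<D>" for K using that g by (simp add: h_def the_inv_into_f_f)
  define a where "a i = (if i \<in> I then A (h i) else 0)" for i
  define r where "r i = (if i \<in> I then \<rho> (h i) else 0)" for i
  let ?Q = "\<lambda>i. cbox (a i) (a i + r i *\<^sub>R One)"
  let ?B = "\<lambda>i. box (a i) (a i + r i *\<^sub>R One)"
  have r: "r i \<ge> 0" for i unfolding r_def using A h by auto
  have Q: "?Q i = h i" if "i \<in> I" for i using that A h(1) by (simp add: a_def r_def)
  have cov: "S \<subseteq> (\<Union>i. ?Q i)"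
  proof
    fix x assume "x \<in> S"
    then obtain K where K: "K \<in> \<D>" "x \<in> K" using D(5) by blast
    then have "g K \<in> I" by (simp add: I_def)
    then have "x \<in> ?Q (g K)" using Q hg K by simp
    then show "x \<in> (\<Union>i. ?Q i)" by blast
  qed
  have B0: "?B i = {}" if "i \<notin> I" for i using that by (simp add: r_def)
  have BD: "(\<Union>i. ?B i) \<subseteq> \<Union>\<D>"
  proof
    fix x assume "x \<in> (\<Union>i. ?B i)"
    then obtain i where i: "x \<in> ?B i" by blast
    then have "i \<in> I" using B0 by blast
    then show "x \<in> \<Union>\<D>" using i Q h(1) box_subset_cbox by blast
  qed
  have dis: "disjoint_family ?B"
    unfolding disjoint_family_on_def
  proof (intro ballI impI)
    fix i j :: nat assume ij: "i \<noteq> j"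
    show "?B i \<inter> ?B j = {}"
    proof (cases "i \<in> I \<and> j \<in> I")
      case True
      then have "h i \<noteq> h j" using h ij by metis
      then have "interior (h i) \<inter> interior (h j) = {}"
        using D(3) h True by (auto simp: pairwise_def)
      then show ?thesis using Q True by (metis interior_cbox)
    qed (use B0 in auto)
  qed
  have eQ: "emeasure lebesgue (?B i) = ennreal (r i ^ DIM('a))" for i
    using r[of i] by (simp add: inner_add_left inner_diff_left)
  have "(\<Sum>i. ennreal (r i ^ DIM('a))) = emeasure lebesgue (\<Union>i. ?B i)"
    unfolding eQ[symmetric] by (rule suminf_emeasure) (use dis in auto)
  also have "\<dots> \<le> emeasure lebesgue (\<Union>\<D>)"
    using BD D(6) by (intro emeasure_mono) auto
  also have "\<dots> = ennreal (measure lebesgue (\<Union>\<D>))"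
    using D(6) by (rule emeasure_eq_measure2)
  also have "\<dots> \<le> ennreal (measure lebesgue S + e)" using D(7) by (rule ennreal_leI)
  finally have 1: "(\<Sum>i. ennreal (r i ^ DIM('a))) \<le> ennreal (measure lebesgue S + e)" .
  have SS: "S \<in> sets lebesgue" using S by simp
  \<comment> \<open>Faces are null, so the overlapping closed cubes may be replaced by the disjoint
    open ones.\<close>
  have eQB: "emeasure lebesgue (?Q i - S) = emeasure lebesgue (?B i - S)" for i
  proof (rule emeasure_eq_AE)
    have "negligible (?Q i - ?B i)" by (rule negligible_frontier_interval)
    then have "AE x in lebesgue. x \<notin> ?Q i - ?B i"
      using negligible_iff_null_sets AE_not_in by blast
    then show "AE x in lebesgue. (x \<in> ?Q i - S) = (x \<in> ?B i - S)"
      by eventually_elim (use box_subset_cbox in auto)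
  qed (use SS in auto)
  have "(\<Sum>i. emeasure lebesgue (?Q i - S)) = emeasure lebesgue (\<Union>i. ?B i - S)"
    unfolding eQB by (rule suminf_emeasure) (use dis SS in \<open>auto simp: disjoint_family_on_def\<close>)
  also have "\<dots> \<le> emeasure lebesgue (\<Union>\<D> - S)"
    using BD D(6) SS by (intro emeasure_mono) auto
  also have "\<dots> = ennreal (measure lebesgue (\<Union>\<D> - S))"
    using D(6) S by (intro emeasure_eq_measure2 fmeasurable.Diff)
  also have "measure lebesgue (\<Union>\<D> - S) = measure lebesgue (\<Union>\<D>) - measure lebesgue S"
    using D(5,6) SS by (intro measurable_measure_Diff)
  also have "ennreal \<dots> \<le> ennreal e" using D(7) by (intro ennreal_leI) simp
  finally have 2: "(\<Sum>i. emeasure lebesgue (?Q i - S)) \<le> ennreal e" .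
  from r cov 1 2 show ?thesis by blast
qed

section \<open>Lipschitz images of cubes and of bounded measurable sets\<close>

lemma dist_cube_le:
  fixes x y :: "'a::euclidean_space"
    and s :: real
  assumes "\<And>i. i \<in> Basis \<Longrightarrow> \<bar>x \<bullet> i - y \<bullet> i\<bar> \<le> s"
  shows "dist x y \<le> DIM('a) * s"
proof -
  have "dist x y \<le> (\<Sum>i\<in>Basis. \<bar>(x - y) \<bullet> i\<bar>)" unfolding dist_norm by (rule norm_le_l1)
  also have "\<dots> \<le> (\<Sum>i\<in>(Basis::'a set). s)" using assms by (intro sum_mono) (simp add: inner_diff_left)
  finally show ?thesis by simp
qed

lemma dist_cbox_cube_le:
  fixes x y :: "'a::euclidean_space"
    and r :: real
  assumes "x \<in> cbox a (a + r *\<^sub>R One)" "y \<in> cbox a (a + r *\<^sub>R One)"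
  shows "dist x y \<le> DIM('a) * r"
proof (rule dist_cube_le)
  fix i :: 'a assume "i \<in> Basis"
  then have "a \<bullet> i \<le> x \<bullet> i" "x \<bullet> i \<le> a \<bullet> i + r" "a \<bullet> i \<le> y \<bullet> i" "y \<bullet> i \<le> a \<bullet> i + r"
    using assms by (auto simp: mem_box inner_add_left)
  then show "\<bar>x \<bullet> i - y \<bullet> i\<bar> \<le> r" by (simp add: abs_le_iff)
qed

lemma hausdorff_content_lipschitz_cube:
  fixes f :: "'a::euclidean_space \<Rightarrow> 'b::metric_space"
  assumes f: "L-lipschitz_on S f" and r: "r \<ge> 0"
  shows "hausdorff_content DIM('a) (f ` (S \<inter> cbox a (a + r *\<^sub>R One)))
    \<le> ennreal (unit_ball_vol DIM('a) * (L * DIM('a) / 2) ^ DIM('a)) * ennreal (r ^ DIM('a))"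
proof -
  have L: "L \<ge> 0" using f by (rule lipschitz_on_nonneg)
  have "hausdorff_content DIM('a) (f ` (S \<inter> cbox a (a + r *\<^sub>R One)))
     \<le> ennreal (unit_ball_vol DIM('a) * ((L * (DIM('a) * r)) / 2) ^ DIM('a))"
  proof (rule hausdorff_content_le)
    fix x y assume "x \<in> f ` (S \<inter> cbox a (a + r *\<^sub>R One))" "y \<in> f ` (S \<inter> cbox a (a + r *\<^sub>R One))"
    then obtain u v where uv: "u \<in> S \<inter> cbox a (a + r *\<^sub>R One)" "v \<in> S \<inter> cbox a (a + r *\<^sub>R One)"
      "x = f u" "y = f v" by blast
    have "dist x y \<le> L * dist u v" using f uv by (auto intro: lipschitz_onD)
    also have "dist u v \<le> DIM('a) * r" using uv dist_cbox_cube_le by blast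
    then have "L * dist u v \<le> L * (DIM('a) * r)"
      using L by (intro mult_left_mono) auto
    finally show "dist x y \<le> L * (DIM('a) * r)" .
  qed (use L r in auto)
  also have "\<dots> = ennreal ((unit_ball_vol DIM('a) * (L * DIM('a) / 2) ^ DIM('a)) * r ^ DIM('a))"
    by (simp add: power_mult_distrib power_divide mult_ac)
  also have "\<dots> = ennreal (unit_ball_vol DIM('a) * (L * DIM('a) / 2) ^ DIM('a)) * ennreal (r ^ DIM('a))"
    using L r by (subst ennreal_mult) auto
  finally show ?thesis .
qed

text \<open>A cube of side r has diameter at most DIM * r by the l^1 norm, so its image has weight
  at most a constant times r^DIM; these volumes are summed over a covering with little
  excess.\<close>

lemma hausdorff_content_lipschitz_image_le:
  fixes f :: "'a::euclidean_space \<Rightarrow> 'b::metric_space"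
  assumes f: "L-lipschitz_on S f" and S: "S \<in> lmeasurable" "bounded S"
  shows "hausdorff_content DIM('a) (f ` S)
    \<le> ennreal (unit_ball_vol DIM('a) * (L * DIM('a) / 2) ^ DIM('a) * measure lebesgue S)"
proof (rule ennreal_le_epsilon)
  fix e :: real assume e: "e > 0"
  let ?c = "unit_ball_vol DIM('a) * (L * DIM('a) / 2) ^ DIM('a)"
  have L: "L \<ge> 0" using f by (rule lipschitz_on_nonneg)
  then have c: "?c \<ge> 0" by simp
  define e' where "e' = e / (?c + 1)"
  have e': "e' > 0" using e c by (simp add: e'_def add_nonneg_pos)
  have aux: "x * (e / (x + 1)) \<le> e" if "x \<ge> 0" for x using that e by (simp add: field_simps)
  obtain a :: "nat \<Rightarrow> 'a" and r where ar: "\<And>i. r i \<ge> 0"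
    "S \<subseteq> (\<Union>i. cbox (a i) (a i + r i *\<^sub>R One))"
    "(\<Sum>i. ennreal (r i ^ DIM('a))) \<le> ennreal (measure lebesgue S + e')"
    "(\<Sum>i. emeasure lebesgue (cbox (a i) (a i + r i *\<^sub>R One) - S)) \<le> ennreal e'"
    using cube_cover[OF S e'] by blast
  have "hausdorff_content DIM('a) (f ` S) \<le> hausdorff_content DIM('a) (\<Union>i. f ` (S \<inter> cbox (a i) (a i + r i *\<^sub>R One)))"
    using ar(2) by (intro hausdorff_content_mono) blast
  also have "\<dots> \<le> (\<Sum>i. hausdorff_content DIM('a) (f ` (S \<inter> cbox (a i) (a i + r i *\<^sub>R One))))"
    by (rule hausdorff_content_UN)
  also have "\<dots> \<le> (\<Sum>i. ennreal ?c * ennreal (r i ^ DIM('a)))"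
    using hausdorff_content_lipschitz_cube[OF f ar(1)] by (intro suminf_le summableI) auto
  also have "\<dots> = ennreal ?c * (\<Sum>i. ennreal (r i ^ DIM('a)))" by (rule ennreal_suminf_cmult)
  also have "\<dots> \<le> ennreal ?c * ennreal (measure lebesgue S + e')" using ar(3) by (intro mult_left_mono) auto
  also have "\<dots> = ennreal (?c * measure lebesgue S + ?c * e')"
    using c e' by (subst ennreal_mult[symmetric]) (auto simp: algebra_simps)
  also have "\<dots> \<le> ennreal (?c * measure lebesgue S + e)"
    unfolding e'_def using aux[OF c] by (intro ennreal_leI add_left_mono)
  also have "\<dots> = ennreal (?c * measure lebesgue S) + ennreal e"
    using c e by (intro ennreal_plus) auto
  finally show "hausdorff_content DIM('a) (f ` S) \<le> ennreal (?c * measure lebesgue S) + ennreal e" .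
qed

subsection \<open>Lipschitz parametrisation and the chord bound\<close>

text \<open>The increments of the control function \<open>w\<close> telescope along every partition.
  A linear \<open>w\<close> serves for Lipschitz curves; in the chord bound \<open>w\<close> also
  charges for gaps.\<close>

lemma curve_length_le:
  assumes "\<And>s t. 0 \<le> s \<Longrightarrow> s \<le> t \<Longrightarrow> t \<le> 1 \<Longrightarrow> dist (h s) (h t) \<le> w t - w s"
  shows "curve_length h \<le> ennreal (w 1 - w 0)"
  unfolding curve_length_def
proof (rule SUP_least, clarify)
  fix n and t :: "nat \<Rightarrow> real"
  assume t: "t 0 = 0" "t n = 1" "\<forall>i<n. t i < t (Suc i)"
  have mono: "t i \<le> t j" if "i \<le> j" "j \<le> n" for i j
    using that
  proof (induction j rule: dec_induct)
    case (step k)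
    then have "t k < t (Suc k)" using t(3) by simp
    with step show ?case by simp
  qed simp
  have "(\<Sum>i<n. dist (h (t i)) (h (t (Suc i)))) \<le> (\<Sum>i<n. w (t (Suc i)) - w (t i))"
  proof (rule sum_mono)
    fix i assume "i \<in> {..<n}"
    then have "0 \<le> t i" "t i \<le> t (Suc i)" "t (Suc i) \<le> 1"
      using mono[of 0 i] mono[of i "Suc i"] mono[of "Suc i" n] t by auto
    then show "dist (h (t i)) (h (t (Suc i))) \<le> w (t (Suc i)) - w (t i)" by (rule assms)
  qed
  also have "\<dots> = w 1 - w 0" using sum_lessThan_telescope[of "\<lambda>i. w (t i)" n] t by simp
  finally show "(\<Sum>i<n. ennreal (dist (h (t i)) (h (t (Suc i))))) \<le> ennreal (w 1 - w 0)"
    by (simp add: ennreal_leI)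
qed

lemma dist_le_curve_length: "ennreal (dist (h 0) (h 1)) \<le> curve_length h"
proof -
  have "(1::nat, \<lambda>i::nat. real i) \<in> {(n, t). t 0 = 0 \<and> t n = 1 \<and> (\<forall>i<n. t i < t (Suc i))}"
    by simp
  from SUP_upper[OF this, of "\<lambda>(n, t). \<Sum>i<n. ennreal (dist (h (t i)) (h (t (Suc i))))"]
  show ?thesis unfolding curve_length_def by simp
qed

text \<open>\<open>s t\<close> is the length of the curve on [0,t], a supremum over partitions.
  Appending the point u to a partition of [0,t] yields the increment inequality.\<close>

lemma arc_length_function:
  fixes \<gamma> :: "real \<Rightarrow> 'a::metric_space"
  assumes len: "curve_length \<gamma> \<le> ennreal l" and l: "l \<ge> 0"
  obtains s where "s 0 = 0" "s 1 \<le> l"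
    "\<And>t u. 0 \<le> t \<Longrightarrow> t \<le> u \<Longrightarrow> u \<le> 1 \<Longrightarrow> dist (\<gamma> t) (\<gamma> u) \<le> s u - s t"
proof -
  define S where "S t = {\<Sum>i<n. dist (\<gamma> (\<tau> i)) (\<gamma> (\<tau> (Suc i))) |n \<tau>.
     \<tau> 0 = 0 \<and> \<tau> n = t \<and> (\<forall>i<n. \<tau> i < \<tau> (Suc i))}" for t :: real
  have app: "x + dist (\<gamma> t) (\<gamma> u) \<in> S u" if "x \<in> S t" "t < u" for x t u
  proof -
    from that(1) obtain n \<tau> where \<tau>: "\<tau> 0 = 0" "\<tau> n = t" "\<forall>i<n. \<tau> i < \<tau> (Suc i)"
      "x = (\<Sum>i<n. dist (\<gamma> (\<tau> i)) (\<gamma> (\<tau> (Suc i))))" unfolding S_def by blast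
    define \<sigma> where "\<sigma> = \<tau>(Suc n := u)"
    have "(\<Sum>i<Suc n. dist (\<gamma> (\<sigma> i)) (\<gamma> (\<sigma> (Suc i)))) = x + dist (\<gamma> t) (\<gamma> u)"
      using \<tau> by (simp add: \<sigma>_def)
    moreover have "\<sigma> 0 = 0" "\<sigma> (Suc n) = u" using \<tau> by (auto simp: \<sigma>_def)
    moreover have "\<forall>i<Suc n. \<sigma> i < \<sigma> (Suc i)"
      using \<tau> that(2) by (auto simp: \<sigma>_def less_Suc_eq)
    ultimately show ?thesis unfolding S_def mem_Collect_eq by metis
  qed
  have le1: "x \<le> l" if "x \<in> S 1" for x
  proof -
    from that obtain n \<tau> where \<tau>: "\<tau> 0 = 0" "\<tau> n = 1" "\<forall>i<n. \<tau> i < \<tau> (Suc i)"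
      "x = (\<Sum>i<n. dist (\<gamma> (\<tau> i)) (\<gamma> (\<tau> (Suc i))))" unfolding S_def by blast
    have "ennreal x = (\<Sum>i<n. ennreal (dist (\<gamma> (\<tau> i)) (\<gamma> (\<tau> (Suc i)))))"
      unfolding \<tau>(4) by (simp add: sum_ennreal)
    also have "\<dots> \<le> curve_length \<gamma>"
      unfolding curve_length_def using \<tau> by (intro SUP_upper2[of "(n, \<tau>)"]) auto
    also note len
    finally show ?thesis using l by simp
  qed
  have le: "x \<le> l" if "x \<in> S t" "t \<le> 1" for x t
  proof (cases "t = 1")
    case False
    then have "x + dist (\<gamma> t) (\<gamma> 1) \<le> l" using le1 app that by simp
    then show ?thesis using zero_le_dist[of "\<gamma> t" "\<gamma> 1"] by linarith
  qed (use le1 that in simp)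
  have ne: "S t \<noteq> {}" if "t \<ge> 0" for t
  proof -
    have 0: "0 \<in> S 0" unfolding S_def by (auto intro!: exI[of _ "0::nat"] exI[of _ "\<lambda>_. 0::real"])
    show ?thesis using 0 app[OF 0, of t] that by (cases "t = 0") auto
  qed
  have bdd: "bdd_above (S t)" if "t \<le> 1" for t using le that by (auto simp: bdd_above_def)
  \<comment> \<open>Subtracting the value at 0 gives s 0 = 0 without evaluating the supremum
    there.\<close>
  define s where "s t = Sup (S t) - Sup (S 0)" for t
  show thesis
  proof (rule that[of s])
    show "s 0 = 0" by (simp add: s_def)
    have "0 \<le> Sup (S 0)"
    proof -
      obtain x where "x \<in> S 0" using ne[of 0] by auto
      moreover then have "x \<ge> 0" unfolding S_def by (auto intro: sum_nonneg)
      ultimately show ?thesis using bdd[of 0] by (simp add: cSup_upper2)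
    qed
    moreover have "Sup (S 1) \<le> l" using ne le1 by (intro cSup_least) auto
    ultimately show "s 1 \<le> l" by (simp add: s_def)
    show "dist (\<gamma> t) (\<gamma> u) \<le> s u - s t" if tu: "0 \<le> t" "t \<le> u" "u \<le> 1" for t u
    proof (cases "t = u")
      case False
      have "Sup (S t) \<le> Sup (S u) - dist (\<gamma> t) (\<gamma> u)"
      proof (rule cSup_least)
        fix x assume "x \<in> S t"
        then have "x + dist (\<gamma> t) (\<gamma> u) \<in> S u" using app tu False by simp
        then have "x + dist (\<gamma> t) (\<gamma> u) \<le> Sup (S u)" using bdd tu by (intro cSup_upper) auto
        then show "x \<le> Sup (S u) - dist (\<gamma> t) (\<gamma> u)" by simp
      qed (use ne tu in auto)
      then show ?thesis by (simp add: s_def)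
    qed simp
  qed
qed

text \<open>The right-continuous inverse of the arc length function need not be continuous, but it
  jumps only over intervals on which the curve is constant.\<close>

lemma lipschitz_reparametrization:
  fixes \<gamma> :: "real \<Rightarrow> 'a::metric_space"
  assumes \<gamma>: "path \<gamma>" and len: "curve_length \<gamma> \<le> ennreal l" and l: "l \<ge> 0"
  obtains c :: "real \<Rightarrow> 'a" where "l-lipschitz_on {0..1} c" "c 0 = \<gamma> 0" "c 1 = \<gamma> 1"
proof -
  obtain s where s0: "s 0 = 0" and s1: "s 1 \<le> l" and
    s: "\<And>t u. 0 \<le> t \<Longrightarrow> t \<le> u \<Longrightarrow> u \<le> 1 \<Longrightarrow> dist (\<gamma> t) (\<gamma> u) \<le> s u - s t"
    using arc_length_function[OF len l] by metis
  define A where "A u = {t \<in> {0..1}. s t \<le> u}" for u :: real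
  \<comment> \<open>\<open>T u\<close> is the last time at which at most the length u has been
    travelled; the supremum need not be attained.\<close>
  define T where "T u = Sup (A u)" for u
  have A0: "0 \<in> A u" if "u \<ge> 0" for u using that s0 by (simp add: A_def)
  have bdd: "bdd_above (A u)" for u unfolding A_def by (auto simp: bdd_above_def)
  have T01: "T u \<in> {0..1}" if "u \<ge> 0" for u
  proof -
    have "0 \<le> T u" unfolding T_def using A0[OF that] bdd by (rule cSup_upper)
    moreover have "A u \<noteq> {}" using A0[OF that] by blast
    then have "T u \<le> 1" unfolding T_def by (rule cSup_least) (simp add: A_def)
    ultimately show ?thesis by simp
  qed
  have upper: "t \<le> T u" if "t \<in> A u" for t u unfolding T_def using that bdd by (rule cSup_upper)
  have near: "\<exists>t\<in>A u. t > T u - d" if "u \<ge> 0" "d > 0" for u d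
  proof -
    have "A u \<noteq> {}" using A0[OF that(1)] by blast
    moreover have "T u - d < Sup (A u)" using that(2) by (simp add: T_def)
    ultimately show ?thesis using less_cSupD by blast
  qed
  have cont: "\<exists>d>0. \<forall>t\<in>{0..1}. \<bar>t - x\<bar> < d \<longrightarrow> dist (\<gamma> t) (\<gamma> x) < e" if "x \<in> {0..1}" "e > 0" for x e
    using \<gamma> that unfolding path_def continuous_on_iff by (metis dist_real_def)
  have key: "dist (\<gamma> (T u)) (\<gamma> (T v)) \<le> v - u" if uv: "0 \<le> u" "u \<le> v" for u v
  proof -
    have "A u \<subseteq> A v" using uv by (auto simp: A_def)
    then have le: "T u \<le> T v" unfolding T_def using A0[OF uv(1)] bdd by (intro cSup_subset_mono) auto
    show ?thesis
    proof (cases "T u = T v")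
      case False
      with le have lt: "T u < T v" by simp
      have v: "0 \<le> v" using uv by simp
      show ?thesis
      proof (rule field_le_epsilon)
        fix e :: real assume e: "e > 0"
        obtain d1 where d1: "d1 > 0" "\<forall>t\<in>{0..1}. \<bar>t - T u\<bar> < d1 \<longrightarrow> dist (\<gamma> t) (\<gamma> (T u)) < e/2"
          using cont[OF T01[OF uv(1)], of "e/2"] e by auto
        obtain d2 where d2: "d2 > 0" "\<forall>t\<in>{0..1}. \<bar>t - T v\<bar> < d2 \<longrightarrow> dist (\<gamma> t) (\<gamma> (T v)) < e/2"
          using cont[OF T01[OF v], of "e/2"] e by auto
        \<comment> \<open>A point just after \<open>T u\<close>, where the length already exceeds u,
          is compared with \<open>t2\<close>, a point close to \<open>T v\<close> from the left
          where it is at most v. Halving the distance between \<open>T u\<close> and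
          \<open>T v\<close> keeps t1 before t2; continuity of the curve absorbs both
          shifts.\<close>
        define t1 where "t1 = T u + min (d1/2) ((T v - T u) / 2)"
        have t1: "T u < t1" "t1 < T u + d1" "t1 \<le> (T u + T v) / 2"
          unfolding t1_def using d1(1) lt by (auto simp: min_def field_simps)
        obtain t2 where t2: "t2 \<in> A v" "t2 > T v - min d2 ((T v - T u) / 2)"
          using near[OF v, of "min d2 ((T v - T u) / 2)"] d2(1) lt by auto
        have t2': "t2 \<le> T v" "t2 > T v - d2" "t2 > (T u + T v) / 2"
          using upper[OF t2(1)] t2(2) by (auto simp: min_def field_simps split: if_splits)
        have t101: "t1 \<in> {0..1}" using T01[OF uv(1)] T01[OF v] t1 lt by auto
        have t201: "t2 \<in> {0..1}" "s t2 \<le> v" using t2(1) by (auto simp: A_def)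
        have "s t1 > u" using upper[of t1 u] t1(1) t101 by (force simp: A_def)
        moreover have "dist (\<gamma> t1) (\<gamma> t2) \<le> s t2 - s t1"
          using t101 t201 t1 t2' by (intro s) auto
        moreover have "dist (\<gamma> t1) (\<gamma> (T u)) < e/2" using d1(2) t101 t1 by auto
        moreover have "dist (\<gamma> t2) (\<gamma> (T v)) < e/2" using d2(2) t201 t2' by auto
        moreover have "dist (\<gamma> (T u)) (\<gamma> (T v)) \<le> dist (\<gamma> t1) (\<gamma> (T u)) + dist (\<gamma> t1) (\<gamma> t2) + dist (\<gamma> t2) (\<gamma> (T v))"
          by metric
        ultimately show "dist (\<gamma> (T u)) (\<gamma> (T v)) \<le> v - u + e" using t201 by linarith
      qed
    qed (use uv in simp)
  qed
  define c where "c x = \<gamma> (T (l * x))" for x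
  show thesis
  proof (rule that[of c])
    show "l-lipschitz_on {0..1} c"
    proof (rule lipschitz_on_leI)
      fix x y :: real assume "x \<in> {0..1}" "y \<in> {0..1}" "x \<le> y"
      then show "dist (c x) (c y) \<le> l * dist x y"
        using key[of "l * x" "l * y"] l
        by (simp add: c_def dist_real_def mult_left_mono right_diff_distrib)
    qed (use l in auto)
    \<comment> \<open>\<open>T 0\<close> may be positive, but no length is travelled before
      it.\<close>
    have "dist (\<gamma> 0) (\<gamma> (T 0)) \<le> 0"
    proof (rule field_le_epsilon)
      fix e :: real assume e: "e > 0"
      obtain d where d: "d > 0" "\<forall>t\<in>{0..1}. \<bar>t - T 0\<bar> < d \<longrightarrow> dist (\<gamma> t) (\<gamma> (T 0)) < e"
        using cont[OF T01[of 0] e] by auto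
      obtain t where t: "t \<in> A 0" "t > T 0 - d" using near[of 0 d] d by auto
      then have "t \<in> {0..1}" "s t \<le> 0" by (auto simp: A_def)
      then have "dist (\<gamma> 0) (\<gamma> t) \<le> s t - s 0" "s t - s 0 \<le> 0" using s[of 0 t] s0 by auto
      then have "dist (\<gamma> 0) (\<gamma> t) \<le> 0" by (rule order.trans)
      moreover have "dist (\<gamma> t) (\<gamma> (T 0)) < e" using d(2) t \<open>t \<in> {0..1}\<close> upper[OF t(1)] by auto
      ultimately show "dist (\<gamma> 0) (\<gamma> (T 0)) \<le> 0 + e" by (simp add: zero_less_dist_iff)
    qed
    then show "c 0 = \<gamma> 0" by (simp add: c_def)
    have "1 \<in> A l" using s1 by (simp add: A_def)
    then have "T l = 1" using upper[of 1 l] T01[OF l] by force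
    then show "c 1 = \<gamma> 1" by (simp add: c_def)
  qed
qed

text \<open>One quasigeodesic is chosen for every ordered pair of points, with a Lipschitz constant
  proportional to their distance, so that gaps can later be filled by a function of their end
  values.\<close>

lemma quasiconvex_lipschitz_path:
  assumes "quasiconvex_space TYPE('a::metric_space)"
  obtains M and G :: "'a::metric_space \<Rightarrow> 'a \<Rightarrow> real \<Rightarrow> 'a" where "M \<ge> 1"
    "\<forall>x y. (M * dist x y)-lipschitz_on {0..1} (G x y) \<and> G x y 0 = x \<and> G x y 1 = y"
proof -
  from assms obtain M where M: "M \<ge> 1" "\<And>x y::'a. \<exists>\<gamma>. path \<gamma> \<and> pathstart \<gamma> = x \<and> pathfinish \<gamma> = y \<and>
           curve_length \<gamma> \<le> ennreal (M * dist x y)"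
    unfolding quasiconvex_space_def by blast
  have "\<exists>c :: real \<Rightarrow> 'a. (M * dist x y)-lipschitz_on {0..1} c \<and> c 0 = x \<and> c 1 = y" for x y :: 'a
  proof -
    obtain \<gamma> where \<gamma>: "path \<gamma>" "pathstart \<gamma> = x" "pathfinish \<gamma> = y" "curve_length \<gamma> \<le> ennreal (M * dist x y)"
      using M(2) by blast
    obtain c :: "real \<Rightarrow> 'a" where "(M * dist x y)-lipschitz_on {0..1} c" "c 0 = \<gamma> 0" "c 1 = \<gamma> 1"
      using lipschitz_reparametrization[OF \<gamma>(1,4)] M(1) by auto
    then show ?thesis using \<gamma>(2,3) unfolding pathstart_def pathfinish_def by (intro exI[of _ c]) simp
  qed
  then obtain G :: "'a \<Rightarrow> 'a \<Rightarrow> real \<Rightarrow> 'a" where "\<And>x y::'a. (M * dist x y)-lipschitz_on {0..1} (G x y) \<and> G x y 0 = x \<and> G x y 1 = y"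
    by metis
  with M(1) show thesis by (intro that[of M G]) simp_all
qed

section \<open>Curves completed across the gaps of a compact set of parameters\<close>

lemma compact_gap:
  fixes K :: "real set"
  assumes K: "compact K" "a \<in> K" "b \<in> K" and t: "a \<le> t" "t \<le> b"
  shows "\<exists>p\<in>K. \<exists>q\<in>K. p \<le> t \<and> t \<le> q \<and> (\<forall>x\<in>K. x \<le> t \<longrightarrow> x \<le> p) \<and> (\<forall>x\<in>K. t \<le> x \<longrightarrow> q \<le> x)"
proof -
  have "compact (K \<inter> {..t})" "a \<in> K \<inter> {..t}" using K t by (auto intro: compact_Int_closed)
  then obtain p where p: "p \<in> K \<inter> {..t}" "\<And>x. x \<in> K \<inter> {..t} \<Longrightarrow> x \<le> p"
    using compact_attains_sup by (metis empty_iff)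
  have "compact (K \<inter> {t..})" "b \<in> K \<inter> {t..}" using K t by (auto intro: compact_Int_closed)
  then obtain q where q: "q \<in> K \<inter> {t..}" "\<And>x. x \<in> K \<inter> {t..} \<Longrightarrow> q \<le> x"
    using compact_attains_inf by (metis empty_iff)
  show ?thesis using p q by (intro bexI[of _ p] bexI[of _ q]) auto
qed

text \<open>The interval from s to t is split at the first point of \<open>K\<close> after s and the
  last one before t. The outer parts are free of \<open>K\<close> inside, and the middle part has
  both ends in \<open>K\<close>.\<close>

lemma compact_gap_chain:
  fixes K :: "real set" and h :: "real \<Rightarrow> 'a::metric_space"
  assumes K: "compact K" "a \<in> K" "b \<in> K"
    and onK: "\<And>s t. s \<in> K \<Longrightarrow> t \<in> K \<Longrightarrow> s \<le> t \<Longrightarrow> dist (h s) (h t) \<le> w t - w s"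
    and gap: "\<And>s t. a \<le> s \<Longrightarrow> s < t \<Longrightarrow> t \<le> b \<Longrightarrow> {s<..<t} \<inter> K = {} \<Longrightarrow> dist (h s) (h t) \<le> w t - w s"
    and st: "a \<le> s" "s \<le> t" "t \<le> b"
  shows "dist (h s) (h t) \<le> w t - w s"
proof -
  have gap': "dist (h s) (h t) \<le> w t - w s" if "a \<le> s" "s \<le> t" "t \<le> b" "{s<..<t} \<inter> K = {}" for s t
    using gap[of s t] that by (cases "s = t") auto
  obtain p q where q: "p \<in> K" "q \<in> K" "p \<le> s" "s \<le> q" "\<forall>x\<in>K. s \<le> x \<longrightarrow> q \<le> x"
    using compact_gap[OF K, of s] st by auto
  obtain p' q' where p: "p' \<in> K" "q' \<in> K" "p' \<le> t" "t \<le> q'" "\<forall>x\<in>K. x \<le> t \<longrightarrow> x \<le> p'"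
    using compact_gap[OF K, of t] st by auto
  have sq: "{s<..<q} \<inter> K = {}" using q(5) by force
  have pt: "{p'<..<t} \<inter> K = {}" using p(5) by force
  show ?thesis
  proof (cases "q \<le> t")
    case False
    then have "{s<..<t} \<inter> K = {}" using sq by force
    then show ?thesis using gap' st by auto
  next
    case True
    have "q \<le> p'" using p(5) q(2) True by blast
    have "dist (h s) (h q) \<le> w q - w s" using gap' sq q st True by auto
    moreover have "dist (h q) (h p') \<le> w p' - w q" using onK q p \<open>q \<le> p'\<close> by auto
    moreover have "dist (h p') (h t) \<le> w t - w p'" using gap' pt p st \<open>q \<le> p'\<close> q by auto
    moreover have "dist (h s) (h t) \<le> dist (h s) (h q) + dist (h q) (h p') + dist (h p') (h t)" by metric
    ultimately show ?thesis by linarith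
  qed
qed

text \<open>Filling the gaps of \<open>K\<close> with quasigeodesics extends \<open>c\<close> to a curve whose image under \<open>\<Phi>\<close> is
  short, so by the length bound the curve itself is short.\<close>

lemma chord_bound:
  fixes \<Phi> :: "'a::metric_space \<Rightarrow> 'b::metric_space" and G :: "'a \<Rightarrow> 'a \<Rightarrow> real \<Rightarrow> 'a"
  assumes M: "M \<ge> 1"
    and G: "\<And>x y. (M * dist x y)-lipschitz_on {0..1} (G x y)" "\<And>x y. G x y 0 = x" "\<And>x y. G x y 1 = y"
    and \<Phi>: "B-lipschitz_on UNIV \<Phi>" and C: "C \<ge> 0"
    and length_bound: "\<And>\<gamma> :: real \<Rightarrow> 'a. rectifiable_curve \<gamma> \<Longrightarrow>
      curve_length \<gamma> \<le> ennreal C * curve_length (\<Phi> \<circ> \<gamma>)"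
    and K: "compact K" "a \<in> K" "b \<in> K" and ab: "a \<le> b" 
    and c: "L-lipschitz_on K c" and e: "e-lipschitz_on K (\<Phi> \<circ> c)"
  shows "dist (c a) (c b) \<le> C * (e * (b - a) + B * M * L * measure lebesgue ({a..b} - K))"
proof (cases "a = b")
  case True
  have "B \<ge> 0" "L \<ge> 0" using \<Phi> c by (auto intro: lipschitz_on_nonneg)
  then show ?thesis using True C M by simp
next
  case False
  with ab have ab: "a < b" by simp
  have B: "B \<ge> 0" and L: "L \<ge> 0" and e0: "e \<ge> 0" using \<Phi> c e by (auto intro: lipschitz_on_nonneg)
  \<comment> \<open>Total length of the gaps up to t. It grows at unit speed across a gap and is the
    quantity that pays for filling.\<close>
  define lam where "lam t = measure lebesgue ({a..t} - K)" for t
  have Kb: "K \<in> sets lebesgue" using K(1) by (simp add: compact_imp_closed borel_closed)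
  have lm: "{a..t} - K \<in> lmeasurable" for t using Kb by (intro fmeasurable_Diff) auto
  have lam_mono: "lam s \<le> lam t" if "s \<le> t" for s t
    unfolding lam_def using lm that by (intro measure_mono_fmeasurable) auto
  have lam_gap: "t - s \<le> lam t - lam s" if "a \<le> s" "s < t" "{s<..<t} \<inter> K = {}" for s t
  proof -
    have "lam s + (t - s) = measure lebesgue (({a..s} - K) \<union> {s<..<t})"
      unfolding lam_def
    proof (subst measure_Un3)
      have "({a..s} - K) \<inter> {s<..<t} = {}" by auto
      then show "measure lebesgue ({a..s} - K) + (t - s) = measure lebesgue ({a..s} - K)
        + measure lebesgue {s<..<t} - measure lebesgue (({a..s} - K) \<inter> {s<..<t})"
        using that by simp
    qed (use lm in auto)
    also have "\<dots> \<le> lam t" unfolding lam_def using lm that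
      by (intro measure_mono_fmeasurable) auto
    finally show ?thesis by simp
  qed
  define p where "p t = (SOME p. p \<in> K \<and> p \<le> t \<and> (\<forall>x\<in>K. x \<le> t \<longrightarrow> x \<le> p))" for t
  define q where "q t = (SOME q. q \<in> K \<and> t \<le> q \<and> (\<forall>x\<in>K. t \<le> x \<longrightarrow> q \<le> x))" for t
  have p: "p t \<in> K \<and> p t \<le> t \<and> (\<forall>x\<in>K. x \<le> t \<longrightarrow> x \<le> p t)" if "a \<le> t" "t \<le> b" for t
    unfolding p_def by (rule someI_ex) (use compact_gap[OF K that] in blast)
  have q: "q t \<in> K \<and> t \<le> q t \<and> (\<forall>x\<in>K. t \<le> x \<longrightarrow> q t \<le> x)" if "a \<le> t" "t \<le> b" for t
    unfolding q_def by (rule someI_ex) (use compact_gap[OF K that] in blast)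
  \<comment> \<open>Across the gap with ends \<open>p t\<close> and \<open>q t\<close> the chosen
    quasigeodesic between the end values is run at constant parameter speed.\<close>
  define g where "g t = (if t \<in> K then c t else G (c (p t)) (c (q t)) ((t - p t) / (q t - p t)))" for t
  have gK: "g t = c t" if "t \<in> K" for t using that by (simp add: g_def)
  have gap: "dist (g s) (g t) \<le> M * L * (t - s)"
    if st: "a \<le> s" "s < t" "t \<le> b" "{s<..<t} \<inter> K = {}" for s t
  proof -
    \<comment> \<open>The gap is identified by an interior point, because s and t may themselves lie
      in \<open>K\<close>.\<close>
    define m where "m = (s + t) / 2"
    have m: "s < m" "m < t" "a \<le> m" "m \<le> b" unfolding m_def using st by (auto simp: field_simps)
    define P where "P = p m"
    define Q where "Q = q m"
    have P: "P \<in> K" "P \<le> m" "\<forall>x\<in>K. x \<le> m \<longrightarrow> x \<le> P" using p[OF m(3,4)] by (auto simp: P_def)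
    have Q: "Q \<in> K" "m \<le> Q" "\<forall>x\<in>K. m \<le> x \<longrightarrow> Q \<le> x" using q[OF m(3,4)] by (auto simp: Q_def)
    have Ps: "P \<le> s" using P st(4) m by (metis disjoint_iff greaterThanLessThan_iff le_less_trans not_le)
    have Qt: "t \<le> Q" using Q st(4) m by (metis disjoint_iff greaterThanLessThan_iff less_le_trans not_le)
    have PQ: "x \<notin> K" if "P < x" "x < Q" for x using P Q that by (meson leI le_cases leD)
    have gr: "g x = G (c P) (c Q) ((x - P) / (Q - P))" if x: "P \<le> x" "x \<le> Q" for x
    proof -
      consider "x = P" | "x = Q" | "P < x" "x < Q" using x by linarith
      then show ?thesis
      proof cases
        case 1 then show ?thesis using P G by (simp add: g_def)
      next
        case 2 then show ?thesis using Q G Ps Qt st by (simp add: g_def)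
      next
        case 3
        have xab: "a \<le> x" "x \<le> b" 
          using 3 P Q K ab m by (meson dual_order.trans less_imp_le)+
        have "p x = P" using p[OF xab] 3 P(1) PQ by (metis antisym_conv2 le_less_trans not_le less_imp_le)
        moreover have "q x = Q" using q[OF xab] 3 Q(1) PQ by (metis antisym_conv2 less_le_trans not_le less_imp_le)
        ultimately show ?thesis using PQ 3 by (simp add: g_def)
      qed
    qed
    have PQ0: "Q - P > 0" using Ps Qt st by simp
    have "dist (g s) (g t) = dist (G (c P) (c Q) ((s - P) / (Q - P))) (G (c P) (c Q) ((t - P) / (Q - P)))"
      using gr[of s] gr[of t] Ps Qt st by simp
    also have "\<dots> \<le> M * dist (c P) (c Q) * dist ((s - P) / (Q - P)) ((t - P) / (Q - P))"
      using Ps Qt st PQ0 by (intro lipschitz_onD[OF G(1)]) (auto simp: field_simps)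
    also have "dist ((s - P) / (Q - P)) ((t - P) / (Q - P)) = (t - s) / (Q - P)"
      using PQ0 st by (simp add: dist_real_def flip: diff_divide_distrib)
    also have "M * dist (c P) (c Q) * ((t - s) / (Q - P)) \<le> M * (L * (Q - P)) * ((t - s) / (Q - P))"
      using lipschitz_onD[OF c P(1) Q(1)] M st PQ0
      by (intro mult_right_mono mult_left_mono) (auto simp: dist_real_def)
    also have "\<dots> = M * L * (t - s)" using PQ0 by simp
    finally show ?thesis .
  qed
  have gL: "dist (g s) (g t) \<le> M * L * t - M * L * s" if "a \<le> s" "s \<le> t" "t \<le> b" for s t
  proof (rule compact_gap_chain[OF K, of g "\<lambda>t. M * L * t"])
    show "dist (g s) (g t) \<le> M * L * t - M * L * s" if "s \<in> K" "t \<in> K" "s \<le> t" for s t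
    proof -
      have "dist (g s) (g t) \<le> L * (t - s)"
        using lipschitz_onD[OF c that(1,2)] that gK by (simp add: dist_real_def)
      also have "\<dots> \<le> M * (L * (t - s))" using M L that by (intro mult_right_mono[of 1 M, simplified]) auto
      finally show ?thesis by (simp add: algebra_simps)
    qed
  qed (use gap that in \<open>auto simp: algebra_simps\<close>)
  \<comment> \<open>Control function of the image curve: speed e from the points of
    \<open>K\<close>, plus speed at most B M L inside gaps.\<close>
  define W where "W t = e * t + B * M * L * lam t" for t
  have BML: "B * M * L \<ge> 0" using B M L by simp
  have gW: "dist (\<Phi> (g s)) (\<Phi> (g t)) \<le> W t - W s" if "a \<le> s" "s \<le> t" "t \<le> b" for s t
  proof (rule compact_gap_chain[OF K, of "\<lambda>t. \<Phi> (g t)" W])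
    show "dist (\<Phi> (g s)) (\<Phi> (g t)) \<le> W t - W s" if "s \<in> K" "t \<in> K" "s \<le> t" for s t
    proof -
      have "dist (\<Phi> (g s)) (\<Phi> (g t)) \<le> e * (t - s)"
        using lipschitz_onD[OF e that(1,2)] that gK by (simp add: dist_real_def)
      moreover have "B * M * L * lam s \<le> B * M * L * lam t"
        using BML lam_mono that by (intro mult_left_mono) auto
      ultimately show ?thesis by (simp add: W_def algebra_simps)
    qed
    show "dist (\<Phi> (g s)) (\<Phi> (g t)) \<le> W t - W s"
      if "a \<le> s" "s < t" "t \<le> b" "{s<..<t} \<inter> K = {}" for s t
    proof -
      have "dist (\<Phi> (g s)) (\<Phi> (g t)) \<le> B * dist (g s) (g t)"
        using \<Phi> by (auto intro: lipschitz_onD)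
      also have "\<dots> \<le> B * (M * L * (t - s))" using gap[OF that] B by (rule mult_left_mono)
      also have "\<dots> \<le> B * M * L * (lam t - lam s)"
        using mult_left_mono[OF lam_gap[OF that(1,2,4)] BML] by (simp add: mult.assoc)
      also have "\<dots> \<le> W t - W s" using e0 that by (simp add: W_def algebra_simps mult_left_mono)
      finally show ?thesis .
    qed
  qed (use that in auto)
  \<comment> \<open>Rescaling to [0,1], the parameter interval in the definition of curve
    length.\<close>
  define h where "h x = g (a + x * (b - a))" for x
  have ran: "a \<le> a + s * (b - a)" "a + s * (b - a) \<le> a + t * (b - a)" "a + t * (b - a) \<le> b"
    if "0 \<le> s" "s \<le> t" "t \<le> 1" for s t
  proof -
    have "t * (b - a) \<le> 1 * (b - a)" using that ab by (intro mult_right_mono) auto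
    then show "a + t * (b - a) \<le> b" by simp
  qed (use that ab in \<open>auto intro: mult_right_mono\<close>)
  have hL: "dist (h s) (h t) \<le> M * L * (b - a) * t - M * L * (b - a) * s" if "0 \<le> s" "s \<le> t" "t \<le> 1" for s t
    using gL[OF ran[OF that]] by (simp add: h_def algebra_simps)
  have MLb: "M * L * (b - a) \<ge> 0" using M L ab by simp
  have "(M * L * (b - a))-lipschitz_on {0..1} h"
  proof (rule lipschitz_on_leI)
    fix x y :: real assume "x \<in> {0..1}" "y \<in> {0..1}" "x \<le> y"
    then show "dist (h x) (h y) \<le> M * L * (b - a) * dist x y"
      using hL[of x y] by (simp add: dist_real_def right_diff_distrib)
  qed (rule MLb)
  then have "path h" unfolding path_def by (rule lipschitz_on_continuous_on)
  moreover have "curve_length h \<le> ennreal (M * L * (b - a) * 1 - M * L * (b - a) * 0)"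
    by (rule curve_length_le) (rule hL)
  ultimately have "rectifiable_curve h"
    unfolding rectifiable_curve_def by (simp add: order_le_less_trans)
  have "ennreal (dist (c a) (c b)) = ennreal (dist (h 0) (h 1))"
    using gK K by (simp add: h_def)
  also have "\<dots> \<le> curve_length h" by (rule dist_le_curve_length)
  also have "\<dots> \<le> ennreal C * curve_length (\<Phi> \<circ> h)" by (rule length_bound) fact
  also have "curve_length (\<Phi> \<circ> h) \<le> ennreal (W (a + 1 * (b - a)) - W (a + 0 * (b - a)))"
    by (rule curve_length_le) (use gW[OF ran] in \<open>simp add: h_def\<close>)
  then have "ennreal C * curve_length (\<Phi> \<circ> h) \<le> ennreal C * ennreal (W b - W a)"
    by (intro mult_left_mono) auto
  also have "\<dots> = ennreal (C * (W b - W a))"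
  proof (rule ennreal_mult[symmetric])
    show "0 \<le> W b - W a" using gW[of a b] ab by (meson less_imp_le order.refl order.trans zero_le_dist)
  qed (rule C)
  finally have "dist (c a) (c b) \<le> C * (W b - W a)"
    using C gW[of a b] ab
    by (metis ennreal_le_iff less_imp_le mult_nonneg_nonneg order.refl order.trans zero_le_dist)
  also have "W b - W a = e * (b - a) + B * M * L * (measure lebesgue ({a..b} - K) - measure lebesgue ({a..a} - K))"
    by (simp add: W_def lam_def algebra_simps)
  also have "measure lebesgue ({a..a} - K) = 0" using K by simp
  finally show ?thesis by simp
qed

subsection \<open>Images of maps that are nearly constant in one direction\<close>

lemma emeasure_translate_vimage:
  fixes N :: "'a::euclidean_space set"
  assumes [measurable]: "N \<in> sets borel"
  shows "(\<integral>\<^sup>+y. indicator N (y + c) \<partial>lborel) = emeasure lborel N"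
proof -
  have "emeasure lborel N = (\<integral>\<^sup>+y. indicator N y \<partial>distr lborel borel ((+) c))"
    by (subst lborel_distr_plus) simp
  also have "\<dots> = (\<integral>\<^sup>+y. indicator N (c + y) \<partial>lborel)"
    by (rule nn_integral_distr) measurable
  finally show ?thesis by (simp add: add.commute)
qed

lemma sets_line_slice:
  fixes N :: "'a::euclidean_space set" and v :: 'a
  assumes [measurable]: "N \<in> sets borel" "T \<in> sets borel"
  shows "{t \<in> T. y + t *\<^sub>R v \<in> N} \<in> sets borel"
proof -
  have "{t. y + t *\<^sub>R v \<in> N} \<in> sets borel" by measurable
  then show ?thesis by (simp add: Collect_conj_eq assms)
qed

text \<open>Tonelli's theorem on \<open>E \<times> \<real>\<close> together with translation invariance replaces slicing the space
  into lines.\<close>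

lemma nn_integral_lines:
  fixes N :: "'a::euclidean_space set" and v :: 'a
  assumes [measurable]: "N \<in> sets borel" "T \<in> sets borel"
  shows "(\<integral>\<^sup>+y. emeasure lborel {t \<in> T. y + t *\<^sub>R v \<in> N} \<partial>lborel) = emeasure lborel T * emeasure lborel N"
proof -
  have "(\<integral>\<^sup>+y. emeasure lborel {t \<in> T. y + t *\<^sub>R v \<in> N} \<partial>lborel)
      = (\<integral>\<^sup>+y. (\<integral>\<^sup>+t. indicator T t * indicator N (y + t *\<^sub>R v) \<partial>lborel) \<partial>lborel)"
  proof (intro nn_integral_cong)
    fix y :: 'a
    have "{t \<in> T. y + t *\<^sub>R v \<in> N} \<in> sets borel" using assms by (rule sets_line_slice)
    then have "emeasure lborel {t \<in> T. y + t *\<^sub>R v \<in> N} = (\<integral>\<^sup>+t. indicator {t \<in> T. y + t *\<^sub>R v \<in> N} t \<partial>lborel)"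
      by simp
    also have "\<dots> = (\<integral>\<^sup>+t. indicator T t * indicator N (y + t *\<^sub>R v) \<partial>lborel)"
      by (intro nn_integral_cong) (auto simp: indicator_def)
    finally show "emeasure lborel {t \<in> T. y + t *\<^sub>R v \<in> N} = \<dots>" .
  qed
  also have "\<dots> = (\<integral>\<^sup>+t. (\<integral>\<^sup>+y. indicator T t * indicator N (y + t *\<^sub>R v) \<partial>lborel) \<partial>lborel)"
    by (rule lborel_pair.Fubini') measurable
  also have "\<dots> = (\<integral>\<^sup>+t. indicator T t * emeasure lborel N \<partial>lborel)"
  proof (intro nn_integral_cong)
    fix t :: real
    have "(\<integral>\<^sup>+y. indicator T t * indicator N (y + t *\<^sub>R v) \<partial>lborel)
       = indicator T t * (\<integral>\<^sup>+y. indicator N (y + t *\<^sub>R v) \<partial>lborel)"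
      by (rule nn_integral_cmult) measurable
    then show "(\<integral>\<^sup>+y. indicator T t * indicator N (y + t *\<^sub>R v) \<partial>lborel) = indicator T t * emeasure lborel N"
      by (simp add: emeasure_translate_vimage)
  qed
  also have "\<dots> = emeasure lborel T * emeasure lborel N"
    by (subst nn_integral_multc) auto
  finally show ?thesis .
qed

text \<open>Averaging: if every line based at a point of \<open>P\<close> had a slice larger than c,
  integration over \<open>P\<close> would contradict the total given by
  \<open>nn_integral_lines\<close>.\<close>

lemma exists_good_line:
  fixes P N :: "'a::euclidean_space set"
  assumes P[measurable]: "P \<in> sets borel" and N[measurable]: "N \<in> sets borel"
    and T[measurable]: "T \<in> sets borel"
    and less: "emeasure lborel T * emeasure lborel N < c * emeasure lborel P"
  shows "\<exists>y\<in>P. emeasure lborel {t \<in> T. y + t *\<^sub>R v \<in> N} \<le> c"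
proof (rule ccontr)
  assume "\<not> ?thesis"
  then have gt: "c \<le> emeasure lborel {t \<in> T. y + t *\<^sub>R v \<in> N}" if "y \<in> P" for y
    using that by (meson not_le less_imp_le)
  have "c * emeasure lborel P = (\<integral>\<^sup>+y. c * indicator P y \<partial>lborel)"
    by (rule nn_integral_cmult_indicator[symmetric]) measurable
  also have "\<dots> \<le> (\<integral>\<^sup>+y. emeasure lborel {t \<in> T. y + t *\<^sub>R v \<in> N} \<partial>lborel)"
    using gt by (intro nn_integral_mono) (auto simp: indicator_def)
  also have "\<dots> = emeasure lborel T * emeasure lborel N" by (rule nn_integral_lines) measurable
  finally show False using less by simp
qed

text \<open>The cube with lower corner a and side r is cut into m slices in every direction except
  i. The function j numbers the slices; its value at i does not enter.\<close>

definition tube :: "'a::euclidean_space \<Rightarrow> 'a \<Rightarrow> real \<Rightarrow> nat \<Rightarrow> ('a \<Rightarrow> nat) \<Rightarrow> 'a set" where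
  "tube i a r m j = cbox
     (a + (\<Sum>b\<in>Basis. (if b = i then 0 else j b * r / m) *\<^sub>R b))
     (a + (\<Sum>b\<in>Basis. (if b = i then r else (real (j b) + 1) * r / m) *\<^sub>R b))"

lemma mem_tube:
  assumes "i \<in> Basis"
  shows "y \<in> tube i a r m j \<longleftrightarrow> a \<bullet> i \<le> y \<bullet> i \<and> y \<bullet> i \<le> a \<bullet> i + r \<and>
     (\<forall>b\<in>Basis - {i}. a \<bullet> b + j b * r / m \<le> y \<bullet> b \<and> y \<bullet> b \<le> a \<bullet> b + (real (j b) + 1) * r / m)"
  unfolding tube_def mem_box using assms by (auto simp: inner_add_left)

lemma emeasure_tube:
  fixes i :: "'a::euclidean_space"
  assumes i: "i \<in> Basis" and r: "r \<ge> 0"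
  shows "emeasure lborel (tube i a r m j) = ennreal (r * (r / m) ^ (DIM('a) - 1))"
proof -
  have "emeasure lborel (tube i a r m j) =
    (\<Prod>b\<in>Basis. ((a + (\<Sum>b\<in>Basis. (if b = i then r else (real (j b) + 1) * r / m) *\<^sub>R b))
       - (a + (\<Sum>b\<in>Basis. (if b = i then 0 else j b * r / m) *\<^sub>R b))) \<bullet> b)"
    unfolding tube_def using r
    by (intro emeasure_lborel_cbox) (auto simp: inner_add_left divide_right_mono mult_right_mono)
  also have "(\<Prod>b\<in>Basis. ((a + (\<Sum>b\<in>Basis. (if b = i then r else (real (j b) + 1) * r / m) *\<^sub>R b))
       - (a + (\<Sum>b\<in>Basis. (if b = i then 0 else j b * r / m) *\<^sub>R b))) \<bullet> b)
      = (\<Prod>b\<in>(Basis::'a set). if b = i then r else r / m)"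
    by (intro prod.cong) (auto simp: inner_add_left inner_diff_left add_divide_distrib distrib_right)
  also have "\<dots> = r * (\<Prod>b\<in>Basis - {i}. if b = i then r else r / m)"
    using i by (subst prod.remove[of _ i]) auto
  also have "(\<Prod>b\<in>Basis - {i}. if b = i then r else r / m) = (\<Prod>b\<in>Basis - {i}. r / m)"
    by (intro prod.cong) auto
  also have "\<dots> = (r / m) ^ (DIM('a) - 1)" using i by (simp add: card_Diff_singleton)
  finally show ?thesis .
qed

lemma cube_subset_tubes:
  fixes i :: "'a::euclidean_space"
  assumes i: "i \<in> Basis" and r: "r > 0" and m: "m > 0"
  shows "cbox a (a + r *\<^sub>R One) \<subseteq> (\<Union>j\<in>(Basis - {i}) \<rightarrow>\<^sub>E {..<m}. tube i a r m j)"
proof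
  fix y assume y: "y \<in> cbox a (a + r *\<^sub>R One)"
  then have yb: "a \<bullet> b \<le> y \<bullet> b" "y \<bullet> b \<le> a \<bullet> b + r" if "b \<in> Basis" for b
    using that by (auto simp: mem_box inner_add_left)
  have "\<exists>n<m. a \<bullet> b + real n * r / m \<le> y \<bullet> b \<and> y \<bullet> b \<le> a \<bullet> b + (real n + 1) * r / m" if b: "b \<in> Basis" for b
  proof -
    define z where "z = (y \<bullet> b - a \<bullet> b) * m / r"
    have "(y \<bullet> b - a \<bullet> b) * m / r \<le> r * m / r"
      using yb[OF b] r by (intro divide_right_mono mult_right_mono) auto
    then have z: "0 \<le> z" "z \<le> m" using yb[OF b] r m by (auto simp: z_def)
    have yz: "y \<bullet> b = a \<bullet> b + z * r / m" using r m by (simp add: z_def)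
    \<comment> \<open>On the far face z equals m, and the floor would be one slice too high.\<close>
    define n where "n = (if z = m then m - 1 else nat \<lfloor>z\<rfloor>)"
    have n: "n < m" "real n \<le> z" "z \<le> real n + 1"
      using z m unfolding n_def by (auto split: if_splits) linarith+
    then have "real n * r / m \<le> z * r / m" "z * r / m \<le> (real n + 1) * r / m"
      using r by (auto intro!: divide_right_mono mult_right_mono)
    then show ?thesis using n(1) yz by (intro exI[of _ n]) auto
  qed
  then obtain n where n: "\<And>b. b \<in> Basis \<Longrightarrow> n b < m \<and> a \<bullet> b + real (n b) * r / m \<le> y \<bullet> b \<and> y \<bullet> b \<le> a \<bullet> b + (real (n b) + 1) * r / m"
    by metis
  define j where "j = restrict n (Basis - {i})"
  have "j \<in> (Basis - {i}) \<rightarrow>\<^sub>E {..<m}" using n by (auto simp: j_def)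
  moreover have "y \<in> tube i a r m j"
    unfolding mem_tube[OF i] using n yb i by (auto simp: j_def)
  ultimately show "y \<in> (\<Union>j\<in>(Basis - {i}) \<rightarrow>\<^sub>E {..<m}. tube i a r m j)" by blast
qed

lemma tube_subset_cube:
  fixes i :: "'a::euclidean_space"
  assumes i: "i \<in> Basis" and r: "r > 0" and m: "m > 0" and j: "j \<in> (Basis - {i}) \<rightarrow>\<^sub>E {..<m}"
  shows "tube i a r m j \<subseteq> cbox a (a + r *\<^sub>R One)"
proof
  fix y assume y: "y \<in> tube i a r m j"
  have "a \<bullet> b \<le> y \<bullet> b \<and> y \<bullet> b \<le> a \<bullet> b + r" if b: "b \<in> Basis" for b
  proof (cases "b = i")
    case False
    then have "j b < m" using j b by auto
    then have "real (j b) + 1 \<le> m" by simp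
    then have "(real (j b) + 1) * r / m \<le> m * r / m"
      using r by (intro divide_right_mono mult_right_mono) auto
    then have "(real (j b) + 1) * r / m \<le> r" "0 \<le> j b * r / m"
      using r m by auto
    moreover have "a \<bullet> b + j b * r / m \<le> y \<bullet> b" "y \<bullet> b \<le> a \<bullet> b + (real (j b) + 1) * r / m"
      using y b False unfolding mem_tube[OF i] by auto
    ultimately show ?thesis by linarith
  qed (use y i in \<open>auto simp: mem_tube\<close>)
  then show "y \<in> cbox a (a + r *\<^sub>R One)" by (auto simp: mem_box inner_add_left)
qed

text \<open>Since 2 h \<le> r, one of the intervals [s,s+h] and [s-h,s] stays inside the large
  interval; having length h, it cannot lie entirely outside \<open>U\<close>.\<close>

lemma interval_meets:
  fixes U :: "real set"
  assumes s: "\<alpha> \<le> s" "s \<le> \<alpha> + r" and h: "2 * h \<le> r" "0 \<le> h"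
    and U: "U \<in> sets lborel" and less: "emeasure lborel ({\<alpha>..\<alpha>+r} - U) < ennreal h"
  shows "\<exists>t\<in>U. \<alpha> \<le> t \<and> t \<le> \<alpha> + r \<and> \<bar>t - s\<bar> \<le> h"
proof (rule ccontr)
  assume no: "\<not> ?thesis"
  define l where "l = (if s + h \<le> \<alpha> + r then s else s - h)"
  have l: "\<alpha> \<le> l" "l + h \<le> \<alpha> + r" "\<And>t. l \<le> t \<Longrightarrow> t \<le> l + h \<Longrightarrow> \<bar>t - s\<bar> \<le> h"
    unfolding l_def using s h by (auto split: if_splits)
  have "{l..l+h} \<subseteq> {\<alpha>..\<alpha>+r} - U"
  proof
    fix t assume t: "t \<in> {l..l+h}"
    then have "\<alpha> \<le> t" "t \<le> \<alpha> + r" "\<bar>t - s\<bar> \<le> h" using l(1,2) l(3)[of t] by auto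
    then show "t \<in> {\<alpha>..\<alpha>+r} - U" using no by auto
  qed
  then have "emeasure lborel {l..l+h} \<le> emeasure lborel ({\<alpha>..\<alpha>+r} - U)"
    using U by (intro emeasure_mono) auto
  with less h show False by simp
qed

text \<open>The assumption \<open>chord\<close> is all that is kept of the geometry of the target
  and of \<Phi>: e is the speed of the image under \<Phi>, and D absorbs every constant of the chord
  bound. Compactness of \<open>K\<close> makes its slices by lines compact, as \<open>chord\<close>
  demands.\<close>

locale nearly_constant_lines =
  fixes f :: "'b::euclidean_space \<Rightarrow> 'a::metric_space" and K :: "'b set" and L D e :: real and i :: 'b
  assumes L: "L-lipschitz_on K f" and D: "D \<ge> 0" and i: "i \<in> Basis"
    and compact_K: "compact K"
    and chord: "\<And>T a b y. compact T \<Longrightarrow> a \<in> T \<Longrightarrow> b \<in> T \<Longrightarrow> a \<le> b \<Longrightarrow>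
      (\<And>t. t \<in> T \<Longrightarrow> y + t *\<^sub>R i \<in> K) \<Longrightarrow>
      dist (f (y + a *\<^sub>R i)) (f (y + b *\<^sub>R i)) \<le> D * (e * (b - a) + measure lebesgue ({a..b} - T))"
begin

lemma L0: "L \<ge> 0" using L by (rule lipschitz_on_nonneg)

lemma K_borel: "K \<in> sets borel" using compact_K by (simp add: borel_compact)

text \<open>Both points are joined through a good line in the tube. Each lies within 4 r / m, in
  every coordinate, of a point of \<open>K\<close> on that line, which costs 8 L DIM in total.
  Moving along the line costs D times (r / m for the speed plus 3 r / m for the gaps).\<close>

lemma tube_diameter:
  assumes r: "r > 0" and m: "m \<ge> 8" and e: "0 \<le> e" "e \<le> 1 / real m"
    and bad: "emeasure lborel (tube i a r m j - K) \<le> ennreal (r ^ DIM('b) / real m ^ DIM('b))"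
    and xy: "x \<in> K \<inter> tube i a r m j" "y \<in> K \<inter> tube i a r m j"
  shows "dist (f x) (f y) \<le> (8 * L * DIM('b) + 4 * D) * (r / m)"
proof -
  let ?P = "tube i a r m j" and ?k = "DIM('b)"
  have m0: "real m > 0" using m by simp
  have Pb: "?P \<in> sets borel" by (simp add: tube_def)
  \<comment> \<open>The base point of the line is not known yet, so parameters range over [-r,r],
    which crosses the tube from any of its points. The average slice of the bad set is at most 2 r /
    m; taking 3 makes the inequality strict.\<close>
  have "emeasure lborel {-r..r} * emeasure lborel (?P - K) < ennreal (3 * r / m) * emeasure lborel ?P"
  proof -
    have "emeasure lborel {-r..r} * emeasure lborel (?P - K)
        \<le> ennreal (2 * r) * ennreal (r ^ ?k / real m ^ ?k)"
      using bad r by (intro mult_mono) auto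
    also have "\<dots> = ennreal (2 * r * (r ^ ?k / real m ^ ?k))" using r by (intro ennreal_mult[symmetric]) auto
    also have "\<dots> < ennreal (3 * r * (r ^ ?k / real m ^ ?k))" using r m0 by (intro ennreal_lessI mult_strict_right_mono) auto
    also have "r ^ ?k / real m ^ ?k = (r / m) * (r / m) ^ (?k - 1)"
      using power_Suc[of "r / m" "?k - 1"] by (simp add: power_divide)
    also have "3 * r * ((r / m) * (r / m) ^ (?k - 1)) = 3 * r / m * (r * (r / m) ^ (?k - 1))" by simp
    also have "ennreal \<dots> = ennreal (3 * r / m) * emeasure lborel ?P"
      using r m0 i by (subst ennreal_mult) (auto simp: emeasure_tube)
    finally show ?thesis .
  qed
  then obtain z where z: "z \<in> ?P" and gz: "emeasure lborel {t \<in> {-r..r}. z + t *\<^sub>R i \<in> ?P - K} \<le> ennreal (3 * r / m)"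
    using exists_good_line[of ?P "?P - K" "{-r..r}" "ennreal (3 * r / m)" i] Pb K_borel by auto
  \<comment> \<open>The parameter at which the line through z enters the tube.\<close>
  define \<alpha> where "\<alpha> = a \<bullet> i - z \<bullet> i"
  have zi: "a \<bullet> i \<le> z \<bullet> i" "z \<bullet> i \<le> a \<bullet> i + r"
    "\<And>b. b \<in> Basis \<Longrightarrow> b \<noteq> i \<Longrightarrow> a \<bullet> b + j b * r / m \<le> z \<bullet> b \<and> z \<bullet> b \<le> a \<bullet> b + (real (j b) + 1) * r / m"
    using z unfolding mem_tube[OF i] by auto
  have line: "z + t *\<^sub>R i \<in> ?P" if "\<alpha> \<le> t" "t \<le> \<alpha> + r" for t
    unfolding mem_tube[OF i] using zi that i by (auto simp: \<alpha>_def inner_add_left inner_Basis)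
  define U where "U = {\<alpha>..\<alpha>+r} \<inter> {t. z + t *\<^sub>R i \<in> K}"
  have "closed {t. z + t *\<^sub>R i \<in> K}"
    using closed_vimage[OF compact_imp_closed[OF compact_K], of "\<lambda>t. z + t *\<^sub>R i"]
    by (simp add: vimage_def continuous_intros)
  then have U: "compact U" unfolding U_def by (simp add: compact_Int_closed)
  then have Ub: "U \<in> sets borel" by (rule borel_compact)
  have "{\<alpha>..\<alpha>+r} - U \<subseteq> {t \<in> {-r..r}. z + t *\<^sub>R i \<in> ?P - K}"
    using line zi by (auto simp: U_def \<alpha>_def)
  moreover have "{t \<in> {-r..r}. z + t *\<^sub>R i \<in> ?P - K} \<in> sets borel"
    using Pb K_borel by (intro sets_line_slice) auto
  ultimately have "emeasure lborel ({\<alpha>..\<alpha>+r} - U) \<le> emeasure lborel {t \<in> {-r..r}. z + t *\<^sub>R i \<in> ?P - K}"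
    by (intro emeasure_mono) auto
  then have bU: "emeasure lborel ({\<alpha>..\<alpha>+r} - U) \<le> ennreal (3 * r / m)"
    using gz by (rule order.trans)
  also have "ennreal (3 * r / m) < ennreal (4 * r / m)" using r m0 by (intro ennreal_lessI) (auto simp: field_simps)
  finally have bU4: "emeasure lborel ({\<alpha>..\<alpha>+r} - U) < ennreal (4 * r / m)" .
  have near: "\<exists>t\<in>U. dist (f w) (f (z + t *\<^sub>R i)) \<le> L * (?k * (4 * r / m))" if w: "w \<in> K \<inter> ?P" for w
  proof -
    have wi: "a \<bullet> i \<le> w \<bullet> i" "w \<bullet> i \<le> a \<bullet> i + r"
      "\<And>b. b \<in> Basis \<Longrightarrow> b \<noteq> i \<Longrightarrow> a \<bullet> b + j b * r / m \<le> w \<bullet> b \<and> w \<bullet> b \<le> a \<bullet> b + (real (j b) + 1) * r / m"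
      using w unfolding Int_iff mem_tube[OF i] by auto
    \<comment> \<open>This is where m \<ge> 8 enters: the half-width 4 r / m must fit twice into the
      length of the line.\<close>
    have "8 * r \<le> m * r" using m r by (intro mult_right_mono) auto
    then have "2 * (4 * r / m) \<le> r" using m0 by (simp add: field_simps)
    then obtain t where t: "t \<in> U" "\<bar>t - (w \<bullet> i - z \<bullet> i)\<bar> \<le> 4 * r / m"
      using interval_meets[of \<alpha> "w \<bullet> i - z \<bullet> i" r "4 * r / m" U] wi r m0 bU4 Ub
      by (auto simp: \<alpha>_def)
    have "dist w (z + t *\<^sub>R i) \<le> ?k * (4 * r / m)"
    proof (rule dist_cube_le)
      fix b :: 'b assume b: "b \<in> Basis"
      show "\<bar>w \<bullet> b - (z + t *\<^sub>R i) \<bullet> b\<bar> \<le> 4 * r / m"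
      proof (cases "b = i")
        case True
        then show ?thesis using t(2) i by (simp add: inner_add_left abs_minus_commute algebra_simps)
      next
        case False
        have "\<bar>w \<bullet> b - z \<bullet> b\<bar> \<le> r / m"
          using wi(3)[OF b False] zi(3)[OF b False] by (auto simp: abs_le_iff add_divide_distrib distrib_right)
        also have "\<dots> \<le> 4 * r / m" using r m0 by (simp add: divide_right_mono)
        finally show ?thesis using False b i by (simp add: inner_add_left inner_Basis)
      qed
    qed
    moreover have "z + t *\<^sub>R i \<in> K" using t by (simp add: U_def)
    ultimately have "dist (f w) (f (z + t *\<^sub>R i)) \<le> L * (?k * (4 * r / m))"
      using L w L0 by (intro order.trans[OF lipschitz_onD[OF L] mult_left_mono]) auto
    then show ?thesis using t(1) by blast
  qed
  have along: "dist (f (z + s *\<^sub>R i)) (f (z + t *\<^sub>R i)) \<le> D * (4 * (r / m))" if st: "s \<in> U" "t \<in> U" "s \<le> t" for s t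
  proof -
    have "dist (f (z + s *\<^sub>R i)) (f (z + t *\<^sub>R i)) \<le> D * (e * (t - s) + measure lebesgue ({s..t} - U))"
      by (rule chord[OF U st]) (simp add: U_def)
    also have "\<dots> \<le> D * (1 / m * r + 3 * r / m)"
    proof (intro mult_left_mono add_mono mult_mono)
      show "t - s \<le> r" using st by (auto simp: U_def)
      have "measure lebesgue ({s..t} - U) = measure lborel ({s..t} - U)"
        using Ub by (intro measure_completion) auto
      also have "\<dots> \<le> 3 * r / m"
      proof -
        have "emeasure lborel ({s..t} - U) \<le> emeasure lborel ({\<alpha>..\<alpha>+r} - U)"
          using Ub st by (intro emeasure_mono) (auto simp: U_def)
        also note bU
        finally show ?thesis unfolding measure_def using r m0 by (intro enn2real_leI) auto
      qed
      finally show "measure lebesgue ({s..t} - U) \<le> 3 * r / m" .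
    qed (use e D r m0 st in auto)
    also have "1 / m * r + 3 * r / m = 4 * (r / m)" by (simp add: field_simps)
    finally show ?thesis .
  qed
  obtain s where s: "s \<in> U" "dist (f x) (f (z + s *\<^sub>R i)) \<le> L * (?k * (4 * r / m))" using near[OF xy(1)] by auto
  obtain t where t: "t \<in> U" "dist (f y) (f (z + t *\<^sub>R i)) \<le> L * (?k * (4 * r / m))" using near[OF xy(2)] by auto
  have "dist (f (z + s *\<^sub>R i)) (f (z + t *\<^sub>R i)) \<le> D * (4 * (r / m))"
    using along[of s t] along[of t s] s(1) t(1) by (cases "s \<le> t") (auto simp: dist_commute)
  then have "dist (f x) (f (z + s *\<^sub>R i)) + dist (f (z + s *\<^sub>R i)) (f (z + t *\<^sub>R i)) + dist (f y) (f (z + t *\<^sub>R i))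
      \<le> L * (?k * (4 * r / m)) + D * (4 * (r / m)) + L * (?k * (4 * r / m))"
    using s(2) t(2) by (intro add_mono)
  moreover have "dist (f x) (f y) \<le> dist (f x) (f (z + s *\<^sub>R i)) + dist (f (z + s *\<^sub>R i)) (f (z + t *\<^sub>R i)) + dist (f y) (f (z + t *\<^sub>R i))"
    by metric
  ultimately have "dist (f x) (f y) \<le> L * (?k * (4 * r / m)) + D * (4 * (r / m)) + L * (?k * (4 * r / m))"
    by (rule order.trans[rotated])
  also have "\<dots> = (8 * L * DIM('b) + 4 * D) * (r / m)" by (simp add: algebra_simps add_divide_distrib)
  finally show ?thesis .
qed

text \<open>A tube has volume r^k / m^(k-1), so the bound on the bad part of the whole cube leaves
  in every tube a bad fraction of at most 1/m, without averaging over tubes.\<close>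

lemma good_cube:
  assumes r: "r > 0" and m: "m \<ge> 8" and e: "0 \<le> e" "e \<le> 1 / real m"
    and bad: "emeasure lborel (cbox a (a + r *\<^sub>R One) - K) \<le> ennreal (r ^ DIM('b) / real m ^ DIM('b))"
  shows "hausdorff_content DIM('b) (f ` (K \<inter> cbox a (a + r *\<^sub>R One)))
    \<le> ennreal (unit_ball_vol DIM('b) * (4 * L * DIM('b) + 2 * D) ^ DIM('b) / m) * ennreal (r ^ DIM('b))"
proof -
  let ?k = "DIM('b)" and ?J = "(Basis - {i}) \<rightarrow>\<^sub>E {..<m}" and ?Q = "cbox a (a + r *\<^sub>R One)"
  let ?d = "(8 * L * ?k + 4 * D) * (r / m)" and ?w = "4 * L * ?k + 2 * D"
  have m0: "m > 0" using m by simp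
  have finJ: "finite ?J" by (intro finite_PiE) auto
  have cardJ: "card ?J = m ^ (?k - 1)"
    using i by (simp add: card_PiE card_Diff_singleton)
  have d0: "?d \<ge> 0" using L0 D r by simp
  have tube: "hausdorff_content ?k (f ` (K \<inter> tube i a r m j)) \<le> ennreal (unit_ball_vol ?k * (?d / 2) ^ ?k)" if j: "j \<in> ?J" for j
  proof (rule hausdorff_content_le)
    have "emeasure lborel (tube i a r m j - K) \<le> emeasure lborel (?Q - K)"
      using tube_subset_cube[OF i r m0 j] K_borel by (intro emeasure_mono) auto
    then have "emeasure lborel (tube i a r m j - K) \<le> ennreal (r ^ DIM('b) / real m ^ DIM('b))" using bad by (rule order.trans)
    then show "dist x y \<le> ?d" if "x \<in> f ` (K \<inter> tube i a r m j)" "y \<in> f ` (K \<inter> tube i a r m j)" for x y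
      using that tube_diameter[OF r m e] by blast
  qed (rule d0)
  have "hausdorff_content ?k (f ` (K \<inter> ?Q)) \<le> hausdorff_content ?k (\<Union>j\<in>?J. f ` (K \<inter> tube i a r m j))"
    using cube_subset_tubes[OF i r m0] by (intro hausdorff_content_mono) blast
  also have "\<dots> \<le> (\<Sum>j\<in>?J. hausdorff_content ?k (f ` (K \<inter> tube i a r m j)))"
    by (rule hausdorff_content_UN_finite[OF finJ])
  also have "\<dots> \<le> (\<Sum>j\<in>?J. ennreal (unit_ball_vol ?k * (?d / 2) ^ ?k))" by (intro sum_mono tube)
  also have "\<dots> = of_nat (m ^ (?k - 1)) * ennreal (unit_ball_vol ?k * (?d / 2) ^ ?k)"
    using cardJ by simp
  also have "\<dots> = ennreal (real (m ^ (?k - 1)) * (unit_ball_vol ?k * (?d / 2) ^ ?k))"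
    unfolding ennreal_of_nat_eq_real_of_nat using L0 D r by (intro ennreal_mult[symmetric]) auto
  also have "?d / 2 = ?w * r / m" using m0 by (simp add: field_simps)
  also have "real (m ^ (?k - 1)) * (unit_ball_vol ?k * (?w * r / m) ^ ?k)
      = unit_ball_vol ?k * ?w ^ ?k / m * r ^ ?k"
  proof -
    have "real m ^ ?k = m * real m ^ (?k - 1)" using power_Suc[of "real m" "?k - 1"] by simp
    then show ?thesis using m0 by (simp add: power_mult_distrib power_divide)
  qed
  also have "ennreal \<dots> = ennreal (unit_ball_vol ?k * ?w ^ ?k / m) * ennreal (r ^ ?k)"
    using L0 D r m0 by (intro ennreal_mult) auto
  finally show ?thesis .
qed

end

text \<open>\<open>A\<close> is replaced by a compact \<open>K\<close> and covered by cubes. Good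
  cubes contribute C times their volume. A bad cube has volume at most m^k times its part outside
  \<open>K\<close>, and these parts sum to at most \<eta>. As \<eta> is chosen after m, bad cubes
  and \<open>A - K\<close> cost less than \<epsilon>.\<close>

proposition hausdorff_content_image_nearly_constant:
  fixes f :: "'b::euclidean_space \<Rightarrow> 'a::metric_space"
  assumes A: "A \<in> lmeasurable" "bounded A" and f: "L-lipschitz_on A f" and D: "D \<ge> 0" and i: "i \<in> Basis"
    and m: "m \<ge> 8" and e: "0 \<le> e" "e \<le> 1 / real m"
    and chord: "\<And>T a b y. compact T \<Longrightarrow> a \<in> T \<Longrightarrow> b \<in> T \<Longrightarrow> a \<le> b \<Longrightarrow>
      (\<And>t. t \<in> T \<Longrightarrow> y + t *\<^sub>R i \<in> A) \<Longrightarrow>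
      dist (f (y + a *\<^sub>R i)) (f (y + b *\<^sub>R i)) \<le> D * (e * (b - a) + measure lebesgue ({a..b} - T))"
  shows "hausdorff_content DIM('b) (f ` A)
    \<le> ennreal (unit_ball_vol DIM('b) * (4 * L * DIM('b) + 2 * D) ^ DIM('b) / m * measure lebesgue A)"
proof (rule ennreal_le_epsilon)
  fix \<epsilon> :: real assume \<epsilon>: "\<epsilon> > 0"
  let ?k = "DIM('b)"
  have L: "L \<ge> 0" using f by (rule lipschitz_on_nonneg)
  have m0: "real m > 0" using m by simp
  define C where "C = unit_ball_vol ?k * (4 * L * ?k + 2 * D) ^ ?k / m"
  define c where "c = unit_ball_vol ?k * (L * ?k / 2) ^ ?k"
  have C0: "C \<ge> 0" and c0: "c \<ge> 0" unfolding C_def c_def using L D by auto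
  \<comment> \<open>Collects all coefficients with which \<eta> enters the final estimate; the
    summand 1 makes it positive.\<close>
  define Z where "Z = C + c * real m ^ ?k + c + 1"
  have Z: "Z > 0" unfolding Z_def using C0 c0 m0 by (auto intro!: add_nonneg_pos add_nonneg_nonneg)
  define \<eta> where "\<eta> = \<epsilon> / Z"
  have \<eta>: "\<eta> > 0" unfolding \<eta>_def using \<epsilon> Z by simp
  have As: "A \<in> sets lebesgue" using A by simp
  obtain K where KA: "closed K" "K \<subseteq> A" "A - K \<in> lmeasurable" "emeasure lebesgue (A - K) < ennreal \<eta>"
    using sets_lebesgue_inner_closed[OF As \<eta>] by metis
  have cK: "compact K" using KA A bounded_subset compact_eq_bounded_closed by blast
  have AK: "measure lebesgue (A - K) \<le> \<eta>"
    using KA(4) \<eta> unfolding measure_def by (intro enn2real_leI) auto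
  interpret nearly_constant_lines f K L D e i
  proof
    show "L-lipschitz_on K f" using f KA(2) by (rule lipschitz_on_subset)
    show "dist (f (y + a *\<^sub>R i)) (f (y + b *\<^sub>R i)) \<le> D * (e * (b - a) + measure lebesgue ({a..b} - T))"
      if "compact T" "a \<in> T" "b \<in> T" "a \<le> b" "\<And>t. t \<in> T \<Longrightarrow> y + t *\<^sub>R i \<in> K" for T a b y
      using that KA(2) by (intro chord) auto
  qed (use D i cK in auto)
  have Klm: "K \<in> lmeasurable" using cK by (rule lmeasurable_compact)
  obtain a :: "nat \<Rightarrow> 'b" and r where ar: "\<forall>i. r i \<ge> 0"
    "K \<subseteq> (\<Union>i. cbox (a i) (a i + r i *\<^sub>R One))"
    "(\<Sum>i. ennreal (r i ^ ?k)) \<le> ennreal (measure lebesgue K + \<eta>)"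
    "(\<Sum>i. emeasure lebesgue (cbox (a i) (a i + r i *\<^sub>R One) - K)) \<le> ennreal \<eta>"
    using cube_cover[OF Klm compact_imp_bounded[OF cK] \<eta>] by blast
  define Q where "Q n = cbox (a n) (a n + r n *\<^sub>R One)" for n
  have cube: "hausdorff_content ?k (f ` (K \<inter> Q n))
    \<le> ennreal C * ennreal (r n ^ ?k) + ennreal (c * real m ^ ?k) * emeasure lebesgue (Q n - K)" for n
  proof (cases "r n > 0 \<and> emeasure lebesgue (Q n - K) \<le> ennreal (r n ^ ?k / real m ^ ?k)")
    case True
    then have "emeasure lborel (cbox (a n) (a n + r n *\<^sub>R One) - K) \<le> ennreal (r n ^ ?k / real m ^ ?k)"
      using K_borel by (simp add: Q_def)
    then have "hausdorff_content ?k (f ` (K \<inter> Q n)) \<le> ennreal C * ennreal (r n ^ ?k)"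
      unfolding Q_def C_def using True m e by (intro good_cube) auto
    also have "\<dots> \<le> ennreal C * ennreal (r n ^ ?k) + ennreal (c * real m ^ ?k) * emeasure lebesgue (Q n - K)" by simp
    finally show ?thesis .
  next
    case False
    have "hausdorff_content ?k (f ` (K \<inter> Q n)) \<le> ennreal c * ennreal (r n ^ ?k)"
      unfolding Q_def c_def using ar(1) by (intro hausdorff_content_lipschitz_cube[OF lipschitz_on_subset[OF f KA(2)]]) auto
    also have "ennreal (r n ^ ?k) \<le> ennreal (real m ^ ?k) * emeasure lebesgue (Q n - K)"
    proof (cases "r n > 0")
      case True
      have "ennreal (r n ^ ?k) = ennreal (real m ^ ?k) * ennreal (r n ^ ?k / real m ^ ?k)"
        using m0 ar(1) by (subst ennreal_mult[symmetric]) auto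
      also have "\<dots> \<le> ennreal (real m ^ ?k) * emeasure lebesgue (Q n - K)"
        using False True by (intro mult_left_mono) auto
      finally show ?thesis .
    next
      case False
      then have "r n = 0" using ar(1) by (metis not_less order_antisym)
      then show ?thesis by (simp add: zero_power)
    qed
    then have "ennreal c * ennreal (r n ^ ?k) \<le> ennreal c * (ennreal (real m ^ ?k) * emeasure lebesgue (Q n - K))"
      by (intro mult_left_mono) auto
    also have "\<dots> = ennreal (c * real m ^ ?k) * emeasure lebesgue (Q n - K)"
      using c0 by (simp add: ennreal_mult mult.assoc)
    also have "\<dots> \<le> ennreal C * ennreal (r n ^ ?k) + ennreal (c * real m ^ ?k) * emeasure lebesgue (Q n - K)" by simp
    finally show ?thesis .
  qed
  have "hausdorff_content ?k (f ` K) \<le> hausdorff_content ?k (\<Union>n. f ` (K \<inter> Q n))"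
    using ar(2) unfolding Q_def by (intro hausdorff_content_mono) blast
  also have "\<dots> \<le> (\<Sum>n. hausdorff_content ?k (f ` (K \<inter> Q n)))" by (rule hausdorff_content_UN)
  also have "\<dots> \<le> (\<Sum>n. ennreal C * ennreal (r n ^ ?k) + ennreal (c * real m ^ ?k) * emeasure lebesgue (Q n - K))"
    by (intro suminf_le cube summableI)
  also have "\<dots> = (\<Sum>n. ennreal C * ennreal (r n ^ ?k)) + (\<Sum>n. ennreal (c * real m ^ ?k) * emeasure lebesgue (Q n - K))"
    by (intro suminf_add[symmetric] summableI)
  also have "\<dots> = ennreal C * (\<Sum>n. ennreal (r n ^ ?k)) + ennreal (c * real m ^ ?k) * (\<Sum>n. emeasure lebesgue (Q n - K))"
    by (simp only: ennreal_suminf_cmult)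
  also have "\<dots> \<le> ennreal C * ennreal (measure lebesgue K + \<eta>) + ennreal (c * real m ^ ?k) * ennreal \<eta>"
    unfolding Q_def using ar(3,4) by (intro add_mono mult_left_mono) auto
  also have "\<dots> = ennreal (C * (measure lebesgue K + \<eta>) + c * real m ^ ?k * \<eta>)"
    using C0 c0 \<eta> by (simp add: ennreal_mult ennreal_plus)
  finally have 1: "hausdorff_content ?k (f ` K) \<le> ennreal (C * (measure lebesgue K + \<eta>) + c * real m ^ ?k * \<eta>)" .
  have "hausdorff_content ?k (f ` (A - K)) \<le> ennreal (c * measure lebesgue (A - K))"
    unfolding c_def using KA(3) A(2) by (intro hausdorff_content_lipschitz_image_le lipschitz_on_subset[OF f]) (auto intro: bounded_subset)
  also have "\<dots> \<le> ennreal (c * \<eta>)" using AK c0 by (intro ennreal_leI mult_left_mono)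
  finally have 2: "hausdorff_content ?k (f ` (A - K)) \<le> ennreal (c * \<eta>)" .
  have "f ` A = f ` K \<union> f ` (A - K)" using KA(2) by blast
  then have "hausdorff_content ?k (f ` A) \<le> hausdorff_content ?k (f ` K) + hausdorff_content ?k (f ` (A - K))"
    using hausdorff_content_Un by metis
  also have "\<dots> \<le> ennreal (C * (measure lebesgue K + \<eta>) + c * real m ^ ?k * \<eta>) + ennreal (c * \<eta>)"
    by (intro add_mono 1 2)
  also have "\<dots> = ennreal (C * (measure lebesgue K + \<eta>) + c * real m ^ ?k * \<eta> + c * \<eta>)"
    using C0 c0 \<eta> by (intro ennreal_plus[symmetric]) auto
  also have "\<dots> \<le> ennreal (C * measure lebesgue A + \<epsilon>)"
  proof (rule ennreal_leI)
    have "measure lebesgue K \<le> measure lebesgue A" using KA(2) A Klm by (intro measure_mono_fmeasurable) auto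
    then have "C * measure lebesgue K \<le> C * measure lebesgue A" using C0 by (rule mult_left_mono)
    moreover have "C * \<eta> + c * real m ^ ?k * \<eta> + c * \<eta> = (Z - 1) * \<eta>" by (simp add: Z_def algebra_simps)
    moreover have "(Z - 1) * \<eta> \<le> Z * \<eta>" using \<eta> by (intro mult_right_mono) auto
    moreover have "Z * \<eta> = \<epsilon>" using Z by (simp add: \<eta>_def)
    ultimately show "C * (measure lebesgue K + \<eta>) + c * real m ^ ?k * \<eta> + c * \<eta> \<le> C * measure lebesgue A + \<epsilon>"
      by (simp add: distrib_left)
  qed
  also have "\<dots> = ennreal (C * measure lebesgue A) + ennreal \<epsilon>" using C0 \<epsilon> by (intro ennreal_plus) auto
  finally show "hausdorff_content ?k (f ` A) \<le> ennreal (unit_ball_vol ?k * (4 * L * ?k + 2 * D) ^ ?k / m * measure lebesgue A) + ennreal \<epsilon>"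
    unfolding C_def .
qed

subsection \<open>Density points and Rademacher's theorem\<close>

lemma measure_lebesgue_ball:
  "r \<ge> 0 \<Longrightarrow> measure lebesgue (ball (x::'a::euclidean_space) r) = unit_ball_vol DIM('a) * r ^ DIM('a)"
  by (simp add: content_ball)

text \<open>Passing to the complement replaces a limit of quotients by a bound on the missing
  volume, the form in which density is used below.\<close>

lemma density_point_iff:
  fixes S :: "'a::euclidean_space set"
  assumes S: "S \<in> sets lebesgue"
  shows "density_point S x \<longleftrightarrow>
    (\<forall>\<kappa>>0. \<exists>d>0. \<forall>r. 0 < r \<and> r < d \<longrightarrow> measure lebesgue (ball x r - S) \<le> \<kappa> * measure lebesgue (ball x r))"
proof -
  have eq: "measure lebesgue (S \<inter> ball x r) / measure lebesgue (ball x r) = 1 - measure lebesgue (ball x r - S) / measure lebesgue (ball x r)"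
    if "r > 0" for r
  proof -
    have "measure lebesgue (ball x r) = measure lebesgue (ball x r - S) + measure lebesgue (S \<inter> ball x r)"
    proof -
      have "measure lebesgue ((ball x r - S) \<union> (S \<inter> ball x r)) = measure lebesgue (ball x r - S) + measure lebesgue (S \<inter> ball x r)"
      proof (rule measure_Union)
        have 1: "ball x r - S \<in> lmeasurable" using S by (intro fmeasurable_Diff) auto
        then have "ball x r - (ball x r - S) \<in> lmeasurable" by (intro fmeasurable_Diff) auto
        moreover have "ball x r - (ball x r - S) = S \<inter> ball x r" by blast
        ultimately have "S \<inter> ball x r \<in> lmeasurable" by simp
        with 1 show "emeasure lebesgue (ball x r - S) \<noteq> \<infinity>" "emeasure lebesgue (S \<inter> ball x r) \<noteq> \<infinity>"
          using fmeasurableD2 unfolding infinity_ennreal_def by blast+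
      qed (use S in auto)
      moreover have "(ball x r - S) \<union> (S \<inter> ball x r) = ball x r" by blast
      ultimately show ?thesis by simp
    qed
    moreover have "measure lebesgue (ball x r) > 0" using that by (simp add: measure_lebesgue_ball)
    ultimately show ?thesis by (simp add: field_simps)
  qed
  define q where "q r = measure lebesgue (ball x r - S) / measure lebesgue (ball x r)" for r
  have "density_point S x \<longleftrightarrow> ((\<lambda>r. 1 - q r) \<longlongrightarrow> 1) (at_right 0)"
    unfolding density_point_def
  proof (rule filterlim_cong[OF refl refl])
    show "\<forall>\<^sub>F r in at_right 0. measure lebesgue (S \<inter> ball x r) / measure lebesgue (ball x r) = 1 - q r"
      unfolding eventually_at_right_field using eq by (intro exI[of _ 1]) (auto simp: q_def)
  qed
  also have "\<dots> \<longleftrightarrow> (q \<longlongrightarrow> 0) (at_right 0)"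
    using tendsto_diff[of "\<lambda>_. 1" 1 "at_right 0" q 0] tendsto_diff[of "\<lambda>_. 1" 1 "at_right 0" "\<lambda>r. 1 - q r" 1] by auto
  also have "\<dots> \<longleftrightarrow> (\<forall>\<kappa>>0. \<exists>d>0. \<forall>r. 0 < r \<and> r < d \<longrightarrow> q r < \<kappa>)"
    unfolding tendsto_iff eventually_at_right_field by (simp add: q_def) meson
  also have "\<dots> \<longleftrightarrow> (\<forall>\<kappa>>0. \<exists>d>0. \<forall>r. 0 < r \<and> r < d \<longrightarrow> q r \<le> \<kappa>)"
  proof (intro iffI allI impI)
    fix \<kappa> :: real assume *: "\<forall>\<kappa>>0. \<exists>d>0. \<forall>r. 0 < r \<and> r < d \<longrightarrow> q r \<le> \<kappa>" "\<kappa> > 0"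
    then obtain d where "d > 0" "\<forall>r. 0 < r \<and> r < d \<longrightarrow> q r \<le> \<kappa> / 2" using half_gt_zero by blast
    then show "\<exists>d>0. \<forall>r. 0 < r \<and> r < d \<longrightarrow> q r < \<kappa>" using *(2) by (intro exI[of _ d]) (auto simp: le_less_trans[of _ "\<kappa> / 2"])
  qed (meson less_imp_le)
  also have "\<dots> \<longleftrightarrow> (\<forall>\<kappa>>0. \<exists>d>0. \<forall>r. 0 < r \<and> r < d \<longrightarrow> measure lebesgue (ball x r - S) \<le> \<kappa> * measure lebesgue (ball x r))"
  proof -
    have "q r \<le> \<kappa> \<longleftrightarrow> measure lebesgue (ball x r - S) \<le> \<kappa> * measure lebesgue (ball x r)" if "r > 0" for r \<kappa>
    proof -
      have "measure lebesgue (ball x r) > 0" using that by (simp add: measure_lebesgue_ball)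
      then show ?thesis by (simp add: q_def pos_divide_le_eq)
    qed
    then show ?thesis by (meson)
  qed
  finally show ?thesis .
qed

text \<open>Otherwise \<open>S\<close> misses a ball of radius e' |h| inside the ball of radius 2
  |h| around x. That is the fraction (e'/2)^DIM of the larger ball, while \<kappa> allows only half
  of it. The cap e' \<le> 1 keeps the small ball inside the large one.\<close>

lemma density_point_near:
  fixes S :: "'a::euclidean_space set"
  assumes S: "S \<in> sets lebesgue" and x: "density_point S x" and e: "e > 0"
  shows "\<exists>d>0. \<forall>h. 0 < norm h \<and> norm h < d \<longrightarrow> (\<exists>a\<in>S. dist a (x + h) \<le> e * norm h)"
proof -
  define e' where "e' = min e 1"
  have e': "0 < e'" "e' \<le> 1" "e' \<le> e" using e by (auto simp: e'_def)
  define \<kappa> where "\<kappa> = (e' / 2) ^ DIM('a) / 2"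
  have \<kappa>: "\<kappa> > 0" using e' by (simp add: \<kappa>_def)
  obtain d where d: "d > 0" "\<And>r. 0 < r \<Longrightarrow> r < d \<Longrightarrow> measure lebesgue (ball x r - S) \<le> \<kappa> * measure lebesgue (ball x r)"
    using x \<kappa> unfolding density_point_iff[OF S] by blast
  show ?thesis
  proof (intro exI[of _ "d / 2"] conjI allI impI)
    show "d / 2 > 0" using d by simp
    fix h :: 'a assume h: "0 < norm h \<and> norm h < d / 2"
    show "\<exists>a\<in>S. dist a (x + h) \<le> e * norm h"
    proof (rule ccontr)
      assume "\<not> ?thesis"
      then have no: "dist a (x + h) > e * norm h" if "a \<in> S" for a using that by (meson not_le)
      have eh: "e' * norm h \<le> e * norm h" "e' * norm h \<le> norm h" using e' h by (auto simp: mult_left_le_one_le)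
      have "ball (x + h) (e' * norm h) \<subseteq> ball x (2 * norm h) - S"
      proof
        fix y assume y: "y \<in> ball (x + h) (e' * norm h)"
        then have "dist x y \<le> norm h + dist (x + h) y" using dist_triangle[of x y "x + h"] by (simp add: dist_norm)
        then have "dist x y < 2 * norm h" using y eh by simp
        moreover have "y \<notin> S" using no[of y] y eh by (auto simp: dist_commute)
        ultimately show "y \<in> ball x (2 * norm h) - S" by simp
      qed
      then have "measure lebesgue (ball (x + h) (e' * norm h)) \<le> measure lebesgue (ball x (2 * norm h) - S)"
        using S by (intro measure_mono_fmeasurable) (auto intro: fmeasurable_Diff)
      also have "\<dots> \<le> \<kappa> * measure lebesgue (ball x (2 * norm h))" using h by (intro d(2)) auto
      also have "\<dots> = (e' / 2) ^ DIM('a) / 2 * (unit_ball_vol DIM('a) * (2 * norm h) ^ DIM('a))"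
        by (subst measure_lebesgue_ball) (auto simp: \<kappa>_def)
      also have "\<dots> = unit_ball_vol DIM('a) * (e' * norm h) ^ DIM('a) / 2"
        by (simp add: power_mult_distrib power_divide)
      also have "measure lebesgue (ball (x + h) (e' * norm h)) = unit_ball_vol DIM('a) * (e' * norm h) ^ DIM('a)"
        using e' h by (intro measure_lebesgue_ball) simp
      finally have "unit_ball_vol DIM('a) * (e' * norm h) ^ DIM('a) \<le> unit_ball_vol DIM('a) * (e' * norm h) ^ DIM('a) / 2" .
      moreover have "unit_ball_vol DIM('a) * (e' * norm h) ^ DIM('a) > 0" using e' h by simp
      ultimately show False by linarith
    qed
  qed
qed

text \<open>Lebesgue's density theorem by Vitali covering. Balls in which \<open>S\<close> misses
  more than the fraction \<kappa> are taken inside an open T with |T - S| < \<kappa> e. For the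
  union U of the disjoint selected balls, \<kappa> |U| \<le> |U - S| \<le> |T - S|, so |U| \<le>
  e.\<close>

theorem negligible_not_density_point:
  fixes S :: "'a::euclidean_space set"
  assumes S: "S \<in> sets lebesgue"
  shows "negligible {x \<in> S. \<not> density_point S x}"
proof -
  define Z where "Z \<kappa> = {x \<in> S. \<forall>d>0. \<exists>r. 0 < r \<and> r < d \<and> measure lebesgue (ball x r - S) > \<kappa> * measure lebesgue (ball x r)}" for \<kappa>
  have neg: "negligible (Z \<kappa>)" if \<kappa>: "\<kappa> > 0" for \<kappa>
    unfolding negligible_outer_le
  proof (intro allI impI)
    fix e :: real assume e: "e > 0"
    have "\<kappa> * e > 0" using \<kappa> e by simp
    then obtain T where T: "open T" "S \<subseteq> T" "T - S \<in> lmeasurable" "emeasure lebesgue (T - S) < ennreal (\<kappa> * e)"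
      using sets_lebesgue_outer_open[OF S] by metis
    define K where "K = {(x, r). x \<in> Z \<kappa> \<and> 0 < r \<and> ball x r \<subseteq> T \<and> measure lebesgue (ball x r - S) > \<kappa> * measure lebesgue (ball x r)}"
    have "\<exists>i. i \<in> K \<and> x \<in> ball (fst i) (snd i) \<and> snd i < d" if "x \<in> Z \<kappa>" "0 < d" for x d
    proof -
      have "x \<in> T" using that T(2) by (auto simp: Z_def)
      then obtain d' where d': "d' > 0" "ball x d' \<subseteq> T" using T(1) open_contains_ball by blast
      then have md: "min d d' > 0" using that by simp
      from that(1) have "\<forall>d>0. \<exists>r. 0 < r \<and> r < d \<and> measure lebesgue (ball x r - S) > \<kappa> * measure lebesgue (ball x r)"
        by (simp add: Z_def)
      from this[rule_format, OF md] obtain r where r: "0 < r" "r < min d d'" "measure lebesgue (ball x r - S) > \<kappa> * measure lebesgue (ball x r)"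
        by blast
      have "ball x r \<subseteq> ball x d'" using r(2) by (intro subset_ball) simp
      then have "ball x r \<subseteq> T" using d'(2) by blast
      then show ?thesis using r that by (intro exI[of _ "(x, r)"]) (auto simp: K_def)
    qed
    then obtain C where C: "countable C" "C \<subseteq> K"
      "pairwise (\<lambda>i j. disjnt (ball (fst i) (snd i)) (ball (fst j) (snd j))) C"
      "negligible (Z \<kappa> - (\<Union>i\<in>C. ball (fst i) (snd i)))"
      by (rule Vitali_covering_theorem_balls[of "Z \<kappa>" K fst snd])
    define U where "U = (\<Union>i\<in>C. ball (fst i) (snd i))"
    have dis: "disjoint_family_on (\<lambda>i. ball (fst i) (snd i)) C"
      using C(3) by (auto simp: disjoint_family_on_def pairwise_def disjnt_def)
    have "ball (fst i) (snd i) \<subseteq> T" if "i \<in> K" for i using that by (simp add: K_def case_prod_unfold)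
    then have UT: "U \<subseteq> T" using C(2) unfolding U_def by blast
    have Um: "U \<in> sets lebesgue" unfolding U_def using C(1) by (intro sets.countable_UN') auto
    have "ennreal \<kappa> * emeasure lebesgue U = (\<integral>\<^sup>+i. ennreal \<kappa> * emeasure lebesgue (ball (fst i) (snd i)) \<partial>count_space C)"
      unfolding U_def using C(1) dis by (subst emeasure_UN_countable) (auto simp: nn_integral_cmult)
    also have "\<dots> \<le> (\<integral>\<^sup>+i. emeasure lebesgue (ball (fst i) (snd i) - S) \<partial>count_space C)"
    proof (rule nn_integral_mono)
      fix i assume "i \<in> space (count_space C)"
      then have i: "i \<in> K" using C(2) by auto
      have "ennreal \<kappa> * emeasure lebesgue (ball (fst i) (snd i)) = ennreal (\<kappa> * measure lebesgue (ball (fst i) (snd i)))"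
        using \<kappa> by (subst emeasure_eq_measure2) (auto simp: ennreal_mult)
      also have "\<dots> \<le> ennreal (measure lebesgue (ball (fst i) (snd i) - S))"
        using i by (intro ennreal_leI) (simp add: K_def case_prod_unfold)
      also have "\<dots> = emeasure lebesgue (ball (fst i) (snd i) - S)"
        using S by (intro emeasure_eq_measure2[symmetric] fmeasurable_Diff) auto
      finally show "ennreal \<kappa> * emeasure lebesgue (ball (fst i) (snd i)) \<le> emeasure lebesgue (ball (fst i) (snd i) - S)" .
    qed
    also have "\<dots> = emeasure lebesgue (\<Union>i\<in>C. ball (fst i) (snd i) - S)"
    proof (rule emeasure_UN_countable[symmetric])
      show "disjoint_family_on (\<lambda>i. ball (fst i) (snd i) - S) C"
        using dis by (rule disjoint_family_on_bisimulation) blast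
    qed (use C(1) S in auto)
    also have "(\<Union>i\<in>C. ball (fst i) (snd i) - S) = U - S" by (auto simp: U_def)
    also have "emeasure lebesgue (U - S) \<le> emeasure lebesgue (T - S)"
      using UT T(3) by (intro emeasure_mono) auto
    also have "\<dots> \<le> ennreal (\<kappa> * e)" using T(4) by simp
    also have "\<dots> = ennreal \<kappa> * ennreal e" using \<kappa> e by (simp add: ennreal_mult)
    finally have Ue: "emeasure lebesgue U \<le> ennreal e"
      using \<kappa> by (simp add: ennreal_mult_le_mult_iff)
    then have "emeasure lebesgue U < \<infinity>" by (simp add: order_le_less_trans)
    with Um have Ulm: "U \<in> lmeasurable" by (auto simp: fmeasurable_def)
    have N: "Z \<kappa> - U \<in> lmeasurable" "measure lebesgue (Z \<kappa> - U) = 0"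
      using C(4) by (auto simp: U_def negligible_iff_measure)
    have "measure lebesgue (U \<union> (Z \<kappa> - U)) \<le> measure lebesgue U + measure lebesgue (Z \<kappa> - U)"
      using Ulm N(1) by (intro measure_Un_le) auto
    also have "\<dots> \<le> e" using Ue e N(2) unfolding measure_def by (simp add: enn2real_leI)
    finally show "\<exists>T. Z \<kappa> \<subseteq> T \<and> T \<in> lmeasurable \<and> measure lebesgue T \<le> e"
      using fmeasurable.Un[OF Ulm N(1)] by (intro exI[of _ "U \<union> (Z \<kappa> - U)"]) auto
  qed
  have "{x \<in> S. \<not> density_point S x} \<subseteq> (\<Union>n. Z (1 / Suc n))"
  proof
    fix x assume "x \<in> {x \<in> S. \<not> density_point S x}"
    then have x: "x \<in> S" "\<not> density_point S x" by auto
    from x(2) obtain \<kappa> where \<kappa>: "\<kappa> > 0"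
      "\<not> (\<exists>d>0. \<forall>r. 0 < r \<and> r < d \<longrightarrow> measure lebesgue (ball x r - S) \<le> \<kappa> * measure lebesgue (ball x r))"
      unfolding density_point_iff[OF S] by blast
    obtain n where n: "1 / Suc n < \<kappa>" using nat_approx_posE[OF \<kappa>(1)] by auto
    have "\<exists>r. 0 < r \<and> r < d \<and> measure lebesgue (ball x r - S) > 1 / Suc n * measure lebesgue (ball x r)" if d: "d > 0" for d
    proof -
      obtain r where r: "0 < r" "r < d" "\<not> measure lebesgue (ball x r - S) \<le> \<kappa> * measure lebesgue (ball x r)"
        using \<kappa>(2) d by blast
      have "1 / Suc n * measure lebesgue (ball x r) \<le> \<kappa> * measure lebesgue (ball x r)"
        using n by (intro mult_right_mono) auto
      with r(3) have "1 / Suc n * measure lebesgue (ball x r) < measure lebesgue (ball x r - S)" by linarith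
      with r(1,2) show ?thesis by blast
    qed
    with x(1) have "x \<in> Z (1 / Suc n)" unfolding Z_def by blast
    then show "x \<in> (\<Union>n. Z (1 / Suc n))" by blast
  qed
  moreover have "negligible (\<Union>n. Z (1 / Suc n))" using neg by (intro negligible_countable_Union) auto
  ultimately show ?thesis by (rule negligible_subset[rotated])
qed

section \<open>Rademacher's theorem, from one variable to several\<close>

lemma lipschitz_plus_linear_mono:
  fixes h :: "real \<Rightarrow> real"
  assumes h: "L-lipschitz_on UNIV h" and xy: "x \<le> y"
  shows "h x + L * x \<le> h y + L * y" "h y + L * y - (h x + L * x) \<le> 2 * L * (y - x)"
  using lipschitz_onD[OF h, of x y] xy by (auto simp: dist_real_def abs_le_iff algebra_simps)

lemma UN_Int_Icc_real: "(\<Union>n::nat. S \<inter> {-real n..real n}) = S"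
proof -
  have "\<exists>n::nat. -real n \<le> x \<and> x \<le> real n" for x :: real
    using real_arch_simple[of "\<bar>x\<bar>"] by (force simp: abs_le_iff)
  then show ?thesis by auto
qed

text \<open>The slope of a Lipschitz function is almost everywhere almost constant at small scales: up to
  a linear term the function is the distribution function of a measure with a density, and almost
  every point is a density point of a set on which this density is nearly constant.\<close>

lemma lipschitz_real_ae_almost_affine:
  fixes h :: "real \<Rightarrow> real"
  assumes h: "L-lipschitz_on UNIV h" and \<epsilon>: "\<epsilon> > 0"
  shows "negligible {x. \<not> (\<exists>a d. d > 0 \<and> (\<forall>t. \<bar>t\<bar> < d \<longrightarrow> \<bar>h (x + t) - h x - t * a\<bar> \<le> \<epsilon> * \<bar>t\<bar>))}"
proof -
  define e where "e = \<epsilon> / 2"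
  have e: "e > 0" using \<epsilon> by (simp add: e_def)
  have L: "L \<ge> 0" using h by (rule lipschitz_on_nonneg)
  \<comment> \<open>The linear term makes the function nondecreasing, hence a distribution function;
    it is subtracted from the slope at the end.\<close>
  define F where "F x = h x + L * x" for x
  have mono: "F x \<le> F y" and lip: "F y - F x \<le> 2 * L * (y - x)" if "x \<le> y" for x y
    using lipschitz_plus_linear_mono[OF h that] by (auto simp: F_def)
  have contF: "continuous_on UNIV F"
    unfolding F_def using lipschitz_on_continuous_on[OF h] by (intro continuous_intros)
  have rc: "continuous (at_right a) F" for a
    using contF by (simp add: continuous_on_eq_continuous_at continuous_at_imp_continuous_at_within)
  define \<mu> where "\<mu> = interval_measure F"
  have sets\<mu>[simp]: "sets \<mu> = sets borel" by (simp add: \<mu>_def)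
  have Icc: "emeasure \<mu> {a..b} = ennreal (F b - F a)" if "a \<le> b" for a b
    unfolding \<mu>_def by (rule emeasure_interval_measure_Icc[OF that mono contF])
  \<comment> \<open>Domination by 2 L times Lebesgue measure yields absolute continuity, and later
    bounds the mass on the part of an interval where the density is not controlled.\<close>
  have le: "emeasure \<mu> S \<le> ennreal (2 * L * measure lebesgue S)" if S: "S \<in> sets borel" "bounded S" for S
  proof (rule ennreal_le_epsilon)
    fix e :: real assume e: "e > 0"
    define e' where "e' = e / (2 * L + 1)"
    have e': "e' > 0" using e L by (simp add: e'_def)
    have Slm: "S \<in> lmeasurable" using S by (intro bounded_set_imp_lmeasurable) auto
    obtain a r :: "nat \<Rightarrow> real" where ar: "\<forall>i. r i \<ge> 0"
      "S \<subseteq> (\<Union>i. cbox (a i) (a i + r i *\<^sub>R One))"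
      "(\<Sum>i. ennreal (r i ^ DIM(real))) \<le> ennreal (measure lebesgue S + e')"
      using cube_cover[OF Slm S(2) e'] by blast
    have "emeasure \<mu> S \<le> emeasure \<mu> (\<Union>i. {a i..a i + r i})"
      using ar(2) by (intro emeasure_mono) auto
    also have "\<dots> \<le> (\<Sum>i. emeasure \<mu> {a i..a i + r i})"
      by (rule emeasure_subadditive_countably) auto
    also have "\<dots> \<le> (\<Sum>i. ennreal (2 * L) * ennreal (r i))"
    proof (intro suminf_le summableI)
      fix i
      have "emeasure \<mu> {a i..a i + r i} \<le> ennreal (2 * L * r i)"
        using Icc[of "a i" "a i + r i"] lip[of "a i" "a i + r i"] ar(1) by (simp add: ennreal_leI)
      then show "emeasure \<mu> {a i..a i + r i} \<le> ennreal (2 * L) * ennreal (r i)"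
        using L ar(1) by (simp add: ennreal_mult)
    qed
    also have "\<dots> = ennreal (2 * L) * (\<Sum>i. ennreal (r i))" by (rule ennreal_suminf_cmult)
    also have "\<dots> \<le> ennreal (2 * L) * ennreal (measure lebesgue S + e')"
      using ar(3) by (intro mult_left_mono) auto
    also have "\<dots> = ennreal (2 * L * measure lebesgue S + 2 * L * e')"
      using L e' by (subst ennreal_mult[symmetric]) (auto simp: distrib_left)
    also have "\<dots> \<le> ennreal (2 * L * measure lebesgue S + e)"
    proof (intro ennreal_leI add_left_mono)
      show "2 * L * e' \<le> e" using L e by (simp add: e'_def field_simps)
    qed
    also have "\<dots> = ennreal (2 * L * measure lebesgue S) + ennreal e"
      using L e by (intro ennreal_plus) auto
    finally show "emeasure \<mu> S \<le> ennreal (2 * L * measure lebesgue S) + ennreal e" .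
  qed
  have "absolutely_continuous lborel \<mu>"
    unfolding absolutely_continuous_def
  proof
    fix N :: "real set" assume N: "N \<in> null_sets lborel"
    then have Nb: "N \<in> sets borel" by auto
    have "emeasure \<mu> (\<Union>n::nat. N \<inter> {-real n..real n}) = 0"
    proof (rule emeasure_UN_eq_0)
      fix n :: nat
      have "emeasure lborel (N \<inter> {-real n..real n}) \<le> emeasure lborel N" using Nb by (intro emeasure_mono) auto
      then have "measure lebesgue (N \<inter> {-real n..real n}) = 0" using N Nb by (simp add: measure_def null_sets_def)
      then show "emeasure \<mu> (N \<inter> {-real n..real n}) = 0"
        using le[of "N \<inter> {-real n..real n}"] Nb by (simp add: bounded_Int)
    qed (use Nb in auto)
    moreover have "N = (\<Union>n::nat. N \<inter> {-real n..real n})"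
      by (rule UN_Int_Icc_real[symmetric])
    ultimately show "N \<in> null_sets \<mu>" using Nb by (auto simp: null_sets_def)
  qed
  then obtain \<phi> where \<phi>[measurable]: "\<phi> \<in> borel_measurable lborel" and dens: "density lborel \<phi> = \<mu>"
    using sigma_finite_measure.Radon_Nikodym[OF sigma_finite_lborel, of \<mu>] by auto
  have em: "emeasure \<mu> S = (\<integral>\<^sup>+x. \<phi> x * indicator S x \<partial>lborel)" if "S \<in> sets borel" for S
    unfolding dens[symmetric] using that by (subst emeasure_density) auto
  \<comment> \<open>Level sets of the density with step e; together with the set where it is
    infinite they exhaust the line.\<close>
  define A where "A j = {x. ennreal (real j * e) \<le> \<phi> x \<and> \<phi> x < ennreal (real (Suc j) * e)}" for j :: nat
  have A[measurable]: "A j \<in> sets borel" for j unfolding A_def using \<phi> by measurable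
  have AL: "A j \<in> sets lebesgue" for j using A by simp
  define I where "I = {x. \<phi> x = top}"
  have I[measurable]: "I \<in> sets borel" unfolding I_def using \<phi> by measurable
  have negI: "negligible I"
  proof -
    have "emeasure lborel (I \<inter> {-real n..real n}) = 0" for n
    proof (rule ccontr)
      assume ne: "emeasure lborel (I \<inter> {-real n..real n}) \<noteq> 0"
      have "emeasure \<mu> (I \<inter> {-real n..real n}) = (\<integral>\<^sup>+x. top * indicator (I \<inter> {-real n..real n}) x \<partial>lborel)"
        by (subst em) (auto intro!: nn_integral_cong simp: I_def indicator_def)
      also have "\<dots> = top * emeasure lborel (I \<inter> {-real n..real n})"
        by (rule nn_integral_cmult_indicator) measurable
      also have "\<dots> = top" using ne by (simp add: ennreal_top_mult)
      finally show False using le[of "I \<inter> {-real n..real n}"] by (simp add: bounded_Int top_unique)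
    qed
    then have "emeasure lborel (\<Union>n::nat. I \<inter> {-real n..real n}) = 0"
      by (intro emeasure_UN_eq_0) auto
    moreover have "I = (\<Union>n::nat. I \<inter> {-real n..real n})"
      by (rule UN_Int_Icc_real[symmetric])
    ultimately have "emeasure lborel I = 0" by simp
    then show ?thesis by (simp add: negligible_iff_null_sets null_sets_completionI null_sets_def I)
  qed
  define B where "B = (\<Union>j. {x \<in> A j. \<not> density_point (A j) x}) \<union> I"
  have negB: "negligible B"
    unfolding B_def using negligible_not_density_point[OF AL] negI
    by (intro negligible_Un negligible_countable_Union) auto
  have "\<exists>a d. d > 0 \<and> (\<forall>t. \<bar>t\<bar> < d \<longrightarrow> \<bar>h (x + t) - h x - t * a\<bar> \<le> 2 * e * \<bar>t\<bar>)" if x: "x \<notin> B" for x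
  proof -
    have "\<phi> x < top" using x by (auto simp: B_def I_def top.not_eq_extremum)
    then obtain p where p: "\<phi> x = ennreal p" "p \<ge> 0" by (cases "\<phi> x") auto
    define j where "j = nat \<lfloor>p / e\<rfloor>"
    have pj: "real j \<le> p / e" "p / e < real (Suc j)"
      unfolding j_def using p(2) e by (auto simp: of_nat_nat) linarith+
    then have "real j * e \<le> p" "p < real (Suc j) * e" using e by (auto simp: field_simps)
    then have "x \<in> A j" using p e by (auto simp: A_def ennreal_leI ennreal_lessI)
    then have dp: "density_point (A j) x" using x by (auto simp: B_def)
    define P where "P = real j * e"
    have P: "P \<ge> 0" using e by (simp add: P_def)
    \<comment> \<open>On an interval of length l, at most 4 \<kappa> l is uncontrolled. Weighted
      with P and with 2 L this must stay below e l, whence 4 P and 8 L.\<close>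
    define \<kappa> where "\<kappa> = e / (8 * L + 4 * P + 1)"
    have den: "8 * L + 4 * P + 1 > 0" using L P by linarith
    then have \<kappa>: "\<kappa> > 0" unfolding \<kappa>_def using e by simp
    have "(8 * L + 4 * P + 1) * \<kappa> = e" using den by (simp add: \<kappa>_def)
    then have \<kappa>e: "8 * L * \<kappa> \<le> e" "4 * P * \<kappa> \<le> e" 
      using L P \<kappa> mult_nonneg_nonneg[of L \<kappa>] mult_nonneg_nonneg[of P \<kappa>] by (auto simp: algebra_simps)
    obtain d where d: "d > 0" "\<And>r. 0 < r \<Longrightarrow> r < d \<Longrightarrow> measure lebesgue (ball x r - A j) \<le> \<kappa> * measure lebesgue (ball x r)"
      using dp \<kappa> unfolding density_point_iff[OF AL] by blast
    \<comment> \<open>Later x is an endpoint of the interval; the factor 2 in the radius places the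
      closed interval inside an open ball. One e comes from the width of the level set, the other
      from the uncontrolled part.\<close>
    have slope: "\<bar>F v - F u - P * (v - u)\<bar> \<le> 2 * e * (v - u)"
      if uv: "u < v" "{u..v} \<subseteq> ball x (2 * (v - u))" "2 * (v - u) < d" for u v
    proof -
      define J where "J = {u..v}"
      have J: "J \<in> sets borel" "bounded J" by (auto simp: J_def)
      have Jlm: "J \<in> lmeasurable" "J - A j \<in> lmeasurable" "J \<inter> A j \<in> lmeasurable"
        using J by (auto intro!: bounded_set_imp_lmeasurable bounded_Int bounded_diff)
      have small: "measure lebesgue (J - A j) \<le> 4 * \<kappa> * (v - u)"
      proof -
        have "measure lebesgue (J - A j) \<le> measure lebesgue (ball x (2 * (v - u)) - A j)"
          using uv AL Jlm by (intro measure_mono_fmeasurable fmeasurable_Diff) (auto simp: J_def)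
        also have "\<dots> \<le> \<kappa> * measure lebesgue (ball x (2 * (v - u)))" using uv by (intro d(2)) auto
        also have "measure lebesgue (ball x (2 * (v - u))) = 4 * (v - u)"
          using uv(1) by (simp add: ball_eq_greaterThanLessThan)
        finally show ?thesis by (simp add: algebra_simps)
      qed
      have sum: "measure lebesgue (J \<inter> A j) = (v - u) - measure lebesgue (J - A j)"
      proof -
        have "measure lebesgue ((J \<inter> A j) \<union> (J - A j)) = measure lebesgue (J \<inter> A j) + measure lebesgue (J - A j)"
          using fmeasurableD2[OF Jlm(2)] fmeasurableD2[OF Jlm(3)] J AL by (intro measure_Union) auto
        moreover have "(J \<inter> A j) \<union> (J - A j) = J" by blast
        moreover have "measure lebesgue J = v - u" using uv(1) by (simp add: J_def)
        ultimately show ?thesis by simp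
      qed
      have \<mu>J: "emeasure \<mu> J = ennreal (F v - F u)" unfolding J_def using uv(1) by (intro Icc) simp
      have lbl: "emeasure lborel (J \<inter> A j) = ennreal (measure lebesgue (J \<inter> A j))"
        using emeasure_eq_measure2[OF Jlm(3)] J by simp
      have low: "ennreal P * emeasure lborel (J \<inter> A j) \<le> emeasure \<mu> (J \<inter> A j)"
      proof -
        have "ennreal P * emeasure lborel (J \<inter> A j) = (\<integral>\<^sup>+x. ennreal P * indicator (J \<inter> A j) x \<partial>lborel)"
          using J by (intro nn_integral_cmult_indicator[symmetric]) auto
        also have "\<dots> \<le> (\<integral>\<^sup>+x. \<phi> x * indicator (J \<inter> A j) x \<partial>lborel)"
          by (intro nn_integral_mono) (auto simp: indicator_def A_def P_def)
        finally show ?thesis using J by (simp add: em)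
      qed
      have up: "emeasure \<mu> (J \<inter> A j) \<le> ennreal (P + e) * emeasure lborel (J \<inter> A j)"
      proof -
        have "emeasure \<mu> (J \<inter> A j) = (\<integral>\<^sup>+x. \<phi> x * indicator (J \<inter> A j) x \<partial>lborel)" using J by (simp add: em)
        also have "\<dots> \<le> (\<integral>\<^sup>+x. ennreal (P + e) * indicator (J \<inter> A j) x \<partial>lborel)"
          by (intro nn_integral_mono) (auto simp: indicator_def A_def P_def algebra_simps)
        also have "\<dots> = ennreal (P + e) * emeasure lborel (J \<inter> A j)"
          using J by (intro nn_integral_cmult_indicator) auto
        finally show ?thesis .
      qed
      have Fuv: "0 \<le> F v - F u" using mono[of u v] uv(1) by simp
      have "ennreal (P * measure lebesgue (J \<inter> A j)) = ennreal P * emeasure lborel (J \<inter> A j)"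
        using P by (simp add: lbl ennreal_mult)
      also have "\<dots> \<le> emeasure \<mu> J" using low J by (elim order.trans, intro emeasure_mono) auto
      finally have 1: "P * measure lebesgue (J \<inter> A j) \<le> F v - F u"
        using Fuv by (simp add: \<mu>J ennreal_le_iff)
      have "emeasure \<mu> J = emeasure \<mu> ((J \<inter> A j) \<union> (J - A j))" by (intro arg_cong[where f="emeasure \<mu>"]) blast
      also have "\<dots> \<le> emeasure \<mu> (J \<inter> A j) + emeasure \<mu> (J - A j)"
        using J by (intro emeasure_subadditive) auto
      also have "\<dots> \<le> ennreal (P + e) * emeasure lborel (J \<inter> A j) + ennreal (2 * L * measure lebesgue (J - A j))"
        using J by (intro add_mono up le) (auto intro: bounded_diff)
      also have "\<dots> = ennreal ((P + e) * measure lebesgue (J \<inter> A j) + 2 * L * measure lebesgue (J - A j))"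
        using P e L by (simp add: lbl ennreal_mult ennreal_plus)
      finally have "emeasure \<mu> J \<le> ennreal ((P + e) * measure lebesgue (J \<inter> A j) + 2 * L * measure lebesgue (J - A j))" .
      have 2: "F v - F u \<le> (P + e) * measure lebesgue (J \<inter> A j) + 2 * L * measure lebesgue (J - A j)"
      proof -
        have "0 \<le> (P + e) * measure lebesgue (J \<inter> A j) + 2 * L * measure lebesgue (J - A j)" using P e L by simp
        then show ?thesis using \<open>emeasure \<mu> J \<le> ennreal ((P + e) * measure lebesgue (J \<inter> A j) + 2 * L * measure lebesgue (J - A j))\<close>
          unfolding \<mu>J by (subst (asm) ennreal_le_iff)
      qed
      have m0: "measure lebesgue (J - A j) \<ge> 0" by simp
      have "P * measure lebesgue (J - A j) \<le> P * (4 * \<kappa> * (v - u))" using P small by (rule mult_left_mono[rotated])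
      also have "\<dots> = (4 * P * \<kappa>) * (v - u)" by simp
      also have "\<dots> \<le> e * (v - u)" using \<kappa>e uv by (intro mult_right_mono) auto
      finally have 3: "P * measure lebesgue (J - A j) \<le> e * (v - u)" .
      have "2 * L * measure lebesgue (J - A j) \<le> 2 * L * (4 * \<kappa> * (v - u))" using L small by (intro mult_left_mono) auto
      also have "\<dots> = (8 * L * \<kappa>) * (v - u)" by simp
      also have "\<dots> \<le> e * (v - u)" using \<kappa>e uv by (intro mult_right_mono) auto
      finally have 4: "2 * L * measure lebesgue (J - A j) \<le> e * (v - u)" .
      have 5: "(P + e) * measure lebesgue (J \<inter> A j) \<le> (P + e) * (v - u)"
        using P e sum m0 by (intro mult_left_mono) auto
      have 6: "P * measure lebesgue (J \<inter> A j) = P * (v - u) - P * measure lebesgue (J - A j)"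
        by (simp add: sum right_diff_distrib)
      have "e * (v - u) \<ge> 0" using e uv by simp
      then show ?thesis using 1 2 3 4 5 6 by (simp add: abs_le_iff algebra_simps)
    qed
    have "\<bar>h (x + t) - h x - t * (P - L)\<bar> \<le> 2 * e * \<bar>t\<bar>" if t: "\<bar>t\<bar> < d / 2" for t
    proof -
      consider "t = 0" | "t > 0" | "t < 0" by linarith
      then show ?thesis
      proof cases
        case 2
        have "{x..x + t} \<subseteq> ball x (2 * (x + t - x))" using 2 by (auto simp: dist_real_def)
        then have "\<bar>F (x + t) - F x - P * (x + t - x)\<bar> \<le> 2 * e * (x + t - x)" using 2 t by (intro slope) auto
        then show ?thesis using 2 by (simp add: F_def algebra_simps)
      next
        case 3
        have "{x + t..x} \<subseteq> ball x (2 * (x - (x + t)))" using 3 by (auto simp: dist_real_def)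
        then have "\<bar>F x - F (x + t) - P * (x - (x + t))\<bar> \<le> 2 * e * (x - (x + t))" using 3 t by (intro slope) auto
        then show ?thesis using 3 by (simp add: F_def algebra_simps abs_minus_commute)
      qed simp
    qed
    then show ?thesis using d(1) by (intro exI[of _ "P - L"] exI[of _ "d / 2"]) auto
  qed
  then have "{x. \<not> (\<exists>a d. d > 0 \<and> (\<forall>t. \<bar>t\<bar> < d \<longrightarrow> \<bar>h (x + t) - h x - t * a\<bar> \<le> 2 * e * \<bar>t\<bar>))} \<subseteq> B" by blast
  then have "negligible {x. \<not> (\<exists>a d. d > 0 \<and> (\<forall>t. \<bar>t\<bar> < d \<longrightarrow> \<bar>h (x + t) - h x - t * a\<bar> \<le> 2 * e * \<bar>t\<bar>))}"
    by (rule negligible_subset[OF negB])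
  then show ?thesis by (simp add: e_def)
qed

text \<open>With slope, scale and tolerance fixed in advance the set is closed for Lipschitz
  \<open>G\<close>, hence measurable, and its density points make sense.\<close>

definition partial_slope :: "('a::euclidean_space \<Rightarrow> real) \<Rightarrow> 'a \<Rightarrow> real \<Rightarrow> real \<Rightarrow> real \<Rightarrow> 'a set" where
  "partial_slope G b a d e = {x. \<forall>t. \<bar>t\<bar> < d \<longrightarrow> \<bar>G (x + t *\<^sub>R b) - G x - t * a\<bar> \<le> e * \<bar>t\<bar>}"

lemma closed_partial_slope:
  assumes "L-lipschitz_on UNIV G"
  shows "closed (partial_slope G b a d e)"
  unfolding partial_slope_def
  by (intro closed_Collect_all closed_Collect_imp open_Collect_const closed_Collect_le continuous_intros
      continuous_on_compose2[OF lipschitz_on_continuous_on[OF assms]]) auto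

text \<open>Parameters restricted to [0,1] have total measure 1, so the slices integrate to exactly
  the measure of \<open>N\<close>.\<close>

lemma negligible_if_lines:
  fixes N :: "'a::euclidean_space set"
  assumes N: "N \<in> sets borel" and lines: "\<And>y. negligible {t. y + t *\<^sub>R v \<in> N}"
  shows "negligible N"
proof -
  have "(\<integral>\<^sup>+y. emeasure lborel {t \<in> {0..1}. y + t *\<^sub>R v \<in> N} \<partial>lborel) = emeasure lborel {0..1::real} * emeasure lborel N"
    by (rule nn_integral_lines) (use N in auto)
  moreover have "emeasure lborel {t \<in> {0..1}. y + t *\<^sub>R v \<in> N} = 0" for y
  proof -
    have b: "{t \<in> {0..1}. y + t *\<^sub>R v \<in> N} \<in> sets borel" using N by (intro sets_line_slice) auto
    have "negligible {t \<in> {0..1}. y + t *\<^sub>R v \<in> N}" by (rule negligible_subset[OF lines[of y]]) auto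
    then have "emeasure lebesgue {t \<in> {0..1}. y + t *\<^sub>R v \<in> N} = 0" using b by (subst negligible_iff_emeasure0[symmetric]) auto
    then show ?thesis using b by simp
  qed
  ultimately have "emeasure lborel N = 0" by simp
  then have "N \<in> null_sets lborel" using N by auto
  then show ?thesis by (simp add: negligible_iff_null_sets null_sets_completionI)
qed

text \<open>The one-variable statement is applied on all lines parallel to b. Rational slopes and
  scales 1/(n+1) keep the union countable and thus measurable; half of the tolerance pays for making
  the slope rational.\<close>

lemma negligible_no_partial_slope:
  fixes G :: "'a::euclidean_space \<Rightarrow> real"
  assumes G: "L-lipschitz_on UNIV G" and e: "e > 0" and b: "b \<in> Basis"
  shows "negligible (- (\<Union>a\<in>\<rat>. \<Union>n. partial_slope G b a (1 / real (Suc n)) e))"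
proof (rule negligible_if_lines[of _ b])
  let ?F = "\<Union>a\<in>\<rat>. \<Union>n. partial_slope G b a (1 / real (Suc n)) e"
  have "?F \<in> sets borel"
    using closed_partial_slope[OF G] by (intro sets.countable_UN' countable_rat) auto
  then show "- ?F \<in> sets borel" by (rule borel_comp)
  fix y :: 'a
  define h where "h t = G (y + t *\<^sub>R b)" for t
  have "L-lipschitz_on UNIV h"
  proof (rule lipschitz_onI)
    show "dist (h s) (h t) \<le> L * dist s t" for s t
      using lipschitz_onD[OF G, of "y + s *\<^sub>R b" "y + t *\<^sub>R b"] b
      by (simp add: h_def dist_norm flip: scaleR_diff_left)
  qed (use G in \<open>rule lipschitz_on_nonneg\<close>)
  then have neg: "negligible {x. \<not> (\<exists>a d. d > 0 \<and> (\<forall>t. \<bar>t\<bar> < d \<longrightarrow> \<bar>h (x + t) - h x - t * a\<bar> \<le> e / 2 * \<bar>t\<bar>))}"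
    using e by (intro lipschitz_real_ae_almost_affine) auto
  have "y + x *\<^sub>R b \<in> ?F" if d: "d > 0" "\<forall>t. \<bar>t\<bar> < d \<longrightarrow> \<bar>h (x + t) - h x - t * a\<bar> \<le> e / 2 * \<bar>t\<bar>" for x a d
  proof -
    obtain q where q: "q \<in> \<rat>" "a < q" "q < a + e / 2" using Rats_dense_in_real[of a "a + e / 2"] e by auto
    obtain n where n: "1 / real (Suc n) < d" using nat_approx_posE[OF d(1)] by auto
    have "\<bar>G (y + x *\<^sub>R b + t *\<^sub>R b) - G (y + x *\<^sub>R b) - t * q\<bar> \<le> e * \<bar>t\<bar>" if t: "\<bar>t\<bar> < 1 / real (Suc n)" for t
    proof -
      have "\<bar>h (x + t) - h x - t * a\<bar> \<le> e / 2 * \<bar>t\<bar>" using t n d(2) by auto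
      moreover have "\<bar>t * (q - a)\<bar> \<le> e / 2 * \<bar>t\<bar>" using q mult_left_mono[of "q - a" "e / 2" "\<bar>t\<bar>"] by (simp add: abs_mult mult.commute)
      moreover have "h (x + t) - h x - t * q = (h (x + t) - h x - t * a) - t * (q - a)" by (simp add: algebra_simps)
      ultimately have "\<bar>h (x + t) - h x - t * q\<bar> \<le> e * \<bar>t\<bar>" by linarith
      then show ?thesis by (simp add: h_def scaleR_add_left add.assoc)
    qed
    then have "y + x *\<^sub>R b \<in> partial_slope G b q (1 / real (Suc n)) e" by (simp add: partial_slope_def)
    then show ?thesis using q(1) by blast
  qed
  then have "{t. y + t *\<^sub>R b \<in> - ?F} \<subseteq> {x. \<not> (\<exists>a d. d > 0 \<and> (\<forall>t. \<bar>t\<bar> < d \<longrightarrow> \<bar>h (x + t) - h x - t * a\<bar> \<le> e / 2 * \<bar>t\<bar>))}"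
    by blast
  with neg show "negligible {t. y + t *\<^sub>R b \<in> - ?F}" by (rule negligible_subset)
qed

text \<open>Moving from \<open>x\<close> to \<open>x + h\<close> one coordinate at a time, every intermediate point can be replaced
  by a nearby point of the set on which the next partial slope is controlled.\<close>

lemma almost_affine_at_density_points:
  fixes G :: "'a::euclidean_space \<Rightarrow> real"
    and L :: real
  assumes G: "L-lipschitz_on UNIV G" and e: "e > 0"
    and x: "\<And>b. b \<in> Basis \<Longrightarrow> \<delta> b > 0 \<and> x \<in> partial_slope G b (\<alpha> b) (\<delta> b) e \<and> density_point (partial_slope G b (\<alpha> b) (\<delta> b) e) x"
  shows "\<exists>d>0. \<forall>h. norm h < d \<longrightarrow>
    \<bar>G (x + h) - G x - (\<Sum>b\<in>Basis. \<alpha> b * (h \<bullet> b))\<bar> \<le> DIM('a) * (2 * L + 1) * e * norm h"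
proof -
  have L: "L \<ge> 0" using G by (rule lipschitz_on_nonneg)
  \<comment> \<open>The part of h in the coordinates from \<open>S\<close>; induction on
    \<open>S\<close> adds one coordinate at a time.\<close>
  define part where "part S h = (\<Sum>b\<in>S. (h \<bullet> b) *\<^sub>R b)" for S and h :: 'a
  have np: "norm (part S h) \<le> norm h" if "S \<subseteq> Basis" for S h
  proof (rule norm_le_componentwise)
    fix b :: 'a assume b: "b \<in> Basis"
    have "part S h \<bullet> b = (\<Sum>c\<in>S. if c = b then h \<bullet> c else 0)"
      unfolding part_def inner_sum_left using that b by (intro sum.cong) (auto simp: inner_Basis)
    also have "\<dots> = (if b \<in> S then h \<bullet> b else 0)"
      using finite_subset[OF that] by (simp add: sum.delta')
    finally show "\<bar>part S h \<bullet> b\<bar> \<le> \<bar>h \<bullet> b\<bar>" by simp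
  qed
  have "\<exists>d>0. \<forall>h. norm h < d \<longrightarrow>
    \<bar>G (x + part S h) - G x - (\<Sum>b\<in>S. \<alpha> b * (h \<bullet> b))\<bar> \<le> card S * (2 * L + 1) * e * norm h"
    if "S \<subseteq> Basis" for S
    using finite_subset[OF that finite_Basis] that
  proof (induction S rule: finite_induct)
    case empty
    then show ?case by (intro exI[of _ 1]) (auto simp: part_def)
  next
    case (insert b S)
    then have b: "b \<in> Basis" and S: "S \<subseteq> Basis" by auto
    obtain d1 where d1: "d1 > 0" "\<And>h. norm h < d1 \<Longrightarrow>
      \<bar>G (x + part S h) - G x - (\<Sum>b\<in>S. \<alpha> b * (h \<bullet> b))\<bar> \<le> card S * (2 * L + 1) * e * norm h"
      using insert.IH[OF S] by blast
    let ?P = "partial_slope G b (\<alpha> b) (\<delta> b) e"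
    have P: "?P \<in> sets lebesgue" using closed_partial_slope[OF G] by auto
    obtain d2 where d2: "d2 > 0" "\<And>h. 0 < norm h \<Longrightarrow> norm h < d2 \<Longrightarrow> \<exists>a\<in>?P. dist a (x + h) \<le> e * norm h"
      using density_point_near[OF P _ e] x[OF b] by blast
    show ?case
    proof (intro exI[of _ "min (\<delta> b) (min d1 d2)"] conjI allI impI)
      show "min (\<delta> b) (min d1 d2) > 0" using d1 d2 x[OF b] by simp
      fix h :: 'a assume h: "norm h < min (\<delta> b) (min d1 d2)"
      define w where "w = part S h"
      have w: "norm w \<le> norm h" using np[OF S] by (simp add: w_def)
      \<comment> \<open>The density argument excludes the zero displacement, for which x itself
        serves.\<close>
      obtain y where y: "y \<in> ?P" "dist y (x + w) \<le> e * norm h"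
      proof (cases "w = 0")
        case True
        then show ?thesis using x[OF b] e that[of x] by simp
      next
        case False
        then obtain a where "a \<in> ?P" "dist a (x + w) \<le> e * norm w" using d2(2)[of w] h w by auto
        then show ?thesis using e w that[of a] by (meson less_imp_le mult_left_mono order.trans)
      qed
      define t where "t = h \<bullet> b"
      have t: "\<bar>t\<bar> \<le> norm h" using b by (simp add: t_def Basis_le_norm)
      have 1: "\<bar>G (y + t *\<^sub>R b) - G y - t * \<alpha> b\<bar> \<le> e * norm h"
      proof -
        have "\<bar>G (y + t *\<^sub>R b) - G y - t * \<alpha> b\<bar> \<le> e * \<bar>t\<bar>" using y(1) t h by (auto simp: partial_slope_def)
        also have "\<dots> \<le> e * norm h" using t e by (intro mult_left_mono) auto
        finally show ?thesis .
      qed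
      have Ly: "L * dist y (x + w) \<le> L * (e * norm h)" using y(2) L by (rule mult_left_mono)
      have 2: "\<bar>G (y + t *\<^sub>R b) - G (x + w + t *\<^sub>R b)\<bar> \<le> L * (e * norm h)"
        using lipschitz_onD[OF G, of "y + t *\<^sub>R b" "x + w + t *\<^sub>R b"] Ly by (simp add: dist_norm)
      have 3: "\<bar>G y - G (x + w)\<bar> \<le> L * (e * norm h)"
        using lipschitz_onD[OF G, of y "x + w"] Ly by (simp add: dist_norm)
      have 4: "\<bar>G (x + w) - G x - (\<Sum>b\<in>S. \<alpha> b * (h \<bullet> b))\<bar> \<le> card S * (2 * L + 1) * e * norm h"
        unfolding w_def using h by (intro d1) simp
      have 5: "x + part (insert b S) h = x + w + t *\<^sub>R b"
        using insert.hyps by (simp add: part_def w_def t_def)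
      have 6: "(\<Sum>b\<in>insert b S. \<alpha> b * (h \<bullet> b)) = t * \<alpha> b + (\<Sum>b\<in>S. \<alpha> b * (h \<bullet> b))"
        using insert.hyps by (simp add: t_def)
      \<comment> \<open>Each new coordinate costs two Lipschitz moves of length e |h|, to y and
        back, and one slope error.\<close>
      have 7: "real (card (insert b S)) * (2 * L + 1) * e * norm h =
        card S * (2 * L + 1) * e * norm h + 2 * (L * (e * norm h)) + e * norm h"
        using insert.hyps by (simp add: algebra_simps)
      show "\<bar>G (x + part (insert b S) h) - G x - (\<Sum>b\<in>insert b S. \<alpha> b * (h \<bullet> b))\<bar>
          \<le> real (card (insert b S)) * (2 * L + 1) * e * norm h"
        unfolding 5 6 7 using 1 2 3 4 by linarith
    qed
  qed
  from this[of Basis] show ?thesis by (simp add: part_def euclidean_representation)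
qed

text \<open>The vector a may depend on the tolerance. Two such vectors, tested on a short multiple
  of their difference, differ by at most the sum of their tolerances; so they form a Cauchy sequence
  whose limit is the gradient.\<close>

lemma differentiable_if_almost_affine:
  fixes G :: "'a::euclidean_space \<Rightarrow> real"
  assumes aff: "\<And>e. e > 0 \<Longrightarrow> \<exists>a. \<exists>d>0. \<forall>h. norm h < d \<longrightarrow> \<bar>G (x + h) - G x - a \<bullet> h\<bar> \<le> e * norm h"
  shows "G differentiable (at x)"
proof -
  have "\<exists>a. \<exists>d>0. \<forall>h. norm h < d \<longrightarrow> \<bar>G (x + h) - G x - a \<bullet> h\<bar> \<le> 1 / real (Suc n) * norm h" for n
    by (rule aff) simp
  then obtain a where "\<And>n. \<exists>d>0. \<forall>h. norm h < d \<longrightarrow> \<bar>G (x + h) - G x - a n \<bullet> h\<bar> \<le> 1 / real (Suc n) * norm h"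
    by metis
  then obtain d where d: "\<And>n. d n > 0" "\<And>n h. norm h < d n \<Longrightarrow> \<bar>G (x + h) - G x - a n \<bullet> h\<bar> \<le> 1 / real (Suc n) * norm h"
    by metis
  have close: "norm (a n - a m) \<le> 1 / real (Suc n) + 1 / real (Suc m)" for n m
  proof (cases "a n = a m")
    case False
    define v where "v = a n - a m"
    have v: "norm v > 0" using False by (simp add: v_def)
    define s where "s = min (d n) (d m) / (2 * norm v)"
    have s: "s > 0" unfolding s_def using d(1) v by simp
    have "norm (s *\<^sub>R v) = s * norm v" using s by simp
    also have "\<dots> = min (d n) (d m) / 2" using v by (simp add: s_def)
    finally have "norm (s *\<^sub>R v) = min (d n) (d m) / 2" .
    then have "norm (s *\<^sub>R v) < d n" "norm (s *\<^sub>R v) < d m" using d(1)[of n] d(1)[of m] by linarith+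
    then have "\<bar>a n \<bullet> (s *\<^sub>R v) - a m \<bullet> (s *\<^sub>R v)\<bar> \<le> 1 / real (Suc n) * norm (s *\<^sub>R v) + 1 / real (Suc m) * norm (s *\<^sub>R v)"
      using d(2)[of "s *\<^sub>R v" n] d(2)[of "s *\<^sub>R v" m] by linarith
    also have "a n \<bullet> (s *\<^sub>R v) - a m \<bullet> (s *\<^sub>R v) = s * (norm v * norm v)"
    proof -
      have "a n \<bullet> (s *\<^sub>R v) - a m \<bullet> (s *\<^sub>R v) = s * (v \<bullet> v)" by (simp add: v_def inner_diff_left right_diff_distrib)
      also have "v \<bullet> v = norm v * norm v" by (simp add: dot_square_norm power2_eq_square)
      finally show ?thesis .
    qed
    finally have "(s * norm v) * norm v \<le> (s * norm v) * (1 / real (Suc n) + 1 / real (Suc m))"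
      using s v by (simp add: algebra_simps)
    then have "norm v \<le> 1 / real (Suc n) + 1 / real (Suc m)"
      by (rule mult_left_le_imp_le) (use s v in simp)
    then show ?thesis by (simp add: v_def)
  qed simp
  have "Cauchy a"
  proof (rule CauchyI)
    fix e :: real assume "e > 0"
    then obtain N where N: "1 / real (Suc N) < e / 2" using nat_approx_posE[of "e / 2"] by auto
    have "norm (a m - a n) < e" if "m \<ge> N" "n \<ge> N" for m n
    proof -
      have "1 / real (Suc m) \<le> 1 / real (Suc N)" "1 / real (Suc n) \<le> 1 / real (Suc N)"
        using that by (auto intro!: divide_left_mono)
      then show ?thesis using close[of m n] N by linarith
    qed
    then show "\<exists>M. \<forall>m\<ge>M. \<forall>n\<ge>M. norm (a m - a n) < e" by blast
  qed
  then obtain A where A: "a \<longlonglongrightarrow> A" using Cauchy_convergent_iff convergent_def by blast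
  have closeA: "norm (a n - A) \<le> 1 / real (Suc n)" for n
  proof (rule tendsto_le[OF trivial_limit_sequentially])
    show "(\<lambda>m. norm (a n - a m)) \<longlonglongrightarrow> norm (a n - A)" by (intro tendsto_intros A)
    have "(\<lambda>m. 1 / real (Suc n) + 1 / real (Suc m)) \<longlonglongrightarrow> 1 / real (Suc n) + 0"
      by (intro tendsto_intros LIMSEQ_Suc lim_1_over_n)
    then show "(\<lambda>m. 1 / real (Suc n) + 1 / real (Suc m)) \<longlonglongrightarrow> 1 / real (Suc n)" by simp
  qed (rule always_eventually, rule allI, rule close)
  have "(G has_derivative (\<lambda>h. A \<bullet> h)) (at x)"
    unfolding has_derivative_at_alt
  proof (intro conjI allI impI)
    show "bounded_linear ((\<bullet>) A)" by (rule bounded_linear_inner_right)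
    fix e :: real assume "e > 0"
    then obtain N where N: "1 / real (Suc N) < e / 2" using nat_approx_posE[of "e / 2"] by auto
    show "\<exists>d>0. \<forall>y. norm (y - x) < d \<longrightarrow> norm (G y - G x - A \<bullet> (y - x)) \<le> e * norm (y - x)"
    proof (intro exI[of _ "d N"] conjI allI impI d(1))
      fix y assume y: "norm (y - x) < d N"
      have "\<bar>G y - G x - a N \<bullet> (y - x)\<bar> \<le> 1 / real (Suc N) * norm (y - x)" using d(2)[OF y] by simp
      moreover have "\<bar>(a N - A) \<bullet> (y - x)\<bar> \<le> 1 / real (Suc N) * norm (y - x)"
        using closeA[of N] by (intro order.trans[OF Cauchy_Schwarz_ineq2] mult_right_mono) auto
      moreover have "1 / real (Suc N) * norm (y - x) \<le> e / 2 * norm (y - x)" using N by (intro mult_right_mono) auto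
      moreover have "G y - G x - A \<bullet> (y - x) = (G y - G x - a N \<bullet> (y - x)) + (a N - A) \<bullet> (y - x)"
        by (simp add: inner_diff_left)
      ultimately show "norm (G y - G x - A \<bullet> (y - x)) \<le> e * norm (y - x)" by (simp only: real_norm_def)
    qed
  qed
  then show ?thesis by (auto simp: differentiable_def)
qed

text \<open>Tolerances 1/(m+1), rational slopes and scales 1/(n+1) leave only countably many
  exceptional sets: points without a partial slope, and points of a slope set that are not density
  points of it.\<close>

theorem Rademacher_real:
  fixes G :: "'a::euclidean_space \<Rightarrow> real"
  assumes G: "L-lipschitz_on UNIV G"
  shows "negligible {x. \<not> G differentiable (at x)}"
proof -
  have L: "L \<ge> 0" using G by (rule lipschitz_on_nonneg)
  let ?P = "\<lambda>b a n m. partial_slope G b a (1 / real (Suc n)) (1 / real (Suc m))"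
  define N1 where "N1 m b = - (\<Union>a\<in>\<rat>. \<Union>n. ?P b a n m)" for m b
  define N2 where "N2 b a n m = {x \<in> ?P b a n m. \<not> density_point (?P b a n m) x}" for b a n m
  define N where "N = (\<Union>m. \<Union>b\<in>Basis. N1 m b \<union> (\<Union>a\<in>\<rat>. \<Union>n. N2 b a n m))"
  have "negligible (N1 m b)" if "b \<in> Basis" for m b
    unfolding N1_def using that by (intro negligible_no_partial_slope[OF G]) auto
  moreover have "negligible (N2 b a n m)" for b a n m
    unfolding N2_def using closed_partial_slope[OF G] by (intro negligible_not_density_point) auto
  ultimately have negN: "negligible N"
  proof -
    have "negligible (\<Union>a\<in>\<rat>. \<Union>n. N2 b a n m)" for b m
      using \<open>\<And>b a n m. negligible (N2 b a n m)\<close>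
      by (intro negligible_countable_Union) (auto simp: countable_rat intro!: negligible_countable_Union)
    with \<open>\<And>m b. b \<in> Basis \<Longrightarrow> negligible (N1 m b)\<close> have "negligible (\<Union>b\<in>Basis. N1 m b \<union> (\<Union>a\<in>\<rat>. \<Union>n. N2 b a n m))" for m
      by (intro negligible_countable_Union) (auto intro!: negligible_Un countable_finite)
    then show ?thesis unfolding N_def by (intro negligible_countable_Union) auto
  qed
  have "G differentiable (at x)" if x: "x \<notin> N" for x
  proof (rule differentiable_if_almost_affine)
    fix e :: real assume e: "e > 0"
    define c where "c = DIM('a) * (2 * L + 1)"
    have c: "c > 0" using L by (simp add: c_def)
    obtain m where m: "1 / real (Suc m) < e / c" using nat_approx_posE[of "e / c"] e c by auto
    have "\<exists>a n. x \<in> ?P b a n m \<and> density_point (?P b a n m) x" if "b \<in> Basis" for b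
    proof -
      have xb: "x \<notin> N1 m b \<union> (\<Union>a\<in>\<rat>. \<Union>n. N2 b a n m)" using x that by (simp add: N_def)
      then obtain a n where a: "a \<in> \<rat>" "x \<in> ?P b a n m" by (auto simp: N1_def)
      moreover have "x \<notin> N2 b a n m" using xb a(1) by blast
      ultimately show ?thesis by (auto simp: N2_def)
    qed
    then obtain \<alpha> n where "\<And>b. b \<in> Basis \<Longrightarrow> x \<in> ?P b (\<alpha> b) (n b) m \<and> density_point (?P b (\<alpha> b) (n b) m) x"
      by metis
    then have "\<exists>d>0. \<forall>h. norm h < d \<longrightarrow>
      \<bar>G (x + h) - G x - (\<Sum>b\<in>Basis. \<alpha> b * (h \<bullet> b))\<bar> \<le> DIM('a) * (2 * L + 1) * (1 / real (Suc m)) * norm h"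
      by (intro almost_affine_at_density_points[OF G, of _ "\<lambda>b. 1 / real (Suc (n b))"]) auto
    then obtain d where d: "d > 0" "\<And>h. norm h < d \<Longrightarrow>
      \<bar>G (x + h) - G x - (\<Sum>b\<in>Basis. \<alpha> b * (h \<bullet> b))\<bar> \<le> c * (1 / real (Suc m)) * norm h"
      unfolding c_def by blast
    define a where "a = (\<Sum>b\<in>Basis. \<alpha> b *\<^sub>R b)"
    have "\<bar>G (x + h) - G x - a \<bullet> h\<bar> \<le> e * norm h" if "norm h < d" for h
    proof -
      have "a \<bullet> h = (\<Sum>b\<in>Basis. \<alpha> b * (h \<bullet> b))"
        unfolding a_def inner_sum_left inner_scaleR_left by (intro sum.cong) (auto simp: inner_commute)
      moreover have "c * (1 / real (Suc m)) * norm h \<le> e * norm h"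
        using m c by (intro mult_right_mono) (auto simp: field_simps)
      ultimately show ?thesis using d(2)[OF that] by simp
    qed
    then show "\<exists>a. \<exists>d>0. \<forall>h. norm h < d \<longrightarrow> \<bar>G (x + h) - G x - a \<bullet> h\<bar> \<le> e * norm h" using d(1) by blast
  qed
  then have "{x. \<not> G differentiable (at x)} \<subseteq> N" by blast
  then show ?thesis using negN negligible_subset by blast
qed

subsection \<open>Lipschitz extension and approximate derivatives\<close>

text \<open>McShane's extension, the infimum of the cones h y + L * dist x y over y in E.\<close>

lemma lipschitz_extension_real:
  fixes h :: "'a::metric_space \<Rightarrow> real"
  assumes h: "L-lipschitz_on E h"
  shows "\<exists>G. L-lipschitz_on UNIV G \<and> (\<forall>x\<in>E. G x = h x)"
proof (cases "E = {}")
  case True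
  have "L-lipschitz_on UNIV (\<lambda>_::'a. 0::real)"
    using lipschitz_on_nonneg[OF h] by (auto intro: lipschitz_onI)
  with True show ?thesis by blast
next
  case False
  then obtain y0 where y0: "y0 \<in> E" by blast
  have L: "L \<ge> 0" using h by (rule lipschitz_on_nonneg)
  define G where "G x = (INF y\<in>E. h y + L * dist x y)" for x
  have hy: "h z \<le> h y + L * dist y z" if "y \<in> E" "z \<in> E" for y z
    using lipschitz_onD[OF h that] by (simp add: dist_real_def abs_le_iff)
  have tri: "L * dist x z \<le> L * dist x y + L * dist y z" for x y z
    using mult_left_mono[OF dist_triangle[of x z y] L] by (simp add: distrib_left)
  have bdd: "bdd_below ((\<lambda>y. h y + L * dist x y) ` E)" for x
  proof (rule bdd_belowI2)
    fix y assume "y \<in> E"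
    then show "h y0 - L * dist x y0 \<le> h y + L * dist x y"
      using hy[of y y0] y0 tri[of y y0 x] by (simp add: dist_commute)
  qed
  have le: "G x \<le> G x' + L * dist x x'" for x x'
  proof -
    have "G x - L * dist x x' \<le> G x'"
      unfolding G_def[of x']
    proof (rule cINF_greatest[OF False])
      fix y assume "y \<in> E"
      then have "G x \<le> h y + L * dist x y" unfolding G_def by (rule cINF_lower[OF bdd])
      then show "G x - L * dist x x' \<le> h y + L * dist x' y" using tri[of x y x'] by simp
    qed
    then show ?thesis by simp
  qed
  show ?thesis
  proof (intro exI conjI ballI)
    show "L-lipschitz_on UNIV G"
    proof (rule lipschitz_onI[OF _ L])
      show "dist (G x) (G x') \<le> L * dist x x'" for x x'
        using le[of x x'] le[of x' x] by (auto simp: dist_real_def abs_le_iff dist_commute)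
    qed
    show "G x = h x" if x: "x \<in> E" for x
    proof (rule antisym)
      show "G x \<le> h x" unfolding G_def using cINF_lower[OF bdd x, of x] by simp
      show "h x \<le> G x" unfolding G_def using hy x by (intro cINF_greatest[OF False]) (auto simp: dist_commute)
    qed
  qed
qed

text \<open>Extending the coordinates separately need not preserve the Lipschitz constant of the
  vector map; continuity and almost everywhere differentiability are what is kept.\<close>

lemma lipschitz_extension_ae_differentiable:
  fixes h :: "'a::euclidean_space \<Rightarrow> real^'n"
  assumes h: "L-lipschitz_on E h"
  obtains G where "\<forall>x\<in>E. G x = h x" "continuous_on UNIV G" "negligible {x. \<not> G differentiable (at x)}"
proof -
  have "L-lipschitz_on E (\<lambda>x. h x $ j)" for j
  proof (rule lipschitz_onI)
    show "dist (h x $ j) (h y $ j) \<le> L * dist x y" if "x \<in> E" "y \<in> E" for x y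
      using lipschitz_onD[OF h that] dist_vec_nth_le[of "h x" j "h y"] by linarith
  qed (use h in \<open>rule lipschitz_on_nonneg\<close>)
  then have "\<exists>G. L-lipschitz_on UNIV G \<and> (\<forall>x\<in>E. G x = h x $ j)" for j
    by (rule lipschitz_extension_real)
  then obtain g where g': "\<And>j. L-lipschitz_on UNIV (g j) \<and> (\<forall>x\<in>E. g j x = h x $ j)"
    by metis
  then have g: "\<And>j. L-lipschitz_on UNIV (g j)" "\<And>j x. x \<in> E \<Longrightarrow> g j x = h x $ j" by blast+
  define G where "G x = (\<chi> j. g j x)" for x
  show thesis
  proof (rule that)
    show "\<forall>x\<in>E. G x = h x" using g(2) by (simp add: G_def vec_eq_iff)
    show "continuous_on UNIV G"
      unfolding G_def using lipschitz_on_continuous_on[OF g(1)] by (intro continuous_on_vec_lambda)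
    have "G differentiable (at x)" if "\<And>j. g j differentiable (at x)" for x
    proof -
      have "(\<lambda>x. G x \<bullet> i) differentiable (at x)" if "i \<in> Basis" for i
      proof -
        obtain j where "i = axis j 1" using \<open>i \<in> Basis\<close> by (auto simp: Basis_vec_def)
        then have "(\<lambda>x. G x \<bullet> i) = g j" by (simp add: inner_axis G_def fun_eq_iff)
        then show ?thesis using \<open>\<And>j. g j differentiable (at x)\<close> by simp
      qed
      then show ?thesis using differentiable_componentwise_within by blast
    qed
    then have "{x. \<not> G differentiable (at x)} \<subseteq> (\<Union>j. {x. \<not> g j differentiable (at x)})" by blast
    moreover have "negligible (\<Union>j. {x. \<not> g j differentiable (at x)})"
      using Rademacher_real[OF g(1)] by (intro negligible_countable_Union) (auto intro: countable_finite)
    ultimately show "negligible {x. \<not> G differentiable (at x)}" by (rule negligible_subset[rotated])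
  qed
qed

text \<open>The difference M of the two maps is o(|y - x|) along \<open>S\<close>. For every small
  w, density gives a point of \<open>S\<close> close to x + w, so M w is small relative to w;
  scaling forces M = 0.\<close>

lemma density_point_derivative_unique:
  fixes h :: "'a::euclidean_space \<Rightarrow> real"
  assumes S: "S \<in> sets lebesgue" "density_point S x" and lin: "linear L1" "linear L2"
    and L1: "((\<lambda>y. (h y - h x - L1 (y - x)) / norm (y - x)) \<longlongrightarrow> 0) (at x within S)"
    and L2: "((\<lambda>y. (h y - h x - L2 (y - x)) / norm (y - x)) \<longlongrightarrow> 0) (at x within S)"
  shows "L1 = L2"
proof
  fix v :: 'a
  define M where "M v = L1 v - L2 v" for v
  have linM: "linear M" unfolding M_def using lin by (intro linear_compose_sub)
  have lim: "((\<lambda>y. M (y - x) / norm (y - x)) \<longlongrightarrow> 0) (at x within S)"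
  proof -
    have "M (y - x) / norm (y - x) = (h y - h x - L2 (y - x)) / norm (y - x) - (h y - h x - L1 (y - x)) / norm (y - x)" for y
      by (simp add: M_def flip: diff_divide_distrib)
    then show ?thesis using tendsto_diff[OF L2 L1] by simp
  qed
  obtain K where K: "K > 0" "\<And>v. norm (M v) \<le> K * norm v" using linear_bounded_pos[OF linM] by blast
  have "\<bar>M v\<bar> \<le> 0"
  proof (cases "v = 0")
    case True
    then show ?thesis using linear_0[OF linM] by simp
  next
    case False
    show ?thesis
    proof (rule ccontr)
      assume "\<not> \<bar>M v\<bar> \<le> 0"
      then have Mv: "\<bar>M v\<bar> > 0" by simp
      define q where "q = (2 + K) * norm v"
      have q: "q > 0" using K(1) False by (simp add: q_def)
      \<comment> \<open>In 2 + K, the 2 comes from |a - x| \<le> 2 |w| and K from the bound of M on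
        the displacement error. The cap 1/2 keeps a away from x.\<close>
      define e where "e = min (1 / 2) (\<bar>M v\<bar> / (2 * q))"
      have e: "e > 0" "e \<le> 1 / 2" using Mv q unfolding e_def by (simp, intro min.cobounded1)
      have eM: "(2 + K) * e * norm v \<le> \<bar>M v\<bar> / 2"
      proof -
        have "e \<le> \<bar>M v\<bar> / (2 * q)" unfolding e_def by (rule min.cobounded2)
        then have "q * e \<le> q * (\<bar>M v\<bar> / (2 * q))" using q by (intro mult_left_mono) auto
        also have "\<dots> = \<bar>M v\<bar> / 2" using q by simp
        finally show ?thesis by (simp add: q_def mult_ac)
      qed
      obtain d where d: "d > 0" "\<And>y. y \<in> S \<Longrightarrow> y \<noteq> x \<Longrightarrow> dist y x < d \<Longrightarrow> \<bar>M (y - x) / norm (y - x)\<bar> < e"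
        using lim e(1) unfolding tendsto_iff eventually_at by (auto simp: dist_real_def)
      obtain d' where d': "d' > 0" "\<And>h. 0 < norm h \<Longrightarrow> norm h < d' \<Longrightarrow> \<exists>a\<in>S. dist a (x + h) \<le> e * norm h"
        using density_point_near[OF S e(1)] by blast
      define t where "t = min (d / 2) d' / (2 * norm v)"
      have t: "t > 0" using d(1) d'(1) False by (simp add: t_def)
      define w where "w = t *\<^sub>R v"
      have "norm w = t * norm v" using t by (simp add: w_def)
      also have "\<dots> = min (d / 2) d' / 2" using False by (simp add: t_def)
      finally have "norm w = min (d / 2) d' / 2" .
      then have w: "norm w > 0" "norm w < d / 2" "norm w < d'" using d(1) d'(1) by linarith+
      obtain a where a: "a \<in> S" "dist a (x + w) \<le> e * norm w" using d'(2)[OF w(1,3)] by blast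
      have ew: "e * norm w \<le> norm w / 2" using mult_right_mono[OF e(2), of "norm w"] by simp
      have aw: "norm ((a - x) - w) \<le> e * norm w" using a(2) by (simp add: dist_norm algebra_simps)
      have ax: "norm (a - x) \<le> 2 * norm w" "norm (a - x) \<ge> norm w / 2"
      proof -
        have "norm ((a - x) - w) \<le> norm w / 2" using aw ew by linarith
        moreover have "norm (w - (a - x)) = norm ((a - x) - w)" by (rule norm_minus_commute)
        ultimately show "norm (a - x) \<le> 2 * norm w" "norm (a - x) \<ge> norm w / 2"
          using norm_triangle_sub[of "a - x" w] norm_triangle_sub[of w "a - x"] norm_ge_zero[of w] by linarith+
      qed
      have "a \<noteq> x" using ax(2) w(1) by auto
      moreover have "dist a x < d" using ax(1) w(2) by (simp add: dist_norm)
      ultimately have "\<bar>M (a - x) / norm (a - x)\<bar> < e" using d(2) a(1) by blast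
      then have "\<bar>M (a - x)\<bar> \<le> e * norm (a - x)" using \<open>a \<noteq> x\<close> by (simp add: abs_divide pos_divide_less_eq)
      also have "\<dots> \<le> e * (2 * norm w)" using ax(1) e(1) by (intro mult_left_mono) auto
      finally have 1: "\<bar>M (a - x)\<bar> \<le> e * (2 * norm w)" .
      have 2: "\<bar>M ((a - x) - w)\<bar> \<le> K * (e * norm w)"
      proof -
        have "\<bar>M ((a - x) - w)\<bar> \<le> K * norm ((a - x) - w)" using K(2)[of "(a - x) - w"] by simp
        also have "\<dots> \<le> K * (e * norm w)" using aw K(1) by (intro mult_left_mono) auto
        finally show ?thesis .
      qed
      have "M w = M (a - x) - M ((a - x) - w)" using linear_diff[OF linM] by simp
      then have "\<bar>M w\<bar> \<le> e * (2 * norm w) + K * (e * norm w)" using 1 2 by linarith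
      also have "\<dots> = t * ((2 + K) * e * norm v)" using t by (simp add: w_def algebra_simps)
      also have "\<dots> \<le> t * (\<bar>M v\<bar> / 2)" using t eM by (intro mult_left_mono) auto
      also have "\<bar>M w\<bar> = t * \<bar>M v\<bar>" using t linear_scale[OF linM] by (simp add: w_def abs_mult)
      finally show False using t Mv by simp
    qed
  qed
  then show "L1 v = L2 v" by (simp add: M_def)
qed

text \<open>\<open>E\<close> itself is the witness. A competing derivative has a smaller witness
  \<open>S\<close>, to which the limit along \<open>E\<close> restricts, so both are compared on
  \<open>S\<close>.\<close>

lemma approx_derivative_eqI:
  fixes h :: "'a::euclidean_space \<Rightarrow> real"
  assumes E: "E \<in> sets lebesgue" "x \<in> E" "density_point E x"
    and g: "(g has_derivative L) (at x)" and gh: "\<And>y. y \<in> E \<Longrightarrow> g y = h y"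
  shows "has_approx_derivative E h L x" "approx_derivative E h x = L"
proof -
  have lin: "linear L" using g has_derivative_linear by blast
  have "((\<lambda>y. norm ((g y - g x - L (y - x)) / norm (y - x))) \<longlongrightarrow> 0) (at x within E)"
    using has_derivative_at_withinI[OF g, of E] unfolding has_derivative_iff_norm by (simp add: norm_divide)
  then have "((\<lambda>y. (g y - g x - L (y - x)) / norm (y - x)) \<longlongrightarrow> 0) (at x within E)"
    by (rule tendsto_norm_zero_cancel)
  moreover have "((\<lambda>y. (g y - g x - L (y - x)) / norm (y - x)) \<longlongrightarrow> 0) (at x within E) \<longleftrightarrow>
    ((\<lambda>y. (h y - h x - L (y - x)) / norm (y - x)) \<longlongrightarrow> 0) (at x within E)"
    using gh E(2) by (intro tendsto_cong) (auto simp: eventually_at intro!: exI[of _ 1])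
  ultimately have lim: "((\<lambda>y. (h y - h x - L (y - x)) / norm (y - x)) \<longlongrightarrow> 0) (at x within E)" by simp
  show *: "has_approx_derivative E h L x"
    unfolding has_approx_derivative_def using E lin lim by blast
  show "approx_derivative E h x = L"
    unfolding approx_derivative_def
  proof (rule the_equality[of "\<lambda>L. has_approx_derivative E h L x", OF *])
    fix L' assume "has_approx_derivative E h L' x"
    then obtain S where S: "linear L'" "S \<in> sets lebesgue" "S \<subseteq> E" "density_point S x"
      "((\<lambda>y. (h y - h x - L' (y - x)) / norm (y - x)) \<longlongrightarrow> 0) (at x within S)"
      unfolding has_approx_derivative_def by blast
    show "L' = L"
      using density_point_derivative_unique[OF S(2,4,1) lin S(5) tendsto_within_subset[OF lim S(3)]] .
  qed
qed

lemma approx_derivative_vec_eqI: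
  fixes h :: "'a::euclidean_space \<Rightarrow> real^'n"
  assumes E: "E \<in> sets lebesgue" "x \<in> E" "density_point E x"
    and g: "(g has_derivative L) (at x)" and gh: "\<And>y. y \<in> E \<Longrightarrow> g y = h y"
  shows "approx_differentiable_vec E h x" "approx_derivative_vec E h x = L"
proof -
  have gj: "((\<lambda>y. g y $ j) has_derivative (\<lambda>v. L v $ j)) (at x)" for j
    by (rule bounded_linear.has_derivative[OF bounded_linear_vec_nth g])
  have *: "has_approx_derivative E (\<lambda>y. h y $ j) (\<lambda>v. L v $ j) x" "approx_derivative E (\<lambda>y. h y $ j) x = (\<lambda>v. L v $ j)" for j
    by (rule approx_derivative_eqI[OF E gj]; simp add: gh)+
  show "approx_differentiable_vec E h x"
    unfolding approx_differentiable_vec_def using *(1) by blast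
  show "approx_derivative_vec E h x = L"
    unfolding approx_derivative_vec_def using *(2) by (simp add: vec_eq_iff fun_eq_iff)
qed

text \<open>A rotation takes a basis vector to v. The measure of the rotated set is estimated
  through its content, which causes the additional factor with 2^k.\<close>

proposition hausdorff_content_image_direction:
  fixes f :: "real^'k \<Rightarrow> 'a::metric_space" and L D :: real
  assumes S: "S \<in> lmeasurable" "bounded S" and f: "L-lipschitz_on S f" and D: "D \<ge> 0" and v: "norm v = 1"
    and m: "m \<ge> 8"
    and chord: "\<And>T a b y. compact T \<Longrightarrow> a \<in> T \<Longrightarrow> b \<in> T \<Longrightarrow> a \<le> b \<Longrightarrow>
      (\<And>t. t \<in> T \<Longrightarrow> y + t *\<^sub>R v \<in> S) \<Longrightarrow>
      dist (f (y + a *\<^sub>R v)) (f (y + b *\<^sub>R v)) \<le> D * (1 / real m * (b - a) + measure lebesgue ({a..b} - T))"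
  shows "hausdorff_content CARD('k) (f ` S)
    \<le> ennreal (unit_ball_vol CARD('k) * (4 * L * CARD('k) + 2 * D) ^ CARD('k) *
        (2 ^ CARD('k) * (unit_ball_vol CARD('k) * (CARD('k) / 2) ^ CARD('k))) / m * measure lebesgue S)"
proof -
  let ?k = "CARD('k)"
  \<comment> \<open>Any coordinate direction will do; \<open>undefined\<close> merely names some
    index.\<close>
  define i :: "real^'k" where "i = axis undefined 1"
  have i: "i \<in> Basis" unfolding i_def Basis_vec_def by auto
  have "norm i = norm v" using v norm_Basis[OF i] by metis
  then obtain T where T: "orthogonal_transformation T" "T i = v"
    by (rule orthogonal_transformation_exists)
  have linT: "linear T" and normT: "\<And>x. norm (T x) = norm x"
    using orthogonal_transformation_linear[OF T(1)] orthogonal_transformation_norm[OF T(1)] by auto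
  define R where "R = inv T"
  have R: "orthogonal_transformation R" unfolding R_def using T(1) by (rule orthogonal_transformation_inv)
  have linR: "linear R" and normR: "\<And>x. norm (R x) = norm x"
    using orthogonal_transformation_linear[OF R] orthogonal_transformation_norm[OF R] by auto
  have TR: "T (R x) = x" for x
    unfolding R_def using orthogonal_transformation_surj[OF T(1)] by (simp add: surj_f_inv_f)
  define A where "A = R ` S"
  have TA: "T x \<in> S" if "x \<in> A" for x using that TR by (auto simp: A_def)
  have R1: "1-lipschitz_on S R"
    by (rule lipschitz_onI) (simp_all add: dist_norm normR flip: linear_diff[OF linR])
  have A_sets: "A \<in> sets lebesgue"
    unfolding A_def using S linR by (intro differentiable_image_in_sets_lebesgue) (auto intro: linear_imp_differentiable_on)
  have A_bounded: "bounded A"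
    unfolding A_def using S(2) linR by (intro bounded_linear_image) (auto simp: linear_linear)
  have Alm: "A \<in> lmeasurable" using A_sets A_bounded by (intro bounded_set_imp_lmeasurable)
  let ?c = "unit_ball_vol ?k * (?k / 2) ^ ?k"
  have "hausdorff_content DIM(real^'k) A \<le> ennreal (?c * measure lebesgue S)"
    using hausdorff_content_lipschitz_image_le[OF R1 S] by (simp add: A_def)
  then have "emeasure lebesgue A \<le> ennreal (2 ^ DIM(real^'k) * (?c * measure lebesgue S))"
    by (intro emeasure_le_hausdorff_content A_sets) auto
  then have mA: "measure lebesgue A \<le> 2 ^ ?k * ?c * measure lebesgue S"
    unfolding measure_def by (intro enn2real_leI) (auto simp: mult_ac)
  have fT: "L-lipschitz_on A (f \<circ> T)"
  proof (rule lipschitz_onI)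
    show "dist ((f \<circ> T) x) ((f \<circ> T) y) \<le> L * dist x y" if "x \<in> A" "y \<in> A" for x y
      using lipschitz_onD[OF f TA[OF that(1)] TA[OF that(2)]]
      by (simp add: dist_norm normT flip: linear_diff[OF linT])
  qed (use f in \<open>rule lipschitz_on_nonneg\<close>)
  have "hausdorff_content DIM(real^'k) ((f \<circ> T) ` A)
    \<le> ennreal (unit_ball_vol DIM(real^'k) * (4 * L * DIM(real^'k) + 2 * D) ^ DIM(real^'k) / m * measure lebesgue A)"
  proof (rule hausdorff_content_image_nearly_constant[OF Alm A_bounded fT D i m, of "1 / real m"])
    fix U :: "real set" and a b y
    assume U: "compact U" "a \<in> U" "b \<in> U" "a \<le> b" "\<And>t. t \<in> U \<Longrightarrow> y + t *\<^sub>R i \<in> A"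
    have Ty: "T (y + t *\<^sub>R i) = T y + t *\<^sub>R v" for t
      using T(2) by (simp add: linear_add[OF linT] linear_scale[OF linT])
    show "dist ((f \<circ> T) (y + a *\<^sub>R i)) ((f \<circ> T) (y + b *\<^sub>R i)) \<le> D * (1 / real m * (b - a) + measure lebesgue ({a..b} - U))"
      unfolding o_def Ty using U(1-4) TA[OF U(5)] by (intro chord) (auto simp: Ty)
  qed auto
  also have "(f \<circ> T) ` A = f ` S" by (simp add: A_def image_image TR)
  also have "ennreal (unit_ball_vol DIM(real^'k) * (4 * L * DIM(real^'k) + 2 * D) ^ DIM(real^'k) / m * measure lebesgue A)
    \<le> ennreal (unit_ball_vol DIM(real^'k) * (4 * L * DIM(real^'k) + 2 * D) ^ DIM(real^'k) / m * (2 ^ ?k * ?c * measure lebesgue S))"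
    using mA lipschitz_on_nonneg[OF f] D by (intro ennreal_leI mult_left_mono) auto
  finally show ?thesis by (simp add: mult_ac)
qed

subsection \<open>Maximal rank and degenerate rank\<close>

text \<open>Expansion holds only for nearby points, since h may identify distant ones. On small
  balls h has a (1/c)-Lipschitz inverse, so each piece is the Lipschitz image of a null set.\<close>

lemma negligible_if_expanding:
  fixes h :: "'a::euclidean_space \<Rightarrow> 'b::metric_space"
  assumes c: "c > 0" and d: "d > 0"
    and exp: "\<And>x y. x \<in> S \<Longrightarrow> y \<in> S \<Longrightarrow> dist x y < d \<Longrightarrow> c * dist x y \<le> dist (h x) (h y)"
    and 0: "hausdorff_content DIM('a) (h ` S) = 0"
  shows "negligible S"
proof (rule iffD2[OF locally_negligible_alt], rule ballI)
  fix x assume x: "x \<in> S"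
  define U where "U = S \<inter> ball x (d / 2)"
  have UU: "c * dist y z \<le> dist (h y) (h z)" if "y \<in> U" "z \<in> U" for y z
  proof -
    have yz: "y \<in> S" "z \<in> S" "dist x y < d / 2" "dist x z < d / 2" using that by (simp_all add: U_def)
    have "dist y z < d" using yz(3,4) by (rule dist_triangle_half_r)
    then show ?thesis by (rule exp[OF yz(1,2)])
  qed
  have inj: "inj_on h U"
  proof (rule inj_onI)
    fix y z assume "y \<in> U" "z \<in> U" "h y = h z"
    then have "c * dist y z \<le> 0" using UU[of y z] by simp
    then show "y = z" using c by (simp add: mult_le_0_iff)
  qed
  have "(1 / c)-lipschitz_on (h ` U) (inv_into U h)"
  proof (rule lipschitz_onI)
    fix p q assume "p \<in> h ` U" "q \<in> h ` U"
    then obtain y z where "y \<in> U" "z \<in> U" "p = h y" "q = h z" by blast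
    then have "dist y z \<le> 1 / c * dist p q" using UU[of y z] c by (simp add: field_simps)
    then show "dist (inv_into U h p) (inv_into U h q) \<le> 1 / c * dist p q"
      using \<open>y \<in> U\<close> \<open>z \<in> U\<close> \<open>p = h y\<close> \<open>q = h z\<close> inj by simp
  qed (use c in simp)
  moreover have "hausdorff_content DIM('a) (h ` U) = 0"
    using hausdorff_content_mono[of "h ` U" "h ` S" "DIM('a)"] 0 by (auto simp: U_def)
  ultimately have "hausdorff_content DIM('a) (inv_into U h ` h ` U) = 0"
    by (rule hausdorff_content_lipschitz_null)
  then have "hausdorff_content DIM('a) U = 0" using inj by simp
  then have "negligible U" by (rule negligible_if_hausdorff_content_0)
  then show "\<exists>U. openin (top_of_set S) U \<and> x \<in> U \<and> negligible U"
    using x d by (intro exI[of _ U]) (auto simp: U_def openin_open)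
qed

lemma negligible_full_rank:
  fixes G :: "'a::euclidean_space \<Rightarrow> 'b::euclidean_space"
  assumes 0: "hausdorff_content DIM('a) (G ` E) = 0"
    and R: "\<And>x. x \<in> R \<Longrightarrow> x \<in> E \<and> (\<exists>D. (G has_derivative D) (at x) \<and> inj D)"
  shows "negligible R"
proof -
  \<comment> \<open>On \<open>W n\<close> the radius and the expansion factor are uniform in x, with
    one index for both.\<close>
  define W where "W n = {x \<in> E. \<forall>y. dist x y < 1 / real (Suc n) \<longrightarrow> 1 / real (Suc n) * dist x y \<le> dist (G x) (G y)}" for n
  have "negligible (W n)" for n
  proof (rule negligible_if_expanding[where h = G])
    show "hausdorff_content DIM('a) (G ` W n) = 0"
      using hausdorff_content_mono[of "G ` W n" "G ` E" "DIM('a)"] 0 by (auto simp: W_def)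
    show "1 / real (Suc n) * dist x y \<le> dist (G x) (G y)" if "x \<in> W n" "y \<in> W n" "dist x y < 1 / real (Suc n)" for x y
      using that by (auto simp: W_def)
  qed auto
  then have "negligible (\<Union>n. W n)" by (intro negligible_countable_Union) auto
  moreover have "R \<subseteq> (\<Union>n. W n)"
  proof
    fix x assume "x \<in> R"
    then obtain D where x: "x \<in> E" and D: "(G has_derivative D) (at x)" "inj D" using R by blast
    have linD: "linear D" using D(1) by (rule has_derivative_linear)
    obtain c where c: "c > 0" "\<And>v. c * norm v \<le> norm (D v)"
      using linear_inj_bounded_below_pos[OF linD D(2)] by metis
    obtain d where d: "d > 0" "\<And>y. norm (y - x) < d \<Longrightarrow> norm (G y - G x - D (y - x)) \<le> c / 2 * norm (y - x)"
      using D(1) half_gt_zero[OF c(1)] unfolding has_derivative_at_alt by blast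
    obtain n where n: "1 / real (Suc n) < min (c / 2) d" using nat_approx_posE[of "min (c / 2) d"] c(1) d(1) by auto
    have "1 / real (Suc n) * dist x y \<le> dist (G x) (G y)" if "dist x y < 1 / real (Suc n)" for y
    proof -
      have "norm (y - x) < d" using that n by (simp add: dist_norm norm_minus_commute)
      then have "norm (G y - G x - D (y - x)) \<le> c / 2 * norm (y - x)" by (rule d(2))
      moreover have "norm (D (y - x)) \<le> norm (G y - G x) + norm (G y - G x - D (y - x))"
        using norm_triangle_ineq4[of "G y - G x" "G y - G x - D (y - x)"] by simp
      moreover have "1 / real (Suc n) * norm (y - x) \<le> c / 2 * norm (y - x)" using n by (intro mult_right_mono) auto
      ultimately have "1 / real (Suc n) * norm (y - x) \<le> norm (G y - G x)" using c(2)[of "y - x"] by linarith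
      then show ?thesis by (simp add: dist_norm norm_minus_commute)
    qed
    then have "x \<in> W n" using x by (simp add: W_def)
    then show "x \<in> (\<Union>n. W n)" by blast
  qed
  ultimately show ?thesis by (rule negligible_subset)
qed

lemma hausdorff_content_lipschitz_negligible:
  fixes f :: "'a::euclidean_space \<Rightarrow> 'b::metric_space"
  assumes f: "L-lipschitz_on N f" and N: "negligible N"
  shows "hausdorff_content DIM('a) (f ` N) = 0"
proof -
  have 0: "hausdorff_content DIM('a) (f ` (N \<inter> ball 0 (real n))) = 0" for n
  proof -
    have neg: "negligible (N \<inter> ball 0 (real n))" using N by (rule negligible_subset) blast
    then have "hausdorff_content DIM('a) (f ` (N \<inter> ball 0 (real n)))
      \<le> ennreal (unit_ball_vol DIM('a) * (L * DIM('a) / 2) ^ DIM('a) * measure lebesgue (N \<inter> ball 0 (real n)))"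
      by (intro hausdorff_content_lipschitz_image_le lipschitz_on_subset[OF f]) (auto simp: bounded_Int negligible_iff_measure)
    also have "measure lebesgue (N \<inter> ball 0 (real n)) = 0" using neg by (simp add: negligible_iff_measure)
    finally show ?thesis by simp
  qed
  have "N = (\<Union>n. N \<inter> ball 0 (real n))" using reals_Archimedean2 by (auto simp: dist_norm)
  then have "f ` N = (\<Union>n. f ` (N \<inter> ball 0 (real n)))" by blast
  then have "hausdorff_content DIM('a) (f ` N) \<le> (\<Sum>n. hausdorff_content DIM('a) (f ` (N \<inter> ball 0 (real n))))"
    using hausdorff_content_UN by metis
  then show ?thesis by (simp add: 0)
qed

text \<open>Direction, scale and speed are fixed, so the set is closed for continuous
  \<open>G\<close>.\<close>

definition slow_set :: "('a::real_normed_vector \<Rightarrow> 'b::real_normed_vector) \<Rightarrow> 'a \<Rightarrow> nat \<Rightarrow> real \<Rightarrow> 'a set" where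
  "slow_set G v n e = {x. \<forall>t. \<bar>t\<bar> < 1 / real (Suc n) \<longrightarrow> norm (G (x + t *\<^sub>R v) - G x) \<le> e * \<bar>t\<bar>}"

lemma closed_slow_set:
  assumes "continuous_on UNIV G"
  shows "closed (slow_set G v n e)"
  unfolding slow_set_def
  by (intro closed_Collect_all closed_Collect_imp open_Collect_const closed_Collect_le continuous_intros
      continuous_on_compose2[OF assms]) auto

text \<open>A unit kernel vector need not lie in the countable dense set V. A nearby v in V still
  has |D v| \<le> e/2, and the other e/2 pays for the error of the linear approximation.\<close>

lemma mem_slow_set_if_kernel:
  fixes G :: "'a::euclidean_space \<Rightarrow> 'b::euclidean_space"
  assumes D: "(G has_derivative D) (at x)" "\<not> inj D" and e: "e > 0"
    and V: "V \<subseteq> sphere 0 1" "sphere 0 1 \<subseteq> closure V"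
  shows "\<exists>v\<in>V. \<exists>n. x \<in> slow_set G v n e"
proof -
  have linD: "linear D" using D(1) by (rule has_derivative_linear)
  obtain w where w: "w \<noteq> 0" "D w = 0" using D(2) linear_injective_0[OF linD] by blast
  define u where "u = w /\<^sub>R norm w"
  have u: "norm u = 1" "D u = 0" using w by (auto simp: u_def linear_scale[OF linD])
  obtain K where K: "K > 0" "\<And>v. norm (D v) \<le> K * norm v" using linear_bounded_pos[OF linD] by blast
  have "u \<in> closure V" using u(1) V(2) by auto
  then obtain v where v: "v \<in> V" "dist v u < e / (2 * K)"
    using e K(1) unfolding closure_approachable by (metis divide_pos_pos mult_pos_pos zero_less_numeral)
  have nv: "norm v = 1" using v(1) V(1) by auto
  have Dv: "norm (D v) \<le> e / 2"
  proof -
    have "D v = D (v - u)" using u(2) by (simp add: linear_diff[OF linD])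
    then have "norm (D v) \<le> K * norm (v - u)" using K(2) by metis
    also have "\<dots> \<le> K * (e / (2 * K))" using v(2) K(1) by (intro mult_left_mono) (auto simp: dist_norm)
    also have "\<dots> = e / 2" using K(1) by simp
    finally show ?thesis .
  qed
  obtain d where d: "d > 0" "\<And>y. norm (y - x) < d \<Longrightarrow> norm (G y - G x - D (y - x)) \<le> e / 2 * norm (y - x)"
    using D(1) half_gt_zero[OF e] unfolding has_derivative_at_alt by blast
  obtain n where n: "1 / real (Suc n) < d" using nat_approx_posE[OF d(1)] by auto
  have "norm (G (x + t *\<^sub>R v) - G x) \<le> e * \<bar>t\<bar>" if t: "\<bar>t\<bar> < 1 / real (Suc n)" for t
  proof -
    have "norm (G (x + t *\<^sub>R v) - G x - t *\<^sub>R D v) \<le> e / 2 * \<bar>t\<bar>"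
      using d(2)[of "x + t *\<^sub>R v"] t n nv by (simp add: linear_scale[OF linD])
    moreover have "norm (t *\<^sub>R D v) \<le> e / 2 * \<bar>t\<bar>"
      using mult_left_mono[OF Dv, of "\<bar>t\<bar>"] by (simp add: mult.commute)
    moreover have "norm (G (x + t *\<^sub>R v) - G x) \<le> norm (G (x + t *\<^sub>R v) - G x - t *\<^sub>R D v) + norm (t *\<^sub>R D v)"
      using norm_triangle_ineq[of "G (x + t *\<^sub>R v) - G x - t *\<^sub>R D v" "t *\<^sub>R D v"] by simp
    ultimately show ?thesis by (simp add: field_simps)
  qed
  then have "x \<in> slow_set G v n e" by (simp add: slow_set_def)
  with v(1) show ?thesis by blast
qed

text \<open>\<open>E\<close> is cut into countably many disjoint pieces, on each of which \<open>G\<close> is slow in a fixed direction.\<close>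

lemma hausdorff_content_degenerate_le:
  fixes G :: "'b::euclidean_space \<Rightarrow> 'c::euclidean_space" and f :: "'b \<Rightarrow> 'a::metric_space" and C :: real
  assumes E: "E \<in> lmeasurable" and G: "continuous_on UNIV G" and C: "C \<ge> 0" and e: "e > 0"
    and D: "\<And>x. x \<in> E \<Longrightarrow> \<exists>D. (G has_derivative D) (at x) \<and> \<not> inj D"
    and piece: "\<And>S v. S \<subseteq> E \<Longrightarrow> S \<in> lmeasurable \<Longrightarrow> norm v = 1 \<Longrightarrow>
      (\<And>y t. y \<in> S \<Longrightarrow> y + t *\<^sub>R v \<in> S \<Longrightarrow> norm (G (y + t *\<^sub>R v) - G y) \<le> e * \<bar>t\<bar>) \<Longrightarrow>
      hausdorff_content k (f ` S) \<le> ennreal (C * measure lebesgue S)"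
  shows "hausdorff_content k (f ` E) \<le> ennreal (C * measure lebesgue E)"
proof -
  obtain V where V: "countable V" "V \<subseteq> sphere (0::'b) 1" "sphere 0 1 \<subseteq> closure V" by (rule separable)
  obtain Q where Q': "countable Q" "Q \<subseteq> UNIV" "(UNIV :: 'b set) \<subseteq> closure Q" by (rule separable)
  then have Q: "countable Q" "(UNIV :: 'b set) \<subseteq> closure Q" by auto
  obtain v0 :: 'b where "v0 \<in> sphere 0 1" using vector_choose_size[of 1] by (metis mem_sphere_0 zero_le_one)
  then have "V \<noteq> {}" using V(3) by (metis closure_empty empty_iff subsetD)
  moreover have "Q \<noteq> {}" using Q(2) by (metis UNIV_I closure_empty empty_iff subsetD)
  ultimately have ne: "V \<times> (UNIV :: nat set) \<times> Q \<noteq> {}" by auto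
  have ct: "countable (V \<times> (UNIV :: nat set) \<times> Q)" using V(1) Q(1) by auto
  \<comment> \<open>The balls have radius half the scale of the slow set, so any two points of a
    piece are within that scale.\<close>
  define P where "P = (\<lambda>(v, n, q). E \<inter> slow_set G v n e \<inter> ball q (1 / (2 * real (Suc n))))"
  define A where "A i = P (from_nat_into (V \<times> UNIV \<times> Q) i)" for i
  \<comment> \<open>Disjoint pieces let the bounds add up to the measure of \<open>E\<close> with
    the same constant.\<close>
  define B where "B = disjointed A"
  have PE: "P x \<subseteq> E" for x by (auto simp: P_def split: prod.split)
  have P_meas: "P x \<in> sets lebesgue" for x
    using E closed_slow_set[OF G] by (auto simp: P_def split: prod.split intro!: sets.Int)
  have A_meas: "range A \<subseteq> sets lebesgue" unfolding A_def using P_meas by blast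
  have B_meas: "B i \<in> sets lebesgue" for i
    unfolding B_def using sets.range_disjointed_sets[OF A_meas] by blast
  have BA: "B i \<subseteq> A i" for i unfolding B_def by (rule disjointed_subset)
  have BE: "B i \<subseteq> E" for i by (rule order.trans[OF BA]) (simp only: A_def PE)
  have B_lm: "B i \<in> lmeasurable" for i using fmeasurableI2[OF E BE B_meas] .
  have EA: "E \<subseteq> (\<Union>i. A i)"
  proof
    fix x assume x: "x \<in> E"
    obtain v n where v: "v \<in> V" "x \<in> slow_set G v n e"
      using D[OF x] mem_slow_set_if_kernel[OF _ _ e V(2,3)] by blast
    have "x \<in> closure Q" using Q(2) by blast
    then obtain q where q: "q \<in> Q" "dist q x < 1 / (2 * real (Suc n))"
      unfolding closure_approachable by (metis divide_pos_pos mult_pos_pos of_nat_0_less_iff zero_less_Suc zero_less_numeral zero_less_one)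
    have "x \<in> P (v, n, q)" using x v q by (simp add: P_def)
    moreover obtain i where "from_nat_into (V \<times> UNIV \<times> Q) i = (v, n, q)"
      using v q ct from_nat_into_surj[of "V \<times> UNIV \<times> Q" "(v, n, q)"] by auto
    ultimately have "x \<in> A i" by (simp add: A_def)
    then show "x \<in> (\<Union>i. A i)" by blast
  qed
  have "(\<Union>i. B i) = (\<Union>i. A i)" unfolding B_def by (rule UN_disjointed_eq)
  moreover have "(\<Union>i. B i) \<subseteq> E" using BE by blast
  ultimately have EB: "E = (\<Union>i. B i)" using EA by auto
  have bound: "hausdorff_content k (f ` B i) \<le> ennreal (C * measure lebesgue (B i))" for i
  proof -
    obtain v q and n :: nat where vnq: "from_nat_into (V \<times> UNIV \<times> Q) i = (v, n, q)" by (metis prod_cases3)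
    then have v: "v \<in> V" using from_nat_into[OF ne, of i] by auto
    then have nv: "norm v = 1" using V(2) by auto
    have Bi: "B i \<subseteq> slow_set G v n e" "B i \<subseteq> ball q (1 / (2 * real (Suc n)))"
      using BA[of i] vnq by (auto simp: A_def P_def)
    show ?thesis
    proof (rule piece[OF BE B_lm nv])
      fix y t assume yt: "y \<in> B i" "y + t *\<^sub>R v \<in> B i"
      then have yq: "dist q y < 1 / (2 * real (Suc n))" "dist q (y + t *\<^sub>R v) < 1 / (2 * real (Suc n))"
        using Bi(2) by auto
      have "\<bar>t\<bar> = dist y (y + t *\<^sub>R v)" using nv by (simp add: dist_norm)
      also have "\<dots> \<le> dist q y + dist q (y + t *\<^sub>R v)" by metric
      also have "\<dots> < 1 / (2 * real (Suc n)) + 1 / (2 * real (Suc n))" using yq by linarith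
      also have "\<dots> = 1 / real (Suc n)" by (simp add: field_simps)
      finally show "norm (G (y + t *\<^sub>R v) - G y) \<le> e * \<bar>t\<bar>"
        using Bi(1) yt(1) by (auto simp: slow_set_def)
    qed
  qed
  have "f ` E = (\<Union>i. f ` B i)" using EB by blast
  then have "hausdorff_content k (f ` E) \<le> (\<Sum>i. hausdorff_content k (f ` B i))"
    using hausdorff_content_UN by metis
  also have "\<dots> \<le> (\<Sum>i. ennreal C * emeasure lebesgue (B i))"
  proof (intro suminf_le summableI)
    show "hausdorff_content k (f ` B i) \<le> ennreal C * emeasure lebesgue (B i)" for i
      using bound[of i] C by (simp add: emeasure_eq_measure2[OF B_lm] ennreal_mult)
  qed
  also have "\<dots> = ennreal C * (\<Sum>i. emeasure lebesgue (B i))" by (rule ennreal_suminf_cmult)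
  also have "(\<Sum>i. emeasure lebesgue (B i)) = emeasure lebesgue E"
    unfolding EB by (rule suminf_emeasure) (use B_meas in \<open>auto simp: B_def disjoint_family_disjointed\<close>)
  also have "ennreal C * emeasure lebesgue E = ennreal (C * measure lebesgue E)"
    using C by (simp add: emeasure_eq_measure2[OF E] ennreal_mult)
  finally show ?thesis .
qed

subsection \<open>The equivalence\<close>

lemma rank_matrix_less_iff:
  fixes D :: "real^'k \<Rightarrow> real^'n"
  assumes "linear D"
  shows "rank (matrix D) < CARD('k) \<longleftrightarrow> \<not> inj D"
proof -
  have "(*v) (matrix D) = D" using matrix_vector_mul(2)[OF assms] by simp
  then show ?thesis by (simp add: less_rank_noninjective)
qed

theorem theorem4p2:
  fixes \<Phi> :: "'a::complete_space \<Rightarrow> real^'n"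
    and C\<^sub>\<Phi> :: real
    and E :: "(real^'k) set"
    and f :: "real^'k \<Rightarrow> 'a"
  assumes quasiconvex: "quasiconvex_space TYPE('a)"
    and lipschitz_Phi: "\<exists>B. B-lipschitz_on UNIV \<Phi>"
    and C_pos: "C\<^sub>\<Phi> > 0"
    and length_bound: "\<And>\<gamma> :: real \<Rightarrow> 'a. rectifiable_curve \<gamma> \<Longrightarrow>
      curve_length \<gamma> \<le> ennreal C\<^sub>\<Phi> * curve_length (\<Phi> \<circ> \<gamma>)"
    and measurable_E: "E \<in> sets lebesgue"
    and lipschitz_f: "\<exists>B. B-lipschitz_on E f"
  shows "(hausdorff_measure CARD('k) (f ` E) = 0 \<longleftrightarrow>
            hausdorff_measure CARD('k) (\<Phi> ` f ` E) = 0) \<and>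
         (hausdorff_measure CARD('k) (\<Phi> ` f ` E) = 0 \<longleftrightarrow>
            (AE x in lebesgue_on E. approx_differentiable_vec E (\<Phi> \<circ> f) x \<and>
               rank (matrix (approx_derivative_vec E (\<Phi> \<circ> f) x)) < CARD('k)))"
proof -
  let ?hc = "hausdorff_content CARD('k)" and ?h = "\<Phi> \<circ> f"
  let ?c3 = "\<lambda>x. approx_differentiable_vec E ?h x \<and> rank (matrix (approx_derivative_vec E ?h x)) < CARD('k)"
  obtain B where B: "B-lipschitz_on UNIV \<Phi>" using lipschitz_Phi by blast
  obtain L where L: "L-lipschitz_on E f" using lipschitz_f by blast
  have B0: "B \<ge> 0" and L0: "L \<ge> 0" using B L by (auto intro: lipschitz_on_nonneg)
  obtain M and \<Gamma> :: "'a \<Rightarrow> 'a \<Rightarrow> real \<Rightarrow> 'a" where M: "M \<ge> 1"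
    and "\<forall>x y. (M * dist x y)-lipschitz_on {0..1} (\<Gamma> x y) \<and> \<Gamma> x y 0 = x \<and> \<Gamma> x y 1 = y"
    by (rule quasiconvex_lipschitz_path[OF quasiconvex])
  then have \<Gamma>: "\<And>x y. (M * dist x y)-lipschitz_on {0..1} (\<Gamma> x y)" "\<And>x y. \<Gamma> x y 0 = x" "\<And>x y. \<Gamma> x y 1 = y"
    by blast+
  have "(B * L)-lipschitz_on E ?h" by (rule lipschitz_on_compose[OF L lipschitz_on_subset[OF B subset_UNIV]])
  then obtain G where Gh': "\<forall>x\<in>E. G x = ?h x" and contG: "continuous_on UNIV G"
    and negG: "negligible {x. \<not> G differentiable (at x)}"
    by (rule lipschitz_extension_ae_differentiable)
  have Gh: "G x = ?h x" if "x \<in> E" for x using Gh' that by blast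
  define D where "D x = frechet_derivative G (at x)" for x
  \<comment> \<open>Off this null set the approximate derivative on \<open>E\<close> is the ordinary
    derivative of \<open>G\<close>, so (3) becomes non-injectivity of \<open>D x\<close>.\<close>
  define N0 where "N0 = {x. \<not> G differentiable (at x)} \<union> {x \<in> E. \<not> density_point E x}"
  have negN0: "negligible N0"
    unfolding N0_def using negG negligible_not_density_point[OF measurable_E] by (rule negligible_Un)
  have D: "(G has_derivative D x) (at x)" if "x \<notin> N0" for x
    using that frechet_derivative_works by (auto simp: N0_def D_def)
  have c3_iff: "?c3 x \<longleftrightarrow> \<not> inj (D x)" if x: "x \<in> E" "x \<notin> N0" for x
  proof -
    have "density_point E x" using x by (auto simp: N0_def)
    note * = approx_derivative_vec_eqI[where h = ?h, OF measurable_E x(1) this D[OF x(2)] Gh]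
    show ?thesis
      using *(1) rank_matrix_less_iff[OF has_derivative_linear[OF D[OF x(2)]]] by (simp add: *(2))
  qed
  have 12: "?hc (\<Phi> ` f ` E) = 0" if "?hc (f ` E) = 0"
    using hausdorff_content_lipschitz_null[OF lipschitz_on_subset[OF B subset_UNIV] that] .
  have 23: "AE x in lebesgue_on E. ?c3 x" if 2: "?hc (\<Phi> ` f ` E) = 0"
  proof -
    define R where "R = {x \<in> E. x \<notin> N0 \<and> inj (D x)}"
    have "G ` E = \<Phi> ` f ` E" using Gh by (auto simp: image_image)
    then have "hausdorff_content DIM(real^'k) (G ` E) = 0" using 2 by simp
    then have "negligible R" by (rule negligible_full_rank) (use D in \<open>auto simp: R_def\<close>)
    then have "negligible (N0 \<union> R)" using negN0 by (intro negligible_Un)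
    then have "AE x in lebesgue. x \<notin> N0 \<union> R" unfolding negligible_iff_null_sets by (rule AE_not_in)
    then have "AE x in lebesgue. x \<in> E \<longrightarrow> ?c3 x"
      by eventually_elim (use c3_iff in \<open>auto simp: R_def\<close>)
    then show ?thesis using measurable_E by (subst AE_restrict_space_iff) auto
  qed
  have 31: "?hc (f ` E) = 0" if 3: "AE x in lebesgue_on E. ?c3 x"
  proof -
    have "AE x in lebesgue. x \<in> E \<longrightarrow> ?c3 x"
      using 3 measurable_E by (subst (asm) AE_restrict_space_iff) auto
    then obtain N1 where N1: "N1 \<in> null_sets lebesgue" "{x. \<not> (x \<in> E \<longrightarrow> ?c3 x)} \<subseteq> N1"
      by (auto simp: eventually_ae_filter)
    define N where "N = N0 \<union> N1"
    have negN: "negligible N" unfolding N_def using negN0 N1(1) by (intro negligible_Un) (auto simp: negligible_iff_null_sets)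
    then have N_meas: "N \<in> sets lebesgue" by (simp add: negligible_imp_sets)
    have deg: "(G has_derivative D x) (at x) \<and> \<not> inj (D x)" if "x \<in> E - N" for x
      using that D[of x] c3_iff[of x] N1(2) by (auto simp: N_def)
    \<comment> \<open>One constant for both terms of the chord bound, whose coefficients are 1 and B
      M L.\<close>
    define D0 where "D0 = C\<^sub>\<Phi> * (1 + B * M * L)"
    have BML: "B * M * L \<ge> 0" using B0 L0 M by simp
    have D0: "D0 \<ge> 0" unfolding D0_def using C_pos BML by simp
    \<comment> \<open>Independent of m, so K / m tends to 0.\<close>
    define K where "K = unit_ball_vol CARD('k) * (4 * L * CARD('k) + 2 * D0) ^ CARD('k) *
        (2 ^ CARD('k) * (unit_ball_vol CARD('k) * (CARD('k) / 2) ^ CARD('k)))"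
    have K: "K \<ge> 0" unfolding K_def using L0 D0 by simp
    have piece: "?hc (f ` S) \<le> ennreal (K / m * measure lebesgue S)"
      if S: "S \<subseteq> E" "S \<in> lmeasurable" "bounded S" and m: "m \<ge> 8" and v: "norm v = 1"
        and slow: "\<And>y t. y \<in> S \<Longrightarrow> y + t *\<^sub>R v \<in> S \<Longrightarrow> norm (G (y + t *\<^sub>R v) - G y) \<le> 1 / real m * \<bar>t\<bar>"
      for S m v
      unfolding K_def
    proof (rule hausdorff_content_image_direction[OF S(2,3) lipschitz_on_subset[OF L S(1)] D0 v m])
      fix T a b y
      assume T: "compact T" "a \<in> T" "b \<in> T" "a \<le> b" "\<And>t. t \<in> T \<Longrightarrow> y + t *\<^sub>R v \<in> S"
      define c where "c t = f (y + t *\<^sub>R v)" for t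
      have cL: "L-lipschitz_on T c"
      proof (rule lipschitz_onI[OF _ L0])
        fix s t assume "s \<in> T" "t \<in> T"
        then show "dist (c s) (c t) \<le> L * dist s t"
          using lipschitz_onD[OF L, of "y + s *\<^sub>R v" "y + t *\<^sub>R v"] T(5) S(1) v
          by (auto simp: c_def dist_norm simp flip: scaleR_diff_left)
      qed
      have ce: "(1 / real m)-lipschitz_on T (\<Phi> \<circ> c)"
      proof (rule lipschitz_onI)
        fix s t assume st: "s \<in> T" "t \<in> T"
        have eq: "y + s *\<^sub>R v + (t - s) *\<^sub>R v = y + t *\<^sub>R v" by (simp add: algebra_simps)
        have "norm (G (y + t *\<^sub>R v) - G (y + s *\<^sub>R v)) \<le> 1 / real m * \<bar>t - s\<bar>"
          using slow[of "y + s *\<^sub>R v" "t - s"] T(5) st by (simp add: eq)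
        moreover have "G (y + t *\<^sub>R v) = \<Phi> (c t)" "G (y + s *\<^sub>R v) = \<Phi> (c s)"
          using Gh T(5) st S(1) by (auto simp: c_def)
        ultimately show "dist ((\<Phi> \<circ> c) s) ((\<Phi> \<circ> c) t) \<le> 1 / real m * dist s t"
          by (simp add: dist_norm norm_minus_commute abs_minus_commute)
      qed simp
      let ?\<mu> = "measure lebesgue ({a..b} - T)" and ?l = "1 / real m * (b - a)"
      have "dist (c a) (c b) \<le> C\<^sub>\<Phi> * (?l + B * M * L * ?\<mu>)"
        using C_pos by (intro chord_bound[OF M \<Gamma> B _ length_bound T(1-4) cL ce]) auto
      also have "\<dots> \<le> C\<^sub>\<Phi> * ((1 + B * M * L) * ?l + (1 + B * M * L) * ?\<mu>)"
      proof (intro mult_left_mono add_mono)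
        have "?l \<ge> 0" using T(4) by simp
        then show "?l \<le> (1 + B * M * L) * ?l" using BML mult_right_mono[of 1 "1 + B * M * L" ?l] by simp
        show "B * M * L * ?\<mu> \<le> (1 + B * M * L) * ?\<mu>" by (intro mult_right_mono) auto
      qed (use C_pos in simp)
      also have "\<dots> = D0 * (?l + ?\<mu>)" by (simp add: D0_def algebra_simps)
      finally show "dist (f (y + a *\<^sub>R v)) (f (y + b *\<^sub>R v)) \<le> D0 * (?l + ?\<mu>)" by (simp add: c_def)
    qed
    \<comment> \<open>The estimates for pieces ask for bounded sets of finite measure, so
      \<open>E - N\<close> is exhausted by balls.\<close>
    have ball: "?hc (f ` ((E - N) \<inter> ball 0 (real n))) = 0" for n
    proof -
      define S where "S = (E - N) \<inter> ball 0 (real n)"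
      have S: "S \<in> lmeasurable" "S \<subseteq> E" "bounded S"
        using measurable_E N_meas by (auto simp: S_def bounded_Int intro!: bounded_set_imp_lmeasurable)
      have le: "?hc (f ` S) \<le> ennreal (K / m * measure lebesgue S)" if m: "m \<ge> 8" for m :: nat
      proof (rule hausdorff_content_degenerate_le[OF S(1) contG, where e = "1 / real m"])
        show "\<exists>D. (G has_derivative D) (at x) \<and> \<not> inj D" if "x \<in> S" for x
          using deg[of x] that by (auto simp: S_def)
        show "?hc (f ` S') \<le> ennreal (K / m * measure lebesgue S')"
          if "S' \<subseteq> S" "S' \<in> lmeasurable" "norm v = 1"
            "\<And>y t. y \<in> S' \<Longrightarrow> y + t *\<^sub>R v \<in> S' \<Longrightarrow> norm (G (y + t *\<^sub>R v) - G y) \<le> 1 / real m * \<bar>t\<bar>" for S' v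
          using that S(2,3) by (intro piece[OF _ that(2) _ m that(3)]) (auto intro: bounded_subset)
      qed (use K m in auto)
      have "?hc (f ` S) \<le> 0"
      proof (rule ennreal_le_epsilon)
        fix \<epsilon> :: real assume \<epsilon>: "\<epsilon> > 0"
        obtain m :: nat where m: "real m \<ge> max 8 (K * measure lebesgue S / \<epsilon>)" using real_arch_simple by blast
        then have m8: "m \<ge> 8" by simp
        then have "K * measure lebesgue S \<le> \<epsilon> * m" using m \<epsilon> by (simp add: pos_divide_le_eq mult.commute)
        then have "K / m * measure lebesgue S \<le> \<epsilon>" using m8 by (simp add: pos_divide_le_eq)
        then show "?hc (f ` S) \<le> 0 + ennreal \<epsilon>"
          using le[OF m8] by (auto intro: order.trans ennreal_leI)
      qed
      then show ?thesis by (simp add: S_def)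
    qed
    have "?hc (f ` (E \<inter> N)) = 0"
      using hausdorff_content_lipschitz_negligible[OF lipschitz_on_subset[OF L Int_lower1] negligible_subset[OF negN Int_lower2]] by simp
    moreover have "?hc (f ` (E - N)) = 0"
    proof -
      have "x \<in> (\<Union>n. ball 0 (real n))" for x :: "real^'k" using reals_Archimedean2[of "norm x"] by auto
      then have "f ` (E - N) = (\<Union>n. f ` ((E - N) \<inter> ball 0 (real n)))" by blast
      then have "?hc (f ` (E - N)) \<le> (\<Sum>n. ?hc (f ` ((E - N) \<inter> ball 0 (real n))))"
        using hausdorff_content_UN by metis
      then show ?thesis by (simp add: ball)
    qed
    moreover have "f ` E = f ` (E \<inter> N) \<union> f ` (E - N)" by blast
    ultimately show ?thesis
      using hausdorff_content_Un[of "CARD('k)" "f ` (E \<inter> N)" "f ` (E - N)"] by simp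
  qed
  have m1: "hausdorff_measure CARD('k) (f ` E) = 0 \<longleftrightarrow> ?hc (f ` E) = 0"
    and m2: "hausdorff_measure CARD('k) (\<Phi> ` f ` E) = 0 \<longleftrightarrow> ?hc (\<Phi> ` f ` E) = 0"
    by (rule hausdorff_measure_eq_0_iff; simp)+
  show ?thesis unfolding m1 m2 using 12 23 31 by blast
qed

end
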